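(* For every $c>0$ there exist constants $C,C_1>0$ depending only on $c$ such that the following holds. Let $G=(V,E)$ be a finite graph with $m=\mathrm{card}(V)$ vertices and Laplacian $\Delta$, and let $W=d\Delta^p$ for some $d>0$, $p>0$. Let $0\le\lambda_1\le\dots\le\lambda_m$ be the eigenvalues of $W$ (repeated with multiplicities), with corresponding orthonormal eigenfunctions $\phi_1,\dots,\phi_m$, and let $k_0$ be the smallest $k$ with $\lambda_k>0$. Assume that for some $\zeta\ge 1$ one has $\lambda_m\le m^{\zeta}$ and $\lambda_{k_0}\ge m^{-\zeta}$; that $s\mapsto s/\lambda_s$ is nonincreasing on $\{k_0,\dots,m\}$; that $\lambda_{k+1}\le c\lambda_k$ for all $k=k_0,\dots,m-1$; and that $$\sum_{k=s}^m\frac1{\lambda_k}\le c\,\frac{s}{\lambda_s}\qquad\text{for all } s\in\{k_0,\dots,m\}.$$ Let $(X,X',Y)\in V\times V\times\{-1,1\}$ be a random triple, where $X,X'$ are independent and uniformly distributed in $V$, and assume that the regression function $S_\ast(u,v)=\mathbb E(Y\mid X=u,X'=v)$, $u,v\in V$, is a symmetric kernel of rank $r\ge1$. Let $L=\mathrm{supp}(S_\ast)$, and let $(X_1,X_1',Y_1),\dots,(X_n,X_n',Y_n)$ be i.i.d. copies of $(X,X',Y)$. Let $\mathbb D$ be a closed convex subset of the space $\mathcal S_V$ of symmetric kernels. Let $t>0$, set $$t_{n,m}:=t+\log\bigl(2m(\log_2(4n^{\zeta}m^{(3/2)\zeta})+2)\bigr),$$ assume that $m\,t_{n,m}\le n$,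 and set $\varepsilon:=4\sqrt{\frac{t+\log(2m)}{nm}}$. Then, for all $s\in\{k_0+1,\dots,m+1\}$ and all $\bar\varepsilon\in[\lambda_s^{-1},\lambda_{s-1}^{-1}]$ (with the convention $\lambda_{m+1}=+\infty$, $\lambda_{m+1}^{-1}=0$), the estimator $$\hat S:=\operatorname{argmin}_{S\in\mathbb D}\Bigl[\|S\|^2_{L_2(\Pi^2)}-\frac2n\sum_{j=1}^nY_jS(X_j,X_j')+\varepsilon\|S\|_1+\bar\varepsilon\|W^{1/2}S\|^2_{L_2(\Pi^2)}\Bigr]$$ satisfies, with probability at least $1-e^{-t}$, $$\|\hat S-S_\ast\|^2_{L_2(\Pi^2)}\le C\,\frac{\bar\varphi(S_\ast;s)\,m\,t_{n,m}}{n}+\bar\varepsilon\,\|W^{1/2}S_\ast\|^2_{L_2(\Pi^2)}+C_1\max_{v\in V}\|P_Le_v\|^2\Bigl(\frac{m\,t_{n,m}}{n}\Bigr)^2.$$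
   Context: Graph Laplacian: $\Delta=D-A$, where $A$ is the adjacency matrix of $G$ and $D$ is the diagonal matrix of vertex degrees. $\mathcal S_V$ is the linear space of symmetric kernels $S:V\times V\to\mathbb R$, identified with real symmetric $m\times m$ matrices. $\|S\|_1$ is the nuclear norm (sum of absolute values of the eigenvalues) and $\|\cdot\|_2$ is the Hilbert–Schmidt (Frobenius) norm. $\Pi$ is the uniform distribution on $V$, $\Pi^2=\Pi\times\Pi$, and for a kernel (matrix) $B$ on $V\times V$, $\|B\|^2_{L_2(\Pi^2)}=\mathbb E|B(X,X')|^2=m^{-2}\|B\|_2^2$; in particular $\|W^{1/2}S\|^2_{L_2(\Pi^2)}=m^{-2}\|W^{1/2}S\|_2^2$, where $W^{1/2}S$ is a matrix product. The support $\mathrm{supp}(S)$ of $S\in\mathcal S_V$ is the linear span in $\mathbb R^V$ of the eigenvectors of $S$ with nonzero eigenvalues. $P_L$ is the orthogonal projector onto the subspace $L$, $\{e_v:v\in V\}$ is the canonical orthonormal basis of $\mathbb R^V$, and $\|x\|$ is the Euclidean norm of $x\in\mathbb R^V$. Coherence function: $\bar\varphi(S_\ast;0)=0$ and, for $k=1,\dots,m$, $$\bar\varphi(S_\ast;k):=\max_{1\le l\le k}\; l\max_{l\le j\le m}\frac1j\sum_{i=1}^j\|P_L\phi_i\|^2,$$ with $l,j$ integers; for $k>m$, $\bar\varphi(S_\ast;k):=\bar\varphi(S_\ast;m)=r$.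
   Formalization: The formal theorem additionally assumes that the target kernel S_* belongs to the closed convex set D; without this the claim fails (e.g. D={0}, G=K_2, Y=1, epsilon-bar=0, n large). *)

theory Defs
  imports
    "HOL-Probability.Probability"
    "Jordan_Normal_Form.Spectral_Radius"
    "Jordan_Normal_Form.Matrix_Kernel"
    "Jordan_Normal_Form.DL_Rank"
begin

text \<open>
  The vertex set is \<open>{..<m}\<close>, so that kernels on \<open>V \<times> V\<close> are real \<open>m \<times> m\<close> matrices and functions
  on \<open>V\<close> are real vectors of dimension \<open>m\<close>.
\<close>

definition simple_graph :: "nat \<Rightarrow> nat set set \<Rightarrow> bool" where
  "simple_graph m E \<longleftrightarrow> (\<forall>e\<in>E. e \<subseteq> {..<m} \<and> card e = 2)"

definition adjacency_mat :: "nat \<Rightarrow> nat set set \<Rightarrow> real mat" where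
  "adjacency_mat m E = mat m m (\<lambda>(u, v). if {u, v} \<in> E then 1 else 0)"

definition degree_mat :: "nat \<Rightarrow> nat set set \<Rightarrow> real mat" where
  "degree_mat m E = mat m m (\<lambda>(u, v). if u = v then real (card {e \<in> E. u \<in> e}) else 0)"

definition laplacian :: "nat \<Rightarrow> nat set set \<Rightarrow> real mat" where
  "laplacian m E = degree_mat m E - adjacency_mat m E"

definition sym_kernels :: "nat \<Rightarrow> real mat set" where
  "sym_kernels m = {S \<in> carrier_mat m m. transpose_mat S = S}"

definition frobenius_sq :: "real mat \<Rightarrow> real" where
  "frobenius_sq B = (\<Sum>u<dim_row B. \<Sum>v<dim_col B. (B $$ (u, v))\<^sup>2)"

text \<open>The squared \<open>L\<^sub>2(\<Pi>\<^sup>2)\<close> norm of a square matrix, \<open>\<Pi>\<close> being uniform on its index set.\<close>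

definition L2_sq :: "real mat \<Rightarrow> real" where
  "L2_sq B = frobenius_sq B / (real (dim_row B))\<^sup>2"

text \<open>
  For a symmetric matrix the characteristic polynomial splits over the reals, and the multiset of
  its roots is the multiset of eigenvalues.
\<close>

definition nuclear_norm :: "real mat \<Rightarrow> real" where
  "nuclear_norm S = (\<Sum>x\<in>#proots (char_poly S). \<bar>x\<bar>)"

definition orth_proj :: "real vec set \<Rightarrow> real vec \<Rightarrow> real vec" where
  "orth_proj L x = (THE y. y \<in> L \<and> (\<forall>z\<in>L. scalar_prod (x - y) z = 0))"

definition norm_sq :: "real vec \<Rightarrow> real" where
  "norm_sq x = scalar_prod x x"

definition support :: "nat \<Rightarrow> real mat \<Rightarrow> real vec set" where
  "support m S = LinearCombinations.module.span class_ring (module_vec TYPE(real) m)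
     {v. \<exists>x. x \<noteq> 0 \<and> eigenvector S v x}"

text \<open>
  Functional calculus for a symmetric matrix: \<open>f(A) = (\<Sum>x. f x P\<^sub>x)\<close>, where \<open>x\<close> ranges over the
  distinct eigenvalues of \<open>A\<close> and \<open>P\<^sub>x\<close> is the orthogonal projector onto the eigenspace of \<open>x\<close>.
\<close>

definition mat_fun :: "(real \<Rightarrow> real) \<Rightarrow> real mat \<Rightarrow> real mat" where
  "mat_fun f A = mat (dim_row A) (dim_row A) (\<lambda>(i, j).
     \<Sum>x\<in>spectrum A. f x * vec_index (orth_proj (mat_kernel (char_matrix A x)) (unit_vec (dim_row A) j)) i)"

text \<open>
  For \<open>p > 0\<close> we have \<open>0 powr p = 0\<close>, so the kernel of the Laplacian is preserved.
\<close>

definition laplacian_power :: "nat \<Rightarrow> nat set set \<Rightarrow> real \<Rightarrow> real \<Rightarrow> real mat" where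
  "laplacian_power m E d p = d \<cdot>\<^sub>m mat_fun (\<lambda>x. x powr p) (laplacian m E)"

definition orthonormal_eigensystem ::
    "nat \<Rightarrow> real mat \<Rightarrow> (nat \<Rightarrow> real) \<Rightarrow> (nat \<Rightarrow> real vec) \<Rightarrow> bool" where
  "orthonormal_eigensystem m W lam \<phi> \<longleftrightarrow>
     mono_on {1..m} lam \<and>
     (\<forall>i\<in>{1..m}. \<phi> i \<in> carrier_vec m \<and> W *\<^sub>v \<phi> i = lam i \<cdot>\<^sub>v \<phi> i) \<and>
     (\<forall>i\<in>{1..m}. \<forall>j\<in>{1..m}. scalar_prod (\<phi> i) (\<phi> j) = (if i = j then 1 else 0))"

definition coherence :: "nat \<Rightarrow> real vec set \<Rightarrow> (nat \<Rightarrow> real vec) \<Rightarrow> nat \<Rightarrow> real" where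
  "coherence m L \<phi> k =
     (if k = 0 then 0
      else MAX l\<in>{1..min k m}. real l *
             (MAX j\<in>{l..m}. (1 / real j) * (\<Sum>i=1..j. norm_sq (orth_proj L (\<phi> i)))))"

text \<open>
  Convexity and closedness are spelled out because matrices of a fixed dimension do not form a type;
  closedness refers to the Frobenius norm.
\<close>

definition convex_mats :: "real mat set \<Rightarrow> bool" where
  "convex_mats D \<longleftrightarrow>
     (\<forall>A\<in>D. \<forall>B\<in>D. \<forall>a\<in>{0..1}. a \<cdot>\<^sub>m A + (1 - a) \<cdot>\<^sub>m B \<in> D)"

definition closed_mats :: "nat \<Rightarrow> real mat set \<Rightarrow> bool" where
  "closed_mats m D \<longleftrightarrow>
     (\<forall>A\<in>carrier_mat m m. (\<forall>e>0. \<exists>B\<in>D. sqrt (frobenius_sq (B - A)) < e) \<longrightarrow> A \<in> D)"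

definition uniform_pair_with_sign_response ::
    "nat \<Rightarrow> 'a measure \<Rightarrow> ('a \<Rightarrow> nat) \<Rightarrow> ('a \<Rightarrow> nat) \<Rightarrow> ('a \<Rightarrow> real) \<Rightarrow> bool" where
  "uniform_pair_with_sign_response m M X X' Y \<longleftrightarrow>
     prob_space.indep_var M (count_space {..<m}) X (count_space {..<m}) X' \<and>
     distr M (count_space {..<m}) X = uniform_count_measure {..<m} \<and>
     distr M (count_space {..<m}) X' = uniform_count_measure {..<m} \<and>
     Y \<in> measurable M (count_space {-1, 1})"

definition iid_copies ::
    "nat \<Rightarrow> 'a measure \<Rightarrow> ('a \<Rightarrow> nat \<times> nat \<times> real) \<Rightarrow> nat \<Rightarrow> (nat \<Rightarrow> 'a \<Rightarrow> nat \<times> nat \<times> real) \<Rightarrow> bool" where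
  "iid_copies m M Z n Zs \<longleftrightarrow>
     (let N = count_space ({..<m} \<times> {..<m} \<times> {-1, 1}) in
       prob_space.indep_vars M (\<lambda>_. N) Zs {1..n} \<and>
       (\<forall>j\<in>{1..n}. distr M N (Zs j) = distr M N Z))"

text \<open>
  The conditioning events have positive probability (for independent uniform \<open>X\<close>, \<open>X'\<close>), so the
  conditional expectation is the elementary one.
\<close>

definition regression_kernel ::
    "nat \<Rightarrow> 'a measure \<Rightarrow> ('a \<Rightarrow> nat) \<Rightarrow> ('a \<Rightarrow> nat) \<Rightarrow> ('a \<Rightarrow> real) \<Rightarrow> real mat" where
  "regression_kernel m M X X' Y = mat m m (\<lambda>(u, v).
     let A = {\<omega> \<in> space M. X \<omega> = u \<and> X' \<omega> = v}
     in (\<integral>\<omega>. Y \<omega> * indicator A \<omega> \<partial>M) / measure M A)"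

definition penalized_risk ::
    "nat \<Rightarrow> (nat \<Rightarrow> nat \<times> nat \<times> real) \<Rightarrow> real \<Rightarrow> real \<Rightarrow> real mat \<Rightarrow> real mat \<Rightarrow> real" where
  "penalized_risk n z \<epsilon> \<epsilon>' W S =
     L2_sq S - (2 / real n) * (\<Sum>j=1..n. case z j of (x, x', y) \<Rightarrow> y * S $$ (x, x'))
     + \<epsilon> * nuclear_norm S + \<epsilon>' * L2_sq (mat_fun sqrt W * S)"

end

theory Submission
  imports Defs
begin

text \<open>
  A sample produces a random symmetric matrix \<open>\<Xi>\<close>, the centred average of the matrices
  \<open>Y (E\<^bsub>u v\<^esub> + E\<^bsub>v u\<^esub>) / 2\<close>, and the objective depends on the sample only through the linear
  functional \<open>S \<mapsto> \<langle>\<Xi>, S\<rangle>\<close>.  Strong convexity of the objective at its minimiser together with the dual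
  description of the nuclear norm, tested at \<open>sgn S\<^sub>* + (2/\<epsilon>) P\<^sup>\<bottom> \<Xi> P\<^sup>\<bottom>\<close>, removes the part of the
  noise orthogonal to \<open>L\<close> as soon as \<open>\<parallel>\<Xi>\<parallel> \<le> \<epsilon>/2\<close>.  The remaining terms \<open>\<langle>\<Xi> - P\<^sup>\<bottom> \<Xi> P\<^sup>\<bottom>, A\<rangle>\<close> and
  \<open>\<epsilon> \<langle>sgn S\<^sub>*, A\<rangle>\<close> are expanded in the eigenbasis \<open>\<phi>\<close> and split by Cauchy-Schwarz with weight \<open>1\<close> for
  \<open>k < s\<close> and \<open>\<epsilon>' \<lambda>\<^sub>k\<close> for \<open>k \<ge> s\<close>; partial summation bounds the resulting weighted sums by the
  coherence function.

  Two tail bounds are needed.  The operator norm is controlled by the Ahlswede-Winter method, that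
  is, by the Golden-Thompson inequality; the second moment of the summands is a multiple of the
  identity, so nothing is lost against the sharper matrix Bernstein inequality.  The weighted
  Hilbert-Schmidt norm of \<open>\<Xi> - P\<^sup>\<bottom> \<Xi> P\<^sup>\<bottom>\<close> is the norm of a sum of independent centred vectors and is
  controlled by Pinelis' argument.
\<close>

section \<open>The spectral theorem\<close>

text \<open>One observation takes finitely many values, so expectations are finite sums and both
  exponential moment bounds come from averaging out one draw at a time. The failure probability
  \<open>exp (- t)\<close> is divided as 3/4 plus 1/4. At the level \<open>\<epsilon> / 2\<close>
  the matrix tail has exponent 5/4 instead of 1, and for \<open>m \<ge> 2\<close> this surplus gains
  the factor 3/4. The logarithmic factor inside the theorem's \<open>tnm\<close> is at least 4,
  which brings the vector tail below the remaining quarter. The bias keeps the factor 1 because the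
  squared error enters twice, once from the difference of the risks and once from the curvature at
  the minimiser. One copy pays for Cauchy-Schwarz, the other is the quantity to be bounded. Nothing
  says that the estimator is measurable. Strong convexity makes the minimiser unique, so the
  estimator is a function of the sample, and on a finite sample space every set of samples is an
  event.\<close>

text \<open>
  Matrices and vectors are plain functions of which only the block \<open>{..<m}\<close> matters; products sum
  over this block, so that the algebraic laws hold without carrier conditions.
\<close>

definition ip :: "nat \<Rightarrow> (nat \<Rightarrow> real) \<Rightarrow> (nat \<Rightarrow> real) \<Rightarrow> real" where
  "ip m x y = (\<Sum>i<m. x i * y i)"

abbreviation nsq :: "nat \<Rightarrow> (nat \<Rightarrow> real) \<Rightarrow> real" where
  "nsq m x \<equiv> ip m x x"

definition kapp :: "nat \<Rightarrow> (nat \<Rightarrow> nat \<Rightarrow> real) \<Rightarrow> (nat \<Rightarrow> real) \<Rightarrow> nat \<Rightarrow> real" where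
  "kapp m A x i = (\<Sum>j<m. A i j * x j)"

definition kmult :: "nat \<Rightarrow> (nat \<Rightarrow> nat \<Rightarrow> real) \<Rightarrow> (nat \<Rightarrow> nat \<Rightarrow> real) \<Rightarrow> nat \<Rightarrow> nat \<Rightarrow> real" where
  "kmult m A B i j = (\<Sum>k<m. A i k * B k j)"

definition ktrace :: "nat \<Rightarrow> (nat \<Rightarrow> nat \<Rightarrow> real) \<Rightarrow> real" where
  "ktrace m A = (\<Sum>i<m. A i i)"

definition ksym :: "nat \<Rightarrow> (nat \<Rightarrow> nat \<Rightarrow> real) \<Rightarrow> bool" where
  "ksym m A \<longleftrightarrow> (\<forall>i<m. \<forall>j<m. A i j = A j i)"

definition orthonormal_on :: "nat \<Rightarrow> 'i set \<Rightarrow> ('i \<Rightarrow> nat \<Rightarrow> real) \<Rightarrow> bool" where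
  "orthonormal_on m I \<psi> \<longleftrightarrow> (\<forall>k\<in>I. \<forall>l\<in>I. ip m (\<psi> k) (\<psi> l) = (if k = l then 1 else 0))"

definition spec :: "'i set \<Rightarrow> ('i \<Rightarrow> real) \<Rightarrow> ('i \<Rightarrow> nat \<Rightarrow> real) \<Rightarrow> nat \<Rightarrow> nat \<Rightarrow> real" where
  "spec I a \<psi> i j = (\<Sum>k\<in>I. a k * \<psi> k i * \<psi> k j)"

section \<open>Inner products and orthonormal systems\<close>

lemma sum_mult_delta:
  fixes f :: "'i \<Rightarrow> real"
  assumes "finite I" "l \<in> I"
  shows "(\<Sum>k\<in>I. f k * (if k = l then 1 else 0)) = f l"
    and "(\<Sum>k\<in>I. f k * (if l = k then 1 else 0)) = f l"
    and "(\<Sum>k\<in>I. (if k = l then 1 else 0) * f k) = f l"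
    and "(\<Sum>k\<in>I. (if l = k then 1 else 0) * f k) = f l"
proof -
  have "(\<Sum>k\<in>I. if k = l then f k else 0) = f l" using assms by simp
  moreover have "f k * (if k = l then 1 else 0) = (if k = l then f k else 0)"
    "f k * (if l = k then 1 else 0) = (if k = l then f k else 0)"
    "(if k = l then 1 else 0) * f k = (if k = l then f k else 0)"
    "(if l = k then 1 else 0) * f k = (if k = l then f k else 0)" for k by auto
  ultimately show "(\<Sum>k\<in>I. f k * (if k = l then 1 else 0)) = f l"
    and "(\<Sum>k\<in>I. f k * (if l = k then 1 else 0)) = f l"
    and "(\<Sum>k\<in>I. (if k = l then 1 else 0) * f k) = f l"
    and "(\<Sum>k\<in>I. (if l = k then 1 else 0) * f k) = f l" by simp_all
qed

lemma ip_commute: "ip m x y = ip m y x"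
  by (simp add: ip_def mult.commute)

lemma ip_sum_right: "ip m x (\<lambda>i. \<Sum>k\<in>I. c k * f k i) = (\<Sum>k\<in>I. c k * ip m x (f k))"
proof -
  have "ip m x (\<lambda>i. \<Sum>k\<in>I. c k * f k i) = (\<Sum>i<m. \<Sum>k\<in>I. c k * (x i * f k i))"
    by (simp add: ip_def sum_distrib_left mult_ac)
  also have "\<dots> = (\<Sum>k\<in>I. \<Sum>i<m. c k * (x i * f k i))" by (rule sum.swap)
  finally show ?thesis by (simp add: ip_def sum_distrib_left)
qed

lemma ip_add_right: "ip m x (\<lambda>i. y i + z i) = ip m x y + ip m x z"
  by (simp add: ip_def algebra_simps sum.distrib)

lemma ip_diff_right: "ip m x (\<lambda>i. y i - z i) = ip m x y - ip m x z"
  by (simp add: ip_def algebra_simps sum_subtractf)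

lemma ip_scale_right: "ip m x (\<lambda>i. c * y i) = c * ip m x y"
  by (simp add: ip_def sum_distrib_left mult_ac)

lemma ip_add_left: "ip m (\<lambda>i. y i + z i) x = ip m y x + ip m z x"
  by (simp add: ip_def algebra_simps sum.distrib)

lemma ip_diff_left: "ip m (\<lambda>i. y i - z i) x = ip m y x - ip m z x"
  by (simp add: ip_def algebra_simps sum_subtractf)

lemma ip_scale_left: "ip m (\<lambda>i. c * y i) x = c * ip m y x"
  by (simp add: ip_def sum_distrib_left mult_ac)

lemma ip_self_nonneg: "0 \<le> nsq m x"
  by (simp add: ip_def sum_nonneg)

lemma ip_self_zero: "nsq m x = 0 \<Longrightarrow> i < m \<Longrightarrow> x i = 0"
  by (simp add: ip_def sum_nonneg_eq_0_iff)

lemma ip_cong: "(\<And>i. i < m \<Longrightarrow> x i = x' i) \<Longrightarrow> (\<And>i. i < m \<Longrightarrow> y i = y' i) \<Longrightarrow> ip m x y = ip m x' y'"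
  by (simp add: ip_def)

lemma ip_kapp: assumes "ksym m A" shows "ip m x (kapp m A y) = ip m (kapp m A x) y"
proof -
  have "ip m x (kapp m A y) = (\<Sum>i<m. \<Sum>j<m. A i j * x i * y j)"
    by (simp add: ip_def kapp_def sum_distrib_left mult_ac)
  also have "\<dots> = (\<Sum>j<m. \<Sum>i<m. A i j * x i * y j)" by (rule sum.swap)
  also have "\<dots> = (\<Sum>j<m. \<Sum>i<m. A j i * x i * y j)"
    using assms unfolding ksym_def by (intro sum.cong refl) auto
  finally show ?thesis by (simp add: ip_def kapp_def sum_distrib_right)
qed

lemma residual_norm:
  fixes x :: "nat \<Rightarrow> real"
  assumes "finite I" "orthonormal_on m I \<psi>"
  defines "p \<equiv> \<lambda>i. \<Sum>k\<in>I. ip m x (\<psi> k) * \<psi> k i"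
  shows "nsq m (\<lambda>i. x i - p i) = nsq m x - (\<Sum>k\<in>I. (ip m x (\<psi> k))\<^sup>2)"
    and "l \<in> I \<Longrightarrow> ip m (\<psi> l) (\<lambda>i. x i - p i) = 0"
proof -
  have r: "ip m (\<psi> l) p = ip m x (\<psi> l)" if "l \<in> I" for l
  proof -
    have "ip m (\<psi> l) p = (\<Sum>k\<in>I. ip m x (\<psi> k) * (if l = k then 1 else 0))"
      unfolding p_def ip_sum_right using assms(2) that by (intro sum.cong refl) (simp add: orthonormal_on_def)
    then show ?thesis using assms(1) that by (simp only: sum_mult_delta)
  qed
  then show "l \<in> I \<Longrightarrow> ip m (\<psi> l) (\<lambda>i. x i - p i) = 0"
    by (simp add: ip_diff_right ip_commute)
  have a: "ip m x p = (\<Sum>k\<in>I. (ip m x (\<psi> k))\<^sup>2)"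
    unfolding p_def ip_sum_right by (simp add: power2_eq_square)
  have "nsq m p = (\<Sum>k\<in>I. ip m x (\<psi> k) * ip m p (\<psi> k))"
    by (subst (2) p_def) (simp only: ip_sum_right)
  also have "\<dots> = (\<Sum>k\<in>I. (ip m x (\<psi> k))\<^sup>2)"
    by (intro sum.cong refl) (simp add: power2_eq_square r ip_commute[of m p])
  finally show "nsq m (\<lambda>i. x i - p i) = nsq m x - (\<Sum>k\<in>I. (ip m x (\<psi> k))\<^sup>2)"
    using a by (simp add: ip_diff_right ip_diff_left ip_commute[of m p x])
qed

lemma ip_unit: "j < m \<Longrightarrow> ip m (\<lambda>i. if i = j then 1 else 0) x = x j"
proof -
  have "ip m (\<lambda>i. if i = j then 1 else 0) x = (\<Sum>i<m. if i = j then x i else 0)"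
    unfolding ip_def by (intro sum.cong refl) auto
  then show "j < m \<Longrightarrow> ?thesis" by simp
qed

lemma sum_sq_coords: "orthonormal_on m I \<psi> \<Longrightarrow> (\<Sum>j<m. \<Sum>k\<in>I. (\<psi> k j)\<^sup>2) = card I"
proof -
  assume o: "orthonormal_on m I \<psi>"
  have "(\<Sum>j<m. \<Sum>k\<in>I. (\<psi> k j)\<^sup>2) = (\<Sum>k\<in>I. \<Sum>j<m. (\<psi> k j)\<^sup>2)" by (rule sum.swap)
  also have "\<dots> = (\<Sum>k\<in>I. 1)"
    using o by (intro sum.cong refl) (simp add: orthonormal_on_def ip_def power2_eq_square)
  finally show ?thesis by simp
qed

text \<open>The squared distances of the unit vectors \<open>e j\<close> from the span are
  nonnegative and add up to \<open>m - card I = 0\<close>, so each of them vanishes.\<close>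

lemma completeness:
  assumes "finite I" "card I = m" and o: "orthonormal_on m I \<psi>" and "i < m" "j < m"
  shows "(\<Sum>k\<in>I. \<psi> k i * \<psi> k j) = (if i = j then 1 else 0)"
proof -
  define e where "e j = (\<lambda>i. if i = j then 1 else (0::real))" for j :: nat
  define r where "r j = (\<lambda>i. e j i - (\<Sum>k\<in>I. ip m (e j) (\<psi> k) * \<psi> k i))" for j
  have n: "nsq m (r j) = 1 - (\<Sum>k\<in>I. (\<psi> k j)\<^sup>2)" if "j < m" for j
  proof -
    have "nsq m (e j) = 1" using ip_unit[OF that, of "e j"] by (simp add: e_def)
    moreover have "ip m (e j) (\<psi> k) = \<psi> k j" for k using ip_unit[OF that] by (simp add: e_def)
    ultimately show ?thesis
      unfolding r_def using residual_norm(1)[OF assms(1) o, of "e j"] by simp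
  qed
  have "(\<Sum>j<m. nsq m (r j)) = (\<Sum>j<m. 1 - (\<Sum>k\<in>I. (\<psi> k j)\<^sup>2))"
    by (intro sum.cong refl n) simp
  also have "\<dots> = 0" using sum_sq_coords[OF o] assms(2) by (simp add: sum_subtractf)
  finally have "nsq m (r j) = 0"
    using sum_nonneg_eq_0_iff[of "{..<m}" "\<lambda>j. nsq m (r j)"] ip_self_nonneg \<open>j < m\<close> by auto
  then have "r j i = 0" using \<open>i < m\<close> by (rule ip_self_zero)
  moreover have "ip m (e j) (\<psi> k) = \<psi> k j" for k using ip_unit[OF \<open>j < m\<close>] by (simp add: e_def)
  ultimately show ?thesis by (simp add: r_def e_def mult.commute split: if_splits)
qed

lemma orthonormal_expansion:
  assumes "finite J" "card J = m" "orthonormal_on m J \<phi>" "i < m"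
  shows "(\<Sum>k\<in>J. ip m (\<phi> k) x * \<phi> k i) = x i"
proof -
  have "(\<Sum>k\<in>J. ip m (\<phi> k) x * \<phi> k i) = (\<Sum>k\<in>J. \<Sum>j<m. x j * (\<phi> k j * \<phi> k i))"
    by (simp add: ip_def sum_distrib_left sum_distrib_right mult_ac)
  also have "\<dots> = (\<Sum>j<m. \<Sum>k\<in>J. x j * (\<phi> k j * \<phi> k i))" by (rule sum.swap)
  also have "\<dots> = (\<Sum>j<m. x j * (if j = i then 1 else 0))"
    unfolding sum_distrib_left[symmetric]
    by (intro sum.cong refl) (simp add: completeness[OF assms(1-3)] assms(4))
  also have "\<dots> = x i" using assms(4) by (intro sum_mult_delta(1)) auto
  finally show ?thesis .
qed

lemma spec_of_eigenvectors:
  assumes J: "finite J" "card J = m" "orthonormal_on m J \<phi>"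
    and ev: "\<And>k i. k \<in> J \<Longrightarrow> i < m \<Longrightarrow> kapp m A (\<phi> k) i = lam k * \<phi> k i"
    and "i < m" "j < m"
  shows "A i j = spec J lam \<phi> i j"
proof -
  have "spec J lam \<phi> i j = (\<Sum>k\<in>J. kapp m A (\<phi> k) i * \<phi> k j)"
    unfolding spec_def using ev assms(5) by (intro sum.cong refl) auto
  also have "\<dots> = (\<Sum>k\<in>J. ip m (\<phi> k) (A i) * \<phi> k j)"
    by (simp add: kapp_def ip_def mult.commute)
  also have "\<dots> = A i j" by (rule orthonormal_expansion[OF J assms(6)])
  finally show ?thesis by simp
qed

text \<open>A maximiser of the Rayleigh quotient on the unit sphere orthogonal to the eigenvectors
  found so far is an eigenvector, because its residual is itself an admissible direction of
  variation.\<close>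

lemma next_eigenvector:
  assumes sym: "ksym m A" and "k < m"
    and o: "orthonormal_on m {..<k} \<psi>"
    and ev: "\<And>l i. l < k \<Longrightarrow> i < m \<Longrightarrow> kapp m A (\<psi> l) i = \<mu> l * \<psi> l i"
  shows "\<exists>x c. nsq m x = 1 \<and> (\<forall>l<k. ip m (\<psi> l) x = 0) \<and> (\<forall>i<m. kapp m A x i = c * x i)"
proof -
  \<comment> \<open>Coordinates from \<open>m\<close> on are set to 0, which places the sphere
    inside a product of compact intervals; compactness is then that of the product topology.\<close>
  define S where "S = {x. (\<forall>i\<ge>m. x i = 0) \<and> nsq m x = 1 \<and> (\<forall>l<k. ip m (\<psi> l) x = 0)}"
  define f where "f x = ip m x (kapp m A x)" for x
  define nrm where "nrm x = (\<lambda>i. if i < m then x i / sqrt (nsq m x) else 0)" for x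
  have nrm: "nrm x \<in> S" "f (nrm x) = f x / nsq m x"
    if p: "nsq m x > 0" and q: "\<And>l. l < k \<Longrightarrow> ip m (\<psi> l) x = 0" for x
  proof -
    define s where "s = 1 / sqrt (nsq m x)"
    have s: "s * s * nsq m x = 1" using p by (simp add: s_def field_simps)
    have e: "ip m y (nrm x) = s * ip m y x" for y
      by (subst ip_scale_right[symmetric]) (rule ip_cong, auto simp: nrm_def s_def)
    have "nsq m (nrm x) = 1"
      by (subst e, subst ip_commute, subst e) (use s in simp)
    then show "nrm x \<in> S" unfolding S_def using q e by (simp add: nrm_def)
    have "kapp m A (nrm x) = (\<lambda>i. s * kapp m A x i)"
      by (simp add: fun_eq_iff kapp_def sum_distrib_left nrm_def s_def)
    then have "f (nrm x) = s * ip m (nrm x) (kapp m A x)"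
      unfolding f_def by (simp add: ip_scale_right)
    also have "\<dots> = s * (s * f x)" unfolding f_def by (subst ip_commute, subst e) (simp add: ip_commute)
    finally show "f (nrm x) = f x / nsq m x" using p by (simp add: s_def field_simps)
  qed
  have "compactin (product_topology (\<lambda>i::nat. euclidean) UNIV)
      (Pi\<^sub>E UNIV (\<lambda>i. if i < m then {-1..1::real} else {0}))"
    by (subst compactin_PiE) auto
  then have cK: "compact (Pi\<^sub>E UNIV (\<lambda>i. if i < m then {-1..1::real} else {0}))"
    by (simp add: euclidean_product_topology)
  have ic: "continuous_on UNIV (\<lambda>x. ip m (g x) (h x))"
    if "\<And>i. continuous_on UNIV (\<lambda>x. g x i)" "\<And>i. continuous_on UNIV (\<lambda>x. h x i)"
    for g h :: "(nat \<Rightarrow> real) \<Rightarrow> nat \<Rightarrow> real"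
    unfolding ip_def by (intro continuous_on_sum continuous_on_mult that)
  note co = continuous_on_product_coordinates[where 'a = nat and 'b = real]
  have kc: "continuous_on UNIV (\<lambda>x. kapp m A x i)" for i
    unfolding kapp_def by (intro continuous_on_sum continuous_on_mult continuous_on_const co)
  have "S = (\<Inter>i\<in>{m..}. {x. x i = 0}) \<inter> {x. nsq m x = 1} \<inter> (\<Inter>l\<in>{..<k}. {x. ip m (\<psi> l) x = 0})"
    unfolding S_def by auto
  moreover have "closed {x :: nat \<Rightarrow> real. x i = 0}" for i
    by (rule closed_Collect_eq[OF co continuous_on_const])
  moreover have "closed {x. nsq m x = 1}"
    by (rule closed_Collect_eq[OF ic[OF co co] continuous_on_const])
  moreover have "closed {x. ip m (\<psi> l) x = 0}" for l
    by (rule closed_Collect_eq[OF ic[OF continuous_on_const co] continuous_on_const])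
  ultimately have "closed S" by (simp add: closed_Int closed_INT)
  moreover have "S \<subseteq> Pi\<^sub>E UNIV (\<lambda>i. if i < m then {-1..1::real} else {0})"
  proof
    fix x assume x: "x \<in> S"
    have "x i \<in> {-1..1}" if "i < m" for i
    proof -
      have "x i * x i \<le> nsq m x" unfolding ip_def using that by (intro member_le_sum) auto
      then have "(x i)\<^sup>2 \<le> 1" using x by (simp add: S_def power2_eq_square)
      then show ?thesis using abs_square_le_1[of "x i"] by auto
    qed
    then show "x \<in> Pi\<^sub>E UNIV (\<lambda>i. if i < m then {-1..1::real} else {0})"
      using x by (auto simp: S_def)
  qed
  ultimately have "compact S" using cK compact_Int_closed by (metis inf.absorb_iff2)
  \<comment> \<open>Were every such sum at least 1, the total over \<open>j\<close> would be at
    least \<open>m\<close>, whereas \<open>sum_sq_coords\<close> gives \<open>k\<close>. For the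
    \<open>j\<close> found here the residual of the unit vector is nonzero and admissible.\<close>
  have "\<exists>j<m. (\<Sum>l<k. (\<psi> l j)\<^sup>2) < 1"
  proof (rule ccontr)
    assume "\<not> ?thesis"
    then have "\<And>j. j < m \<Longrightarrow> 1 \<le> (\<Sum>l<k. (\<psi> l j)\<^sup>2)" by (meson not_less)
    then have "(\<Sum>j<m. 1) \<le> (\<Sum>j<m. \<Sum>l<k. (\<psi> l j)\<^sup>2)" by (intro sum_mono) auto
    then show False using sum_sq_coords[OF o] \<open>k < m\<close> by simp
  qed
  then obtain j where j: "j < m" "(\<Sum>l<k. (\<psi> l j)\<^sup>2) < 1" by auto
  define e where "e = (\<lambda>i. if i = j then 1 else (0::real))"
  define r where "r = (\<lambda>i. e i - (\<Sum>l<k. ip m e (\<psi> l) * \<psi> l i))"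
  have "ip m e (\<psi> l) = \<psi> l j" for l using ip_unit[OF j(1)] by (simp add: e_def)
  moreover have "nsq m e = 1" using ip_unit[OF j(1), of e] by (simp add: e_def)
  ultimately have "nsq m r > 0"
    unfolding r_def using j residual_norm(1)[OF _ o, of e] by simp
  moreover have "ip m (\<psi> l) r = 0" if "l < k" for l
    unfolding r_def using residual_norm(2)[OF _ o, of l e] that by simp
  ultimately have "S \<noteq> {}" using nrm(1) by blast
  have "continuous_on UNIV f"
    unfolding f_def by (rule ic[OF co kc])
  then have "continuous_on S f" by (rule continuous_on_subset) simp
  from continuous_attains_sup[OF \<open>compact S\<close> \<open>S \<noteq> {}\<close> this]
  obtain x where x: "x \<in> S" and mx: "\<And>y. y \<in> S \<Longrightarrow> f y \<le> f x" by blast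
  have le: "f y \<le> f x * nsq m y" if "\<And>l. l < k \<Longrightarrow> ip m (\<psi> l) y = 0" for y
  proof (cases "nsq m y > 0")
    case True
    then have "f y / nsq m y \<le> f x" using mx nrm that by metis
    then show ?thesis using True by (simp add: field_simps)
  next
    case False
    then have "nsq m y = 0" using ip_self_nonneg[of m y] by simp
    then have "\<And>i. i < m \<Longrightarrow> y i = 0" by (rule ip_self_zero)
    then show ?thesis by (simp add: f_def ip_def)
  qed
  \<comment> \<open>The residual \<open>A x - f x * x\<close>. By symmetry of \<open>A\<close> it is
    orthogonal to the earlier eigenvectors, so \<open>x + \<tau> g\<close> competes with
    \<open>x\<close>.\<close>
  define g where "g = (\<lambda>i. kapp m A x i - f x * x i)"
  have x1: "nsq m x = 1" and xo: "\<And>l. l < k \<Longrightarrow> ip m (\<psi> l) x = 0" using x by (auto simp: S_def)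
  have go: "ip m (\<psi> l) g = 0" if "l < k" for l
  proof -
    have "ip m (\<psi> l) (kapp m A x) = ip m (\<lambda>i. \<mu> l * \<psi> l i) x"
      unfolding ip_kapp[OF sym] by (rule ip_cong) (use ev that in auto)
    then show ?thesis unfolding g_def ip_diff_right ip_scale_right by (simp add: ip_scale_left xo that)
  qed
  have gx: "nsq m g = ip m g (kapp m A x) - f x * ip m g x"
    by (subst (2) g_def) (simp add: ip_diff_right ip_scale_right)
  define C where "C = f x * nsq m g - f g"
  have exp: "0 \<le> - 2 * \<tau> * nsq m g + \<tau>\<^sup>2 * C" for \<tau>
  proof -
    define y where "y = (\<lambda>i. x i + \<tau> * g i)"
    have ky: "kapp m A y = (\<lambda>i. kapp m A x i + \<tau> * kapp m A g i)"
      by (simp add: fun_eq_iff kapp_def y_def algebra_simps sum.distrib sum_distrib_left)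
    have xg: "ip m x (kapp m A g) = ip m g (kapp m A x)"
      using ip_kapp[OF sym, of x g] by (simp add: ip_commute)
    have "f y \<le> f x * nsq m y"
      by (rule le) (simp add: y_def ip_add_right ip_scale_right xo go)
    moreover have "f y = f x + 2 * \<tau> * ip m g (kapp m A x) + \<tau>\<^sup>2 * f g"
      unfolding f_def ky unfolding y_def
      by (simp add: ip_add_left ip_add_right ip_scale_left ip_scale_right xg power2_eq_square algebra_simps)
    moreover have "nsq m y = 1 + 2 * \<tau> * ip m g x + \<tau>\<^sup>2 * nsq m g"
      unfolding y_def
      by (simp add: ip_add_left ip_add_right ip_scale_left ip_scale_right x1 ip_commute[of m x g] power2_eq_square algebra_simps)
    ultimately show ?thesis unfolding C_def gx by (simp add: algebra_simps)
  qed
  have "nsq m g = 0"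
  proof (rule ccontr)
    assume "nsq m g \<noteq> 0"
    then have G: "nsq m g > 0" using ip_self_nonneg[of m g] by simp
    \<comment> \<open>So small that the quadratic term in \<open>exp\<close> is at most half of the
      linear one, which leaves a negative right-hand side.\<close>
    define \<tau> where "\<tau> = nsq m g / (\<bar>C\<bar> + 1)"
    have "\<tau> > 0" using G by (simp add: \<tau>_def)
    have "\<tau> * C \<le> \<tau> * (\<bar>C\<bar> + 1)" using \<open>\<tau> > 0\<close> by (intro mult_left_mono) auto
    also have "\<dots> = nsq m g" by (simp add: \<tau>_def)
    finally have "\<tau> * (\<tau> * C) \<le> \<tau> * nsq m g" using \<open>\<tau> > 0\<close> by (intro mult_left_mono) auto
    moreover have "\<tau> * nsq m g > 0" using G \<open>\<tau> > 0\<close> by simp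
    ultimately show False using exp[of \<tau>] by (simp add: power2_eq_square mult.assoc)
  qed
  then have "\<forall>i<m. kapp m A x i = f x * x i" using ip_self_zero[of m g] by (auto simp: g_def)
  then show ?thesis using x1 xo by blast
qed

theorem spectral_theorem:
  assumes "ksym m A"
  obtains \<mu> \<psi> where "orthonormal_on m {..<m} \<psi>"
    and "\<And>i j. i < m \<Longrightarrow> j < m \<Longrightarrow> A i j = spec {..<m} \<mu> \<psi> i j"
proof -
  have "\<exists>\<psi> \<mu>. orthonormal_on m {..<k} \<psi> \<and> (\<forall>l<k. \<forall>i<m. kapp m A (\<psi> l) i = \<mu> l * \<psi> l i)"
    if "k \<le> m" for k using that
  proof (induction k)
    case 0
    then show ?case by (simp add: orthonormal_on_def)
  next
    case (Suc k)
    then obtain \<psi> \<mu> where o: "orthonormal_on m {..<k} \<psi>"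
      and ev: "\<And>l i. l < k \<Longrightarrow> i < m \<Longrightarrow> kapp m A (\<psi> l) i = \<mu> l * \<psi> l i" by auto
    have "k < m" using Suc.prems by simp
    from next_eigenvector[OF assms this o ev]
    obtain x c where x: "nsq m x = 1" "\<And>l. l < k \<Longrightarrow> ip m (\<psi> l) x = 0"
      "\<And>i. i < m \<Longrightarrow> kapp m A x i = c * x i" by blast
    have x': "ip m x (\<psi> l) = 0" if "l < k" for l using x(2)[OF that] by (simp add: ip_commute)
    have "orthonormal_on m {..<Suc k} (\<psi>(k := x))"
      using o x(1,2) x' unfolding orthonormal_on_def by (auto simp: less_Suc_eq)
    moreover have "\<forall>l<Suc k. \<forall>i<m. kapp m A ((\<psi>(k := x)) l) i = (\<mu>(k := c)) l * (\<psi>(k := x)) l i"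
      using ev x(3) by (auto simp: less_Suc_eq)
    ultimately show ?case by blast
  qed
  then obtain \<psi> \<mu> where o: "orthonormal_on m {..<m} \<psi>"
    and ev: "\<And>l i. l < m \<Longrightarrow> i < m \<Longrightarrow> kapp m A (\<psi> l) i = \<mu> l * \<psi> l i" by blast
  have "A i j = spec {..<m} \<mu> \<psi> i j" if "i < m" "j < m" for i j
    by (rule spec_of_eigenvectors[OF _ _ o _ that]) (use ev in auto)
  with o show ?thesis by (rule that)
qed

section \<open>The Golden-Thompson inequality\<close>

lemma kapp_spec: "kapp m (spec I a \<psi>) x i = (\<Sum>k\<in>I. a k * ip m (\<psi> k) x * \<psi> k i)"
proof -
  have "kapp m (spec I a \<psi>) x i = (\<Sum>j<m. \<Sum>k\<in>I. a k * (\<psi> k j * x j) * \<psi> k i)"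
    by (simp add: kapp_def spec_def sum_distrib_left sum_distrib_right mult_ac)
  also have "\<dots> = (\<Sum>k\<in>I. \<Sum>j<m. a k * (\<psi> k j * x j) * \<psi> k i)" by (rule sum.swap)
  finally show ?thesis by (simp add: ip_def sum_distrib_left sum_distrib_right)
qed

lemma spec_sym: "spec I a \<psi> i j = spec I a \<psi> j i"
  by (simp add: spec_def mult_ac)

lemma spec_add: "spec I (\<lambda>k. a k + b k) \<psi> i j = spec I a \<psi> i j + spec I b \<psi> i j"
  by (simp add: spec_def distrib_right sum.distrib)

lemma spec_scale: "spec I (\<lambda>k. c * a k) \<psi> i j = c * spec I a \<psi> i j"
  by (simp add: spec_def sum_distrib_left mult_ac)

lemma spec_one:
  assumes "finite I" "card I = m" "orthonormal_on m I \<psi>" "i < m" "j < m"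
  shows "spec I (\<lambda>_. 1) \<psi> i j = (if i = j then 1 else 0)"
  using completeness[OF assms] by (simp add: spec_def)

lemma ip_combination:
  assumes "finite I" "orthonormal_on m I \<psi>"
  shows "ip m (\<lambda>i. \<Sum>k\<in>I. c k * \<psi> k i) (\<lambda>i. \<Sum>k\<in>I. d k * \<psi> k i) = (\<Sum>k\<in>I. c k * d k)"
proof -
  have c: "ip m (\<psi> k) (\<lambda>i. \<Sum>k\<in>I. c k * \<psi> k i) = c k" if "k \<in> I" for k
  proof -
    have "ip m (\<psi> k) (\<lambda>i. \<Sum>k\<in>I. c k * \<psi> k i) = (\<Sum>l\<in>I. c l * (if k = l then 1 else 0))"
      unfolding ip_sum_right using assms(2) that by (intro sum.cong refl) (simp add: orthonormal_on_def)
    then show ?thesis by (simp only: sum_mult_delta[OF assms(1) that])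
  qed
  show ?thesis unfolding ip_sum_right
    by (intro sum.cong refl) (subst ip_commute, simp only: c mult.commute)
qed

lemma ip_kapp_spec: "ip m x (kapp m (spec I a \<psi>) x) = (\<Sum>k\<in>I. a k * (ip m (\<psi> k) x)\<^sup>2)"
  unfolding kapp_spec[abs_def] ip_sum_right by (simp add: power2_eq_square ip_commute mult_ac)

lemma norm_kapp_spec:
  assumes "finite I" "orthonormal_on m I \<psi>"
  shows "nsq m (kapp m (spec I a \<psi>) x) = (\<Sum>k\<in>I. (a k)\<^sup>2 * (ip m (\<psi> k) x)\<^sup>2)"
  unfolding kapp_spec[abs_def] ip_combination[OF assms] by (simp add: power2_eq_square mult_ac)

lemma Bessel:
  assumes "finite I" "orthonormal_on m I \<psi>"
  shows "(\<Sum>k\<in>I. (ip m (\<psi> k) x)\<^sup>2) \<le> nsq m x"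
  using residual_norm(1)[OF assms, of x] ip_self_nonneg[of m "\<lambda>i. x i - (\<Sum>k\<in>I. ip m x (\<psi> k) * \<psi> k i)"]
  by (simp add: ip_commute)

lemma Parseval:
  assumes "finite I" "card I = m" "orthonormal_on m I \<psi>"
  shows "(\<Sum>k\<in>I. ip m (\<psi> k) x * ip m (\<psi> k) y) = ip m x y"
proof -
  have "(\<Sum>k\<in>I. ip m (\<psi> k) x * ip m (\<psi> k) y) = ip m y (\<lambda>i. \<Sum>k\<in>I. ip m (\<psi> k) x * \<psi> k i)"
    unfolding ip_sum_right by (simp add: ip_commute)
  also have "\<dots> = ip m y x" by (rule ip_cong) (simp_all add: orthonormal_expansion[OF assms])
  finally show ?thesis by (simp add: ip_commute)
qed

lemma ktrace_spec: "orthonormal_on m I \<psi> \<Longrightarrow> ktrace m (spec I a \<psi>) = (\<Sum>k\<in>I. a k)"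
proof -
  assume o: "orthonormal_on m I \<psi>"
  have "ktrace m (spec I a \<psi>) = (\<Sum>k\<in>I. \<Sum>i<m. a k * (\<psi> k i * \<psi> k i))"
    unfolding ktrace_def spec_def by (subst sum.swap) (simp add: mult.assoc)
  also have "\<dots> = (\<Sum>k\<in>I. a k * nsq m (\<psi> k))" by (simp add: ip_def sum_distrib_left)
  also have "\<dots> = (\<Sum>k\<in>I. a k)" using o by (intro sum.cong refl) (simp add: orthonormal_on_def)
  finally show ?thesis .
qed

lemma kapp_kmult: "kapp m (kmult m A B) x = kapp m A (kapp m B x)"
proof
  fix i
  have "kapp m (kmult m A B) x i = (\<Sum>j<m. \<Sum>k<m. A i k * B k j * x j)"
    by (simp add: kapp_def kmult_def sum_distrib_right)
  also have "\<dots> = (\<Sum>k<m. \<Sum>j<m. A i k * B k j * x j)" by (rule sum.swap)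
  finally show "kapp m (kmult m A B) x i = kapp m A (kapp m B x) i"
    by (simp add: kapp_def sum_distrib_left mult_ac)
qed

lemma kmult_kapp: "kmult m A B i j = kapp m A (\<lambda>k. B k j) i"
  by (simp add: kmult_def kapp_def)

lemma kmult_assoc: "kmult m (kmult m A B) C = kmult m A (kmult m B C)"
  by (simp add: fun_eq_iff kmult_kapp kapp_kmult)

lemma kmult_spec:
  assumes "finite I" "orthonormal_on m I \<psi>"
  shows "kmult m (spec I a \<psi>) (spec I b \<psi>) = spec I (\<lambda>k. a k * b k) \<psi>"
proof (intro ext)
  fix i j
  have "ip m (\<psi> k) (\<lambda>l. spec I b \<psi> l j) = b k * \<psi> k j" if "k \<in> I" for k
  proof -
    have "ip m (\<psi> k) (\<lambda>l. spec I b \<psi> l j) = ip m (\<psi> k) (\<lambda>l. \<Sum>k\<in>I. (b k * \<psi> k j) * \<psi> k l)"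
      by (simp add: spec_def mult_ac)
    also have "\<dots> = (\<Sum>l\<in>I. (b l * \<psi> l j) * (if k = l then 1 else 0))"
      unfolding ip_sum_right using assms(2) that by (intro sum.cong refl) (simp add: orthonormal_on_def)
    finally show ?thesis by (simp only: sum_mult_delta[OF assms(1) that])
  qed
  then have "kmult m (spec I a \<psi>) (spec I b \<psi>) i j = (\<Sum>k\<in>I. a k * (b k * \<psi> k j) * \<psi> k i)"
    unfolding kmult_kapp kapp_spec by (intro sum.cong refl) simp
  then show "kmult m (spec I a \<psi>) (spec I b \<psi>) i j = spec I (\<lambda>k. a k * b k) \<psi> i j"
    by (simp add: spec_def mult_ac)
qed

section \<open>Trace inequalities for powers of products\<close>

lemma ktrace_kmult_commute: "ktrace m (kmult m A B) = ktrace m (kmult m B A)"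
  unfolding ktrace_def kmult_def by (subst sum.swap) (simp add: mult.commute)

text \<open>Only exponents \<open>2\<^sup>K\<close> occur, so that no unit matrix is needed.\<close>

definition ksq :: "nat \<Rightarrow> nat \<Rightarrow> (nat \<Rightarrow> nat \<Rightarrow> real) \<Rightarrow> nat \<Rightarrow> nat \<Rightarrow> real" where
  "ksq m K Z = ((\<lambda>Z. kmult m Z Z) ^^ K) Z"

lemma ksq_0: "ksq m 0 Z = Z"
  by (simp add: ksq_def)

lemma ksq_Suc: "ksq m (Suc K) Z = kmult m (ksq m K Z) (ksq m K Z)"
  by (simp add: ksq_def)

lemma ksq_Suc': "ksq m (Suc K) Z = ksq m K (kmult m Z Z)"
  by (simp add: ksq_def funpow_Suc_right del: funpow.simps(2))

text \<open>With \<open>A' = A B A\<close> the squares of \<open>A B\<close> and \<open>B A\<close>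
  are \<open>A' B\<close> and \<open>B A'\<close>; this is why \<open>A\<close> varies in the
  induction.\<close>

lemma ktrace_ksq_commute: "ktrace m (ksq m K (kmult m A B)) = ktrace m (ksq m K (kmult m B A))"
proof (induction K arbitrary: A)
  case 0
  then show ?case by (simp add: ksq_0 ktrace_kmult_commute)
next
  case (Suc K)
  show ?case using Suc.IH[of "kmult m A (kmult m B A)"] by (simp add: ksq_Suc' kmult_assoc)
qed

lemma kmult_transpose: "(\<lambda>i j. kmult m A B j i) = kmult m (\<lambda>i j. B j i) (\<lambda>i j. A j i)"
  by (simp add: fun_eq_iff kmult_def mult.commute)

lemma ktrace_kmult_le:
  "\<bar>ktrace m (kmult m A B)\<bar> \<le> (ktrace m (kmult m A (\<lambda>i j. A j i)) + ktrace m (kmult m (\<lambda>i j. B j i) B)) / 2"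
proof -
  have "\<bar>ktrace m (kmult m A B)\<bar> \<le> (\<Sum>i<m. \<Sum>k<m. \<bar>A i k * B k i\<bar>)"
    unfolding ktrace_def kmult_def by (rule order_trans[OF sum_abs sum_mono[OF sum_abs]])
  also have "\<dots> \<le> (\<Sum>i<m. \<Sum>k<m. ((A i k)\<^sup>2 + (B k i)\<^sup>2) / 2)"
  proof (intro sum_mono)
    fix i k
    have "0 \<le> (\<bar>A i k\<bar> - \<bar>B k i\<bar>)\<^sup>2" by simp
    then show "\<bar>A i k * B k i\<bar> \<le> ((A i k)\<^sup>2 + (B k i)\<^sup>2) / 2"
      unfolding power2_diff by (simp add: abs_mult)
  qed
  also have "\<dots> = (ktrace m (kmult m A (\<lambda>i j. A j i)) + ktrace m (kmult m (\<lambda>i j. B j i) B)) / 2"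
    by (simp add: ktrace_def kmult_def power2_eq_square sum.distrib sum_divide_distrib[symmetric])
  finally show ?thesis .
qed

lemma ksq_transpose: "(\<lambda>i j. ksq m K Z j i) = ksq m K (\<lambda>i j. Z j i)"
  by (induction K arbitrary: Z) (simp_all add: ksq_0 ksq_Suc' kmult_transpose)

text \<open>The two claims feed each other. For the first, \<open>Z Z\<close> is inserted into its
  own induction hypothesis, and \<open>Z Z Z' Z'\<close> (with \<open>Z'\<close> the transpose) is
  rotated cyclically to \<open>Q P\<close>, where \<open>Q = Z Z'\<close> and
  \<open>P = Z' Z\<close>. The second claim separates the powers of \<open>Q\<close> and
  \<open>P\<close>, whose traces agree. For the second, the first is applied to \<open>X Y\<close>,
  and \<open>X Y Y X\<close> is rotated to \<open>(X X) (Y Y)\<close>.\<close>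

lemma trace_powers:
  "\<bar>ktrace m (ksq m (Suc K) Z)\<bar> \<le> ktrace m (ksq m K (kmult m Z (\<lambda>i j. Z j i)))"
  "(\<lambda>i j. X j i) = X \<Longrightarrow> (\<lambda>i j. Y j i) = Y \<Longrightarrow>
    ktrace m (ksq m K (kmult m X Y)) \<le> ktrace m (kmult m (ksq m K X) (ksq m K Y))"
proof (induction K arbitrary: X Y Z)
  case 0
  {
    case 1
    show ?case using ktrace_kmult_le[of m Z Z] ktrace_kmult_commute[of m "\<lambda>i j. Z j i" Z]
      by (simp add: ksq_0 ksq_Suc)
  next
    case 2
    show ?case by (simp add: ksq_0)
  }
next
  case (Suc K)
  {
    case (1 Z)
    let ?T = "\<lambda>i j. Z j i"
    define P where "P = kmult m ?T Z"
    define Q where "Q = kmult m Z ?T"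
    have sym: "(\<lambda>i j. P j i) = P" "(\<lambda>i j. Q j i) = Q"
      by (simp_all add: P_def Q_def kmult_transpose)
    have "\<bar>ktrace m (ksq m (Suc (Suc K)) Z)\<bar> = \<bar>ktrace m (ksq m (Suc K) (kmult m Z Z))\<bar>"
      by (simp add: ksq_Suc'[of m "Suc K"])
    also have "\<dots> \<le> ktrace m (ksq m K (kmult m (kmult m Z Z) (kmult m ?T ?T)))"
      using Suc.IH(1)[of "kmult m Z Z"] by (simp add: kmult_transpose)
    also have "\<dots> = ktrace m (ksq m K (kmult m Q P))"
      using ktrace_ksq_commute[of m K Z "kmult m Z (kmult m ?T ?T)"] by (simp add: P_def Q_def kmult_assoc)
    also have "\<dots> \<le> ktrace m (kmult m (ksq m K Q) (ksq m K P))" by (rule Suc.IH(2)[OF sym(2,1)])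
    also have "\<dots> \<le> (ktrace m (ksq m (Suc K) Q) + ktrace m (ksq m (Suc K) P)) / 2"
      using ktrace_kmult_le[of m "ksq m K Q" "ksq m K P"] by (simp add: ksq_transpose sym ksq_Suc)
    also have "ktrace m (ksq m (Suc K) P) = ktrace m (ksq m (Suc K) Q)"
      unfolding P_def Q_def by (rule ktrace_ksq_commute)
    finally show ?case by (simp add: Q_def)
  next
    case (2 X Y)
    have "ktrace m (ksq m (Suc K) (kmult m X Y)) \<le> ktrace m (ksq m K (kmult m (kmult m X Y) (kmult m Y X)))"
      using abs_le_D1[OF Suc.IH(1)[of "kmult m X Y"]] unfolding kmult_transpose 2(1) 2(2) .
    also have "\<dots> = ktrace m (ksq m K (kmult m (kmult m X X) (kmult m Y Y)))"
      using ktrace_ksq_commute[of m K "kmult m X (kmult m Y Y)" X] by (simp add: kmult_assoc)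
    also have "\<dots> \<le> ktrace m (kmult m (ksq m K (kmult m X X)) (ksq m K (kmult m Y Y)))"
      by (rule Suc.IH(2)) (simp_all add: kmult_transpose 2)
    finally show ?case by (simp add: ksq_Suc')
  }
qed

section \<open>Operator norm bounds for powers\<close>

definition op_bound :: "nat \<Rightarrow> real \<Rightarrow> (nat \<Rightarrow> nat \<Rightarrow> real) \<Rightarrow> bool" where
  "op_bound m K A \<longleftrightarrow> 0 \<le> K \<and> (\<forall>x. L2_set (kapp m A x) {..<m} \<le> K * L2_set x {..<m})"

lemma L2_set_ip: "L2_set x {..<m} = sqrt (nsq m x)"
  by (simp add: L2_set_def ip_def power2_eq_square)

lemma op_bound_cong: "(\<And>i j. i < m \<Longrightarrow> j < m \<Longrightarrow> A i j = B i j) \<Longrightarrow> op_bound m K A = op_bound m K B"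
proof -
  assume "\<And>i j. i < m \<Longrightarrow> j < m \<Longrightarrow> A i j = B i j"
  then have "kapp m A x i = kapp m B x i" if "i < m" for x i
    unfolding kapp_def using that by (intro sum.cong refl) auto
  then have "L2_set (kapp m A x) {..<m} = L2_set (kapp m B x) {..<m}" for x
    by (intro L2_set_cong) auto
  then show ?thesis by (simp add: op_bound_def)
qed

lemma op_bound_mono: "op_bound m K A \<Longrightarrow> K \<le> K' \<Longrightarrow> op_bound m K' A"
  unfolding op_bound_def by (meson L2_set_nonneg mult_right_mono order_trans)

lemma op_bound_add:
  assumes "op_bound m K A" "op_bound m K' B"
  shows "op_bound m (K + K') (\<lambda>i j. A i j + B i j)"
proof -
  have "L2_set (kapp m (\<lambda>i j. A i j + B i j) x) {..<m} \<le> (K + K') * L2_set x {..<m}" for x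
  proof -
    have "kapp m (\<lambda>i j. A i j + B i j) x = (\<lambda>i. kapp m A x i + kapp m B x i)"
      by (simp add: fun_eq_iff kapp_def distrib_right sum.distrib)
    then have "L2_set (kapp m (\<lambda>i j. A i j + B i j) x) {..<m} \<le>
        L2_set (kapp m A x) {..<m} + L2_set (kapp m B x) {..<m}"
      by (simp add: L2_set_triangle_ineq)
    also have "\<dots> \<le> K * L2_set x {..<m} + K' * L2_set x {..<m}"
      using assms unfolding op_bound_def by (intro add_mono) auto
    finally show ?thesis by (simp add: distrib_right)
  qed
  then show ?thesis using assms by (simp add: op_bound_def)
qed

lemma op_bound_uminus: "op_bound m K A \<Longrightarrow> op_bound m K (\<lambda>i j. - A i j)"
  by (simp add: op_bound_def kapp_def L2_set_def sum_negf)

lemma op_bound_kmult: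
  assumes "op_bound m K A" "op_bound m K' B"
  shows "op_bound m (K * K') (kmult m A B)"
  unfolding op_bound_def kapp_kmult
proof (intro conjI allI)
  show "0 \<le> K * K'" using assms by (simp add: op_bound_def)
  fix x
  have "L2_set (kapp m A (kapp m B x)) {..<m} \<le> K * L2_set (kapp m B x) {..<m}"
    using assms by (simp add: op_bound_def)
  also have "\<dots> \<le> K * (K' * L2_set x {..<m})"
    using assms unfolding op_bound_def by (intro mult_left_mono) auto
  finally show "L2_set (kapp m A (kapp m B x)) {..<m} \<le> K * K' * L2_set x {..<m}"
    by (simp add: mult.assoc)
qed

lemma op_bound_spec:
  assumes "finite I" "orthonormal_on m I \<psi>" "0 \<le> K" "\<And>k. k \<in> I \<Longrightarrow> \<bar>a k\<bar> \<le> K"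
  shows "op_bound m K (spec I a \<psi>)"
  unfolding op_bound_def
proof (intro conjI allI)
  fix x
  have "(\<Sum>k\<in>I. (a k)\<^sup>2 * (ip m (\<psi> k) x)\<^sup>2) \<le> (\<Sum>k\<in>I. K\<^sup>2 * (ip m (\<psi> k) x)\<^sup>2)"
    using assms by (intro sum_mono mult_right_mono) (auto simp: abs_le_square_iff[symmetric])
  also have "\<dots> \<le> K\<^sup>2 * nsq m x"
    unfolding sum_distrib_left[symmetric] by (intro mult_left_mono Bessel assms) simp
  finally have "sqrt (\<Sum>k\<in>I. (a k)\<^sup>2 * (ip m (\<psi> k) x)\<^sup>2) \<le> sqrt (K\<^sup>2 * nsq m x)"
    by (rule real_sqrt_le_mono)
  then show "L2_set (kapp m (spec I a \<psi>) x) {..<m} \<le> K * L2_set x {..<m}"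
    using assms(3) unfolding L2_set_ip norm_kapp_spec[OF assms(1,2)] by (simp add: real_sqrt_mult)
qed fact

lemma op_bound_trace:
  assumes "op_bound m K A"
  shows "\<bar>ktrace m A\<bar> \<le> real m * K"
proof -
  have "\<bar>A i i\<bar> \<le> K" if "i < m" for i
  proof -
    let ?e = "\<lambda>j. if j = i then 1 else (0::real)"
    have "\<bar>A i i\<bar> = \<bar>kapp m A ?e i\<bar>"
      using that by (simp only: kapp_def sum_mult_delta finite_lessThan lessThan_iff)
    also have "\<dots> \<le> L2_set (\<lambda>i. \<bar>kapp m A ?e i\<bar>) {..<m}"
      using that by (intro member_le_L2_set) auto
    also have "\<dots> = L2_set (kapp m A ?e) {..<m}" by (simp add: L2_set_def)
    also have "\<dots> \<le> K * L2_set ?e {..<m}" using assms by (simp add: op_bound_def)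
    also have "L2_set ?e {..<m} = 1" using ip_unit[OF that, of ?e] by (simp add: L2_set_ip)
    finally show ?thesis by simp
  qed
  then have "(\<Sum>i<m. \<bar>A i i\<bar>) \<le> (\<Sum>i<m. K)" by (intro sum_mono) auto
  then show ?thesis unfolding ktrace_def by (intro order_trans[OF sum_abs]) simp
qed

lemma op_bound_ksq: "op_bound m \<beta> U \<Longrightarrow> op_bound m (\<beta> ^ 2 ^ j) (ksq m j U)"
proof (induction j)
  case (Suc j)
  then show ?case using op_bound_kmult[OF Suc.IH Suc.IH] by (simp add: ksq_Suc mult_2 power_add)
qed (simp add: ksq_0)

text \<open>From \<open>U U - V V = U (U - V) + (U - V) V\<close>, each squaring doubles the error
  and multiplies it by the norm bound of the powers. With \<open>N = 2 ^ n\<close> and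
  \<open>\<beta> ^ N\<close> bounded, an error of order \<open>1 / N^2\<close> per factor ends as
  one of order \<open>1 / N\<close>.\<close>

lemma op_bound_ksq_diff:
  assumes "op_bound m \<beta> U" "op_bound m \<beta> V" "1 \<le> \<beta>" "op_bound m \<delta> (\<lambda>i j. U i j - V i j)"
  shows "op_bound m (2 ^ n * \<beta> ^ 2 ^ n * \<delta>) (\<lambda>i j. ksq m n U i j - ksq m n V i j)"
proof (induction n)
  case 0
  have "1 * \<delta> \<le> \<beta> * \<delta>" using assms by (intro mult_right_mono) (auto simp: op_bound_def)
  then show ?case using op_bound_mono[OF assms(4)] by (simp add: ksq_0)
next
  case (Suc n)
  let ?u = "ksq m n U" and ?v = "ksq m n V"
  let ?d = "\<lambda>i j. ?u i j - ?v i j" and ?b = "\<beta> ^ 2 ^ n"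
  have "op_bound m (?b * (2 ^ n * ?b * \<delta>) + (2 ^ n * ?b * \<delta>) * ?b)
      (\<lambda>i j. kmult m ?u ?d i j + kmult m ?d ?v i j)"
    by (intro op_bound_add op_bound_kmult op_bound_ksq assms Suc.IH)
  also have "(\<lambda>i j. kmult m ?u ?d i j + kmult m ?d ?v i j) =
      (\<lambda>i j. ksq m (Suc n) U i j - ksq m (Suc n) V i j)"
    by (simp add: fun_eq_iff ksq_Suc kmult_def algebra_simps sum.distrib sum_subtractf)
  also have "?b * (2 ^ n * ?b * \<delta>) + (2 ^ n * ?b * \<delta>) * ?b = 2 ^ Suc n * \<beta> ^ 2 ^ Suc n * \<delta>"
  proof -
    have "\<beta> ^ 2 ^ Suc n = ?b * ?b" by (metis mult_2 power_Suc power_add)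
    then show ?thesis by simp
  qed
  finally show ?case .
qed

lemma ksq_spec:
  assumes "finite I" "orthonormal_on m I \<psi>"
  shows "ksq m n (spec I a \<psi>) = spec I (\<lambda>k. a k ^ 2 ^ n) \<psi>"
  by (induction n) (simp_all add: ksq_0 ksq_Suc kmult_spec[OF assms] mult_2 power_add)

lemma exp_diff_bounds:
  fixes y :: real
  shows "\<bar>exp y - 1\<bar> \<le> \<bar>y\<bar> * exp \<bar>y\<bar>" "\<bar>exp y - 1 - y\<bar> \<le> y\<^sup>2 * exp \<bar>y\<bar>"
proof -
  obtain t where t: "\<bar>t\<bar> \<le> \<bar>y\<bar>" "exp y = (\<Sum>k<1. y ^ k / fact k) + exp t / fact 1 * y ^ 1"
    using Maclaurin_exp_le by blast
  have "\<bar>exp y - 1\<bar> = \<bar>y\<bar> * exp t" using t(2) by (simp add: abs_mult)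
  also have "\<dots> \<le> \<bar>y\<bar> * exp \<bar>y\<bar>" using t(1) by (intro mult_left_mono) auto
  finally show "\<bar>exp y - 1\<bar> \<le> \<bar>y\<bar> * exp \<bar>y\<bar>" .
  obtain s where s: "\<bar>s\<bar> \<le> \<bar>y\<bar>" "exp y = (\<Sum>k<2. y ^ k / fact k) + exp s / fact 2 * y ^ 2"
    using Maclaurin_exp_le by blast
  have "\<bar>exp y - 1 - y\<bar> = y\<^sup>2 * (exp s / 2)" using s(2) by (simp add: numeral_2_eq_2 abs_mult)
  also have "\<dots> \<le> y\<^sup>2 * exp \<bar>y\<bar>"
  proof (intro mult_left_mono)
    have "exp s \<le> exp \<bar>y\<bar>" using s(1) by auto
    then show "exp s / 2 \<le> exp \<bar>y\<bar>" using exp_gt_zero[of s] by linarith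
  qed simp
  finally show "\<bar>exp y - 1 - y\<bar> \<le> y\<^sup>2 * exp \<bar>y\<bar>" .
qed

text \<open>The Lie product formula along \<open>N = 2 ^ n\<close>:
  \<open>exp (A / N) exp (B / N)\<close> agrees with \<open>exp ((A + B) / N)\<close> up to order
  \<open>1 / N^2\<close>. The trace of its \<open>N\<close>-th power is bounded by
  \<open>trace_powers\<close>, and \<open>n\<close> tends to infinity. Exponentials are written
  through the spectral decompositions of the three matrices.\<close>

theorem Golden_Thompson:
  fixes a b c :: "nat \<Rightarrow> real"
  assumes oA: "orthonormal_on m {..<m} \<psi>A" and oB: "orthonormal_on m {..<m} \<psi>B"
    and oC: "orthonormal_on m {..<m} \<psi>C"
    and sum: "\<And>i j. i < m \<Longrightarrow> j < m \<Longrightarrow>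
      spec {..<m} c \<psi>C i j = spec {..<m} a \<psi>A i j + spec {..<m} b \<psi>B i j"
  shows "(\<Sum>k<m. exp (c k)) \<le>
    ktrace m (kmult m (spec {..<m} (\<lambda>k. exp (a k)) \<psi>A) (spec {..<m} (\<lambda>k. exp (b k)) \<psi>B))"
    (is "?L \<le> ?R")
proof -
  let ?S = "spec {..<m}"
  define \<alpha> where "\<alpha> = (\<Sum>k<m. \<bar>a k\<bar> + \<bar>b k\<bar> + \<bar>c k\<bar>)"
  have "\<alpha> \<ge> 0" unfolding \<alpha>_def by (intro sum_nonneg) auto
  have \<alpha>: "\<bar>a k\<bar> \<le> \<alpha>" "\<bar>b k\<bar> \<le> \<alpha>" "\<bar>c k\<bar> \<le> \<alpha>" if "k < m" for k
  proof -
    have "\<bar>a k\<bar> + \<bar>b k\<bar> + \<bar>c k\<bar> \<le> \<alpha>" unfolding \<alpha>_def using that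
      by (intro member_le_sum[of k _ "\<lambda>k. \<bar>a k\<bar> + \<bar>b k\<bar> + \<bar>c k\<bar>"]) auto
    then show "\<bar>a k\<bar> \<le> \<alpha>" "\<bar>b k\<bar> \<le> \<alpha>" "\<bar>c k\<bar> \<le> \<alpha>" by auto
  qed
  \<comment> \<open>Divided by \<open>N^2\<close>, the first product bounds \<open>X1 Y1\<close>,
    and the three equal terms bound the second-order remainders of \<open>A\<close>,
    \<open>B\<close> and their sum.\<close>
  define \<kappa> where "\<kappa> = (\<alpha> * exp \<alpha>) * (\<alpha> * exp \<alpha>) + (\<alpha>\<^sup>2 * exp \<alpha> + \<alpha>\<^sup>2 * exp \<alpha> + \<alpha>\<^sup>2 * exp \<alpha>)"
  have main: "?L \<le> ?R + real m * (exp (2 * \<alpha>) * \<kappa>) / 2 ^ n" for n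
  proof -
    define N where "N = (2::real) ^ n"
    have N: "N \<ge> 1" "N > 0" by (simp_all add: N_def)
    have small: "\<bar>exp (z / N) - 1\<bar> \<le> \<alpha> * exp \<alpha> / N"
      "\<bar>exp (z / N) - 1 - z / N\<bar> \<le> \<alpha>\<^sup>2 * exp \<alpha> / N\<^sup>2" "\<bar>exp (z / N)\<bar> \<le> exp (\<alpha> / N)"
      "exp (z / N) ^ 2 ^ n = exp z" if "\<bar>z\<bar> \<le> \<alpha>" for z
    proof -
      have z: "\<bar>z / N\<bar> \<le> \<alpha> / N" using that N by (simp add: divide_right_mono)
      have "\<alpha> / N \<le> \<alpha>" using mult_left_mono[OF N(1) \<open>\<alpha> \<ge> 0\<close>] N(2) by (simp add: divide_le_eq)
      then have e: "exp \<bar>z / N\<bar> \<le> exp \<alpha>" using order_trans[OF z] by (simp only: exp_le_cancel_iff)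
      have "\<bar>z / N\<bar> * exp \<bar>z / N\<bar> \<le> (\<alpha> / N) * exp \<alpha>" using z e \<open>\<alpha> \<ge> 0\<close> N by (intro mult_mono) auto
      then show "\<bar>exp (z / N) - 1\<bar> \<le> \<alpha> * exp \<alpha> / N"
        using exp_diff_bounds(1)[of "z / N"] by simp
      have "(z / N)\<^sup>2 \<le> (\<alpha> / N)\<^sup>2" using z \<open>\<alpha> \<ge> 0\<close> N by (subst abs_le_square_iff[symmetric]) auto
      then have "(z / N)\<^sup>2 * exp \<bar>z / N\<bar> \<le> (\<alpha> / N)\<^sup>2 * exp \<alpha>" using e by (intro mult_mono) auto
      then show "\<bar>exp (z / N) - 1 - z / N\<bar> \<le> \<alpha>\<^sup>2 * exp \<alpha> / N\<^sup>2"
        using exp_diff_bounds(2)[of "z / N"] by (simp add: power_divide)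
      show "\<bar>exp (z / N)\<bar> \<le> exp (\<alpha> / N)" using abs_le_D1[OF z] by (simp only: abs_exp_cancel exp_le_cancel_iff)
      have "exp (z / N) ^ 2 ^ n = exp (real (2 ^ n) * (z / N))" by (simp only: exp_of_nat_mult)
      then show "exp (z / N) ^ 2 ^ n = exp z" using N by (simp add: N_def)
    qed
    define X where "X = ?S (\<lambda>k. exp (a k / N)) \<psi>A"
    define Y where "Y = ?S (\<lambda>k. exp (b k / N)) \<psi>B"
    define E where "E = ?S (\<lambda>k. exp (c k / N)) \<psi>C"
    define X1 where "X1 = ?S (\<lambda>k. exp (a k / N) - 1) \<psi>A"
    define Y1 where "Y1 = ?S (\<lambda>k. exp (b k / N) - 1) \<psi>B"
    define RA where "RA = ?S (\<lambda>k. exp (a k / N) - 1 - a k / N) \<psi>A"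
    define RB where "RB = ?S (\<lambda>k. exp (b k / N) - 1 - b k / N) \<psi>B"
    define RC where "RC = ?S (\<lambda>k. exp (c k / N) - 1 - c k / N) \<psi>C"
    have fin: "finite {..<m}" "card {..<m} = m" by auto
    have X1: "X i j = (if i = j then 1 else 0) + X1 i j" "Y i j = (if i = j then 1 else 0) + Y1 i j"
      if "i < m" "j < m" for i j
      using spec_add[of "{..<m}" "\<lambda>_. 1" "\<lambda>k. exp (a k / N) - 1" \<psi>A i j]
        spec_add[of "{..<m}" "\<lambda>_. 1" "\<lambda>k. exp (b k / N) - 1" \<psi>B i j]
        spec_one[OF fin oA that] spec_one[OF fin oB that]
      by (simp_all add: X_def X1_def Y_def Y1_def)
    have R: "X1 i j = RA i j + ?S a \<psi>A i j / N" "Y1 i j = RB i j + ?S b \<psi>B i j / N" for i j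
      using spec_add[of "{..<m}" "\<lambda>k. exp (a k / N) - 1 - a k / N" "\<lambda>k. (1/N) * a k" \<psi>A i j]
        spec_add[of "{..<m}" "\<lambda>k. exp (b k / N) - 1 - b k / N" "\<lambda>k. (1/N) * b k" \<psi>B i j]
        spec_scale[of "{..<m}" "1/N" a \<psi>A i j] spec_scale[of "{..<m}" "1/N" b \<psi>B i j]
      by (simp_all add: X1_def RA_def Y1_def RB_def)
    have E: "E i j = (if i = j then 1 else 0) + RC i j + ?S c \<psi>C i j / N" if "i < m" "j < m" for i j
      using spec_add[of "{..<m}" "\<lambda>_. 1" "\<lambda>k. exp (c k / N) - 1" \<psi>C i j]
        spec_add[of "{..<m}" "\<lambda>k. exp (c k / N) - 1 - c k / N" "\<lambda>k. (1/N) * c k" \<psi>C i j]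
        spec_scale[of "{..<m}" "1/N" c \<psi>C i j] spec_one[OF fin oC that]
      by (simp add: E_def RC_def)
    have kXY: "kmult m X Y i j = (if i = j then 1 else 0) + X1 i j + Y1 i j + kmult m X1 Y1 i j"
      if "i < m" "j < m" for i j
    proof -
      have "kmult m X Y i j = (\<Sum>k<m. ((if i = k then 1 else 0) + X1 i k) * ((if k = j then 1 else 0) + Y1 k j))"
        unfolding kmult_def using that by (intro sum.cong refl) (simp add: X1)
      also have "\<dots> = (\<Sum>k<m. (if i = k then 1 else 0) * ((if k = j then 1 else 0) + Y1 k j))
          + (\<Sum>k<m. X1 i k * (if k = j then 1 else 0)) + kmult m X1 Y1 i j"
        by (simp add: kmult_def sum.distrib algebra_simps)
      also have "(\<Sum>k<m. (if i = k then 1 else 0) * ((if k = j then 1 else 0) + Y1 k j)) = (if i = j then 1 else 0) + Y1 i j"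
        using that by (intro sum_mult_delta(4)) auto
      also have "(\<Sum>k<m. X1 i k * (if k = j then 1 else 0)) = X1 i j"
        using that by (intro sum_mult_delta(1)) auto
      finally show ?thesis by simp
    qed
    have diff: "op_bound m (\<kappa> / N\<^sup>2) (\<lambda>i j. kmult m X Y i j - E i j)"
    proof -
      have "op_bound m ((\<alpha> * exp \<alpha> / N) * (\<alpha> * exp \<alpha> / N) +
          (\<alpha>\<^sup>2 * exp \<alpha> / N\<^sup>2 + \<alpha>\<^sup>2 * exp \<alpha> / N\<^sup>2 + \<alpha>\<^sup>2 * exp \<alpha> / N\<^sup>2))
          (\<lambda>i j. kmult m X1 Y1 i j + (RA i j + RB i j + - RC i j))"
        unfolding X1_def Y1_def RA_def RB_def RC_def
        by (intro op_bound_add op_bound_kmult op_bound_uminus op_bound_spec oA oB oC fin small \<alpha>)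
          (use \<open>\<alpha> \<ge> 0\<close> N in auto)
      also have "(\<alpha> * exp \<alpha> / N) * (\<alpha> * exp \<alpha> / N) +
          (\<alpha>\<^sup>2 * exp \<alpha> / N\<^sup>2 + \<alpha>\<^sup>2 * exp \<alpha> / N\<^sup>2 + \<alpha>\<^sup>2 * exp \<alpha> / N\<^sup>2) = \<kappa> / N\<^sup>2"
        by (simp add: \<kappa>_def add_divide_distrib power2_eq_square)
      finally have *: "op_bound m (\<kappa> / N\<^sup>2) (\<lambda>i j. kmult m X1 Y1 i j + (RA i j + RB i j + - RC i j))" .
      \<comment> \<open>The unit matrices cancel, and so do the first-order terms, by the hypothesis
        \<open>sum\<close>.\<close>
      have "kmult m X Y i j - E i j = kmult m X1 Y1 i j + (RA i j + RB i j + - RC i j)"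
        if "i < m" "j < m" for i j
        using kXY[OF that] E[OF that] sum[OF that] R(1)[of i j] R(2)[of i j]
        by (simp add: add_divide_distrib)
      then show ?thesis by (rule op_bound_cong[THEN iffD2, OF _ *])
    qed
    \<comment> \<open>The power \<open>\<beta> ^ 2 ^ n\<close> equals
      \<open>exp (2 * \<alpha>)\<close> for every \<open>n\<close>, so taking powers costs a
      constant only.\<close>
    define \<beta> where "\<beta> = exp (2 * \<alpha> / N)"
    have "op_bound m (exp (\<alpha> / N) * exp (\<alpha> / N)) (kmult m X Y)"
      unfolding X_def Y_def by (intro op_bound_kmult op_bound_spec oA oB fin small \<alpha>) auto
    then have bXY: "op_bound m \<beta> (kmult m X Y)" by (simp add: \<beta>_def exp_add[symmetric] flip: add_divide_distrib)
    have "op_bound m (exp (\<alpha> / N)) E" unfolding E_def by (intro op_bound_spec oC fin small \<alpha>) auto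
    moreover have "exp (\<alpha> / N) \<le> \<beta>" using \<open>\<alpha> \<ge> 0\<close> N by (simp add: \<beta>_def divide_right_mono)
    ultimately have bE: "op_bound m \<beta> E" by (rule op_bound_mono)
    have "1 \<le> \<beta>" using \<open>\<alpha> \<ge> 0\<close> N by (simp add: \<beta>_def)
    have \<beta>n: "\<beta> ^ 2 ^ n = exp (2 * \<alpha>)"
    proof -
      have "\<beta> ^ 2 ^ n = exp (real (2 ^ n) * (2 * \<alpha> / N))" unfolding \<beta>_def by (simp only: exp_of_nat_mult)
      then show ?thesis using N by (simp add: N_def)
    qed
    have "op_bound m (2 ^ n * \<beta> ^ 2 ^ n * (\<kappa> / N\<^sup>2)) (\<lambda>i j. ksq m n (kmult m X Y) i j - ksq m n E i j)"
      by (rule op_bound_ksq_diff[OF bXY bE \<open>1 \<le> \<beta>\<close> diff])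
    also have "2 ^ n * \<beta> ^ 2 ^ n * (\<kappa> / N\<^sup>2) = exp (2 * \<alpha>) * \<kappa> / N"
      unfolding \<beta>n using N by (simp add: N_def power2_eq_square)
    finally have "\<bar>ktrace m (\<lambda>i j. ksq m n (kmult m X Y) i j - ksq m n E i j)\<bar> \<le> real m * (exp (2 * \<alpha>) * \<kappa> / N)"
      by (rule op_bound_trace)
    then have "ktrace m (ksq m n E) \<le> ktrace m (ksq m n (kmult m X Y)) + real m * (exp (2 * \<alpha>) * \<kappa>) / N"
      by (simp add: ktrace_def sum_subtractf)
    moreover have "ktrace m (ksq m n E) = ?L"
      unfolding E_def ksq_spec[OF fin(1) oC] ktrace_spec[OF oC] using small(4) \<alpha> by (intro sum.cong refl) simp
    moreover have "ktrace m (ksq m n (kmult m X Y)) \<le> ktrace m (kmult m (ksq m n X) (ksq m n Y))"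
      by (rule trace_powers(2)) (simp_all add: fun_eq_iff X_def Y_def spec_sym)
    moreover have "ksq m n X = ?S (\<lambda>k. exp (a k)) \<psi>A" "ksq m n Y = ?S (\<lambda>k. exp (b k)) \<psi>B"
      unfolding X_def Y_def ksq_spec[OF fin(1) oA] ksq_spec[OF fin(1) oB] spec_def
      using small(4) \<alpha> by (intro ext sum.cong refl; simp)+
    ultimately show ?thesis by (simp add: N_def)
  qed
  have "(\<lambda>n. real m * (exp (2 * \<alpha>) * \<kappa>) / 2 ^ n) \<longlonglongrightarrow> 0"
    by (rule LIMSEQ_divide_realpow_zero) simp
  then have "(\<lambda>n. ?R + real m * (exp (2 * \<alpha>) * \<kappa>) / 2 ^ n) \<longlonglongrightarrow> ?R + 0"
    by (intro tendsto_intros)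
  then show ?thesis using main by (intro LIMSEQ_le_const[where X = "\<lambda>n. ?R + real m * (exp (2 * \<alpha>) * \<kappa>) / 2 ^ n"]) auto
qed

section \<open>Tail bounds for sums of independent matrices and vectors\<close>

text \<open>The expectation over \<open>n\<close> independent draws with weights \<open>q\<close>,
  indexed by \<open>{1..n}\<close> like the sample.\<close>

definition pexp :: "('w \<Rightarrow> real) \<Rightarrow> 'w set \<Rightarrow> nat \<Rightarrow> ((nat \<Rightarrow> 'w) \<Rightarrow> real) \<Rightarrow> real" where
  "pexp q \<Omega> n f = (\<Sum>z\<in>PiE {1..n} (\<lambda>_. \<Omega>). (\<Prod>j=1..n. q (z j)) * f z)"

lemma pexp_Suc:
  "pexp q \<Omega> (Suc n) f = pexp q \<Omega> n (\<lambda>z. \<Sum>w\<in>\<Omega>. q w * f (z(Suc n := w)))"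
proof -
  let ?B = "PiE {1..n} (\<lambda>_. \<Omega>)"
  have i: "{1..Suc n} = insert (Suc n) {1..n}" by auto
  have inj: "inj_on (\<lambda>(y, g). g(Suc n := y)) (\<Omega> \<times> ?B)"
    using inj_combinator[of "Suc n" "{1..n}" "\<lambda>_. \<Omega>"] by simp
  have "pexp q \<Omega> (Suc n) f =
      (\<Sum>(w, z)\<in>\<Omega> \<times> ?B. (\<Prod>j=1..Suc n. q ((z(Suc n := w)) j)) * f (z(Suc n := w)))"
    unfolding pexp_def by (subst i, subst PiE_insert_eq, subst sum.reindex[OF inj])
      (simp add: case_prod_unfold)
  also have "\<dots> = (\<Sum>w\<in>\<Omega>. \<Sum>z\<in>?B. (\<Prod>j=1..Suc n. q ((z(Suc n := w)) j)) * f (z(Suc n := w)))"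
    by (rule sum.cartesian_product[symmetric])
  also have "\<dots> = (\<Sum>z\<in>?B. \<Sum>w\<in>\<Omega>. (\<Prod>j=1..Suc n. q ((z(Suc n := w)) j)) * f (z(Suc n := w)))"
    by (rule sum.swap)
  also have "\<dots> = pexp q \<Omega> n (\<lambda>z. \<Sum>w\<in>\<Omega>. q w * f (z(Suc n := w)))"
    unfolding pexp_def by (simp add: sum_distrib_left mult_ac)
  finally show ?thesis .
qed

lemma pexp_mono:
  assumes "\<And>w. w \<in> \<Omega> \<Longrightarrow> 0 \<le> q w"
    and "\<And>z. z \<in> PiE {1..n} (\<lambda>_. \<Omega>) \<Longrightarrow> f z \<le> g z"
  shows "pexp q \<Omega> n f \<le> pexp q \<Omega> n g"
  unfolding pexp_def using assms by (intro sum_mono mult_left_mono prod_nonneg) (auto simp: PiE_iff)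

lemma pexp_scale: "pexp q \<Omega> n (\<lambda>z. c * f z) = c * pexp q \<Omega> n f"
  by (simp add: pexp_def sum_distrib_left mult_ac)

text \<open>A supermartingale bound in finite form: averaging out the last draw costs a factor
  \<open>G\<close>. The invariant \<open>P\<close> records what \<open>step\<close> requires of a
  partial sum, for example symmetry of a matrix.\<close>

lemma pexp_partial_sums_le:
  fixes g :: "'w \<Rightarrow> 'i \<Rightarrow> real"
  assumes q: "\<And>w. w \<in> \<Omega> \<Longrightarrow> 0 \<le> q w"
    and P0: "P (\<lambda>_. 0)" and PS: "\<And>s w. P s \<Longrightarrow> w \<in> \<Omega> \<Longrightarrow> P (\<lambda>i. s i + g w i)"
    and step: "\<And>s. P s \<Longrightarrow> (\<Sum>w\<in>\<Omega>. q w * F (\<lambda>i. s i + g w i)) \<le> G * F s"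
    and "G \<ge> 0"
  shows "pexp q \<Omega> n (\<lambda>z. F (\<lambda>i. \<Sum>j=1..n. g (z j) i)) \<le> G ^ n * F (\<lambda>_. 0)"
proof (induction n)
  case 0
  then show ?case by (simp add: pexp_def)
next
  case (Suc n)
  have P: "P (\<lambda>i. \<Sum>j=1..k. g (z j) i)" if "z \<in> PiE {1..n} (\<lambda>_. \<Omega>)" "k \<le> n" for z k
    using that(2)
  proof (induction k)
    case (Suc k)
    then show ?case using PS[of "\<lambda>i. \<Sum>j=1..k. g (z j) i" "z (Suc k)"] that(1) by (auto simp: PiE_iff)
  qed (simp add: P0)
  have e: "(\<Sum>j=1..Suc n. g ((z(Suc n := w)) j) i) = (\<Sum>j=1..n. g (z j) i) + g w i" for z w i
    by simp
  have "pexp q \<Omega> (Suc n) (\<lambda>z. F (\<lambda>i. \<Sum>j=1..Suc n. g (z j) i)) =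
      pexp q \<Omega> n (\<lambda>z. \<Sum>w\<in>\<Omega>. q w * F (\<lambda>i. (\<Sum>j=1..n. g (z j) i) + g w i))"
    unfolding pexp_Suc e ..
  also have "\<dots> \<le> pexp q \<Omega> n (\<lambda>z. G * F (\<lambda>i. \<Sum>j=1..n. g (z j) i))"
    by (intro pexp_mono q step P) auto
  also have "\<dots> \<le> G * (G ^ n * F (\<lambda>_. 0))"
    unfolding pexp_scale using Suc.IH \<open>G \<ge> 0\<close> by (intro mult_left_mono)
  finally show ?case by simp
qed

lemma pexp_Markov:
  assumes "finite \<Omega>" and q: "\<And>w. w \<in> \<Omega> \<Longrightarrow> 0 \<le> q w"
    and "\<And>z. 0 \<le> f z" "c > 0"
    and "\<And>z. z \<in> B \<Longrightarrow> c \<le> f z" and B: "B \<subseteq> PiE {1..n} (\<lambda>_. \<Omega>)"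
  shows "(\<Sum>z\<in>B. \<Prod>j=1..n. q (z j)) \<le> pexp q \<Omega> n f / c"
proof -
  have q': "0 \<le> (\<Prod>j=1..n. q (z j))" if "z \<in> PiE {1..n} (\<lambda>_. \<Omega>)" for z
    using q that by (intro prod_nonneg) (auto simp: PiE_iff)
  have "c * (\<Sum>z\<in>B. \<Prod>j=1..n. q (z j)) \<le> (\<Sum>z\<in>B. (\<Prod>j=1..n. q (z j)) * f z)"
    unfolding sum_distrib_left
  proof (intro sum_mono)
    fix z assume "z \<in> B"
    then show "c * (\<Prod>j=1..n. q (z j)) \<le> (\<Prod>j=1..n. q (z j)) * f z"
      using assms(5)[of z] q'[of z] B by (subst mult.commute) (intro mult_left_mono, auto)
  qed
  also have "\<dots> \<le> pexp q \<Omega> n f"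
    unfolding pexp_def using assms q' by (intro sum_mono2 finite_PiE) auto
  finally show ?thesis using \<open>c > 0\<close> by (simp add: field_simps)
qed

text \<open>The range is set by \<open>quadratic_cen_bounded\<close>, where a centred observation
  has norm bound 3/2 and not 1.\<close>

lemma exp_le_quadratic:
  fixes y :: real
  assumes "\<bar>y\<bar> \<le> 3/2"
  shows "exp y \<le> 1 + y + y\<^sup>2"
proof -
  consider "y \<le> 0" | "0 \<le> y" "y \<le> 1" | "1 \<le> y" by linarith
  then show ?thesis
  proof cases
    case 1
    obtain t where t: "\<bar>t\<bar> \<le> \<bar>y\<bar>" "exp y = (\<Sum>k<3. y ^ k / fact k) + exp t / fact 3 * y ^ 3"
      using Maclaurin_exp_le by blast
    have "y ^ 3 \<le> 0"
      using mult_nonneg_nonpos[OF zero_le_power2[of y] 1] by (simp add: power3_eq_cube power2_eq_square)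
    then have "exp t / fact 3 * y ^ 3 \<le> 0" by (intro mult_nonneg_nonpos) auto
    moreover have "(\<Sum>k<3. y ^ k / fact k) = 1 + y + y\<^sup>2 / 2"
      by (simp add: numeral_3_eq_3 power2_eq_square)
    ultimately show ?thesis using t(2) zero_le_power2[of y] by linarith
  next
    case 2
    then show ?thesis by (rule exp_bound)
  next
    \<comment> \<open>By convexity \<open>exp\<close> lies below its chord on
      \<open>[1, 3/2]\<close>. With the bounds 2.72 and 4.49 at the ends the chord is
      \<open>3.54 y - 0.82\<close>, and \<open>1 + y + y^2\<close> exceeds it by more than
      \<open>(y - 1.27)^2\<close>.\<close>
    case 3
    define l where "l = 2 * (y - 1)"
    have l: "0 \<le> l" "l \<le> 1" using 3 assms by (auto simp: l_def)
    have e1: "exp 1 \<le> (272/100::real)" using e_less_272 by simp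
    have "exp (3/2::real) ^ 2 = exp 1 ^ 3"
      by (simp add: exp_of_nat_mult[symmetric])
    also have "\<dots> \<le> (272/100::real) ^ 3" by (intro power_mono e1) simp
    also have "\<dots> \<le> (449/100)\<^sup>2" by (simp add: power2_eq_square power3_eq_cube)
    finally have e2: "exp (3/2::real) \<le> 449/100" by (rule power2_le_imp_le) simp
    have "exp y = exp ((1 - l) *\<^sub>R 1 + l *\<^sub>R (3/2))" by (simp add: l_def algebra_simps)
    also have "\<dots> \<le> (1 - l) * exp 1 + l * exp (3/2)"
      using convex_onD[OF exp_convex, of l 1 "3/2"] l by simp
    also have "\<dots> \<le> (1 - l) * (272/100) + l * (449/100)"
      using l e1 e2 by (intro add_mono mult_left_mono) auto
    also have "\<dots> \<le> 1 + y + y\<^sup>2"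
    proof -
      have "0 \<le> y * y - 254/100 * y + 16129/10000"
        using zero_le_power2[of "y - 127/100"] by (simp add: power2_eq_square algebra_simps)
      moreover have "(1 - l) * (272/100) + l * (449/100) = 354/100 * y - 82/100"
        by (simp add: l_def field_simps)
      ultimately show ?thesis unfolding power2_eq_square by linarith
    qed
    finally show ?thesis .
  qed
qed

text \<open>The trace of \<open>exp A\<close>, computed from some spectral decomposition of
  \<open>A\<close>. The choice is harmless because \<open>Golden_Thompson\<close> holds for
  arbitrary decompositions.\<close>

definition trexp :: "nat \<Rightarrow> (nat \<Rightarrow> nat \<Rightarrow> real) \<Rightarrow> real" where
  "trexp m A = (SOME t. \<exists>\<mu> \<psi>. orthonormal_on m {..<m} \<psi> \<and>
     (\<forall>i<m. \<forall>j<m. A i j = spec {..<m} \<mu> \<psi> i j) \<and> t = (\<Sum>k<m. exp (\<mu> k)))"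

lemma trexp_spectral:
  assumes "ksym m A"
  obtains \<mu> \<psi> where "orthonormal_on m {..<m} \<psi>"
    and "\<And>i j. i < m \<Longrightarrow> j < m \<Longrightarrow> A i j = spec {..<m} \<mu> \<psi> i j"
    and "trexp m A = (\<Sum>k<m. exp (\<mu> k))"
proof -
  have "\<exists>t \<mu> \<psi>. orthonormal_on m {..<m} \<psi> \<and>
     (\<forall>i<m. \<forall>j<m. A i j = spec {..<m} \<mu> \<psi> i j) \<and> t = (\<Sum>k<m. exp (\<mu> k))"
    using spectral_theorem[OF assms] by metis
  from someI_ex[OF this] show ?thesis using that unfolding trexp_def[symmetric] by blast
qed

lemma kapp_cong:
  "(\<And>i j. i < m \<Longrightarrow> j < m \<Longrightarrow> A i j = B i j) \<Longrightarrow> i < m \<Longrightarrow> kapp m A x i = kapp m B x i"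
  unfolding kapp_def by (intro sum.cong refl) auto

lemma ip_kapp_cong:
  "(\<And>i j. i < m \<Longrightarrow> j < m \<Longrightarrow> A i j = B i j) \<Longrightarrow> ip m x (kapp m A y) = ip m x (kapp m B y)"
  by (rule ip_cong) (auto intro: kapp_cong)

lemma eigenvalue_quadratic_form:
  assumes "orthonormal_on m {..<m} \<psi>" "l < m"
  shows "ip m (\<psi> l) (kapp m (spec {..<m} \<mu> \<psi>) (\<psi> l)) = \<mu> l"
proof -
  have "ip m (\<psi> l) (kapp m (spec {..<m} \<mu> \<psi>) (\<psi> l)) = (\<Sum>k<m. \<mu> k * (if k = l then 1 else 0))"
    unfolding ip_kapp_spec using assms by (intro sum.cong refl) (auto simp: orthonormal_on_def)
  then show ?thesis using assms(2) by (simp only: sum_mult_delta finite_lessThan lessThan_iff)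
qed

lemma trexp_zero: "trexp m (\<lambda>_ _. 0) = real m"
proof -
  have "ksym m (\<lambda>_ _. 0)" by (simp add: ksym_def)
  then obtain \<mu> \<psi> where o: "orthonormal_on m {..<m} \<psi>"
    and e: "\<And>i j. i < m \<Longrightarrow> j < m \<Longrightarrow> 0 = spec {..<m} \<mu> \<psi> i j"
    and t: "trexp m (\<lambda>_ _. 0) = (\<Sum>k<m. exp (\<mu> k))" by (rule trexp_spectral) blast
  have "\<mu> l = 0" if "l < m" for l
    using eigenvalue_quadratic_form[OF o that, of \<mu>]
      ip_kapp_cong[of m "\<lambda>_ _. 0" "spec {..<m} \<mu> \<psi>" "\<psi> l" "\<psi> l"] e
    by (simp add: kapp_def ip_def)
  then show ?thesis unfolding t by simp
qed

lemma trexp_nonneg: "ksym m A \<Longrightarrow> 0 \<le> trexp m A"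
  by (erule trexp_spectral) (simp add: sum_nonneg)

text \<open>A Rayleigh quotient above \<open>R\<close> forces an eigenvalue above \<open>R\<close>,
  and its exponential is one of the nonnegative summands of the trace.\<close>

lemma exp_le_trexp:
  assumes "ksym m A" "R * nsq m x < ip m x (kapp m A x)"
  shows "exp R \<le> trexp m A"
proof -
  obtain \<mu> \<psi> where o: "orthonormal_on m {..<m} \<psi>"
    and e: "\<And>i j. i < m \<Longrightarrow> j < m \<Longrightarrow> A i j = spec {..<m} \<mu> \<psi> i j"
    and t: "trexp m A = (\<Sum>k<m. exp (\<mu> k))" by (rule trexp_spectral[OF assms(1)]) blast
  have "\<exists>k<m. R < \<mu> k"
  proof (rule ccontr)
    assume "\<not> ?thesis"
    then have "\<And>k. k < m \<Longrightarrow> \<mu> k \<le> R" by (meson not_less)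
    then have "(\<Sum>k<m. \<mu> k * (ip m (\<psi> k) x)\<^sup>2) \<le> (\<Sum>k<m. R * (ip m (\<psi> k) x)\<^sup>2)"
      by (intro sum_mono mult_right_mono) auto
    also have "\<dots> = R * nsq m x"
      using Parseval[OF _ _ o, of x x] by (simp add: sum_distrib_left[symmetric] power2_eq_square)
    finally show False using assms(2) ip_kapp_cong[of m A "spec {..<m} \<mu> \<psi>" x x] e by (simp add: ip_kapp_spec)
  qed
  then obtain k where "k < m" "R < \<mu> k" by blast
  then have "exp R \<le> exp (\<mu> k)" by simp
  also have "\<dots> \<le> trexp m A" unfolding t using \<open>k < m\<close> by (intro member_le_sum) auto
  finally show ?thesis .
qed

lemma ktrace_kmult_spec:
  "ktrace m (kmult m (spec I a \<psi>) B) = (\<Sum>k\<in>I. a k * ip m (\<psi> k) (kapp m B (\<psi> k)))"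
proof -
  have "ktrace m (kmult m (spec I a \<psi>) B) = ktrace m (kmult m B (spec I a \<psi>))"
    by (rule ktrace_kmult_commute)
  also have "\<dots> = (\<Sum>i<m. \<Sum>l<m. \<Sum>k\<in>I. a k * (\<psi> k i * (B i l * \<psi> k l)))"
    by (simp add: ktrace_def kmult_def spec_def sum_distrib_left mult_ac)
  also have "\<dots> = (\<Sum>i<m. \<Sum>k\<in>I. \<Sum>l<m. a k * (\<psi> k i * (B i l * \<psi> k l)))"
    by (intro sum.cong refl sum.swap)
  also have "\<dots> = (\<Sum>k\<in>I. \<Sum>i<m. \<Sum>l<m. a k * (\<psi> k i * (B i l * \<psi> k l)))" by (rule sum.swap)
  finally show ?thesis by (simp add: ip_def kapp_def sum_distrib_left)
qed

text \<open>\<open>Golden_Thompson\<close> splits off \<open>exp \<zeta>\<close>, which is at most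
  \<open>1 + \<zeta> + \<zeta>^2\<close> as a quadratic form. Averaging removes the linear term and
  bounds the square by \<open>v\<close>. Only quadratic forms at the eigenvectors of
  \<open>A\<close> occur, so the hypotheses on \<open>\<zeta>\<close> are stated for quadratic
  forms.\<close>

lemma Ahlswede_Winter_step:
  assumes "ksym m A" and q: "\<And>w. w \<in> \<Omega> \<Longrightarrow> 0 \<le> q w" and q1: "(\<Sum>w\<in>\<Omega>. q w) = 1"
    and sym: "\<And>w. w \<in> \<Omega> \<Longrightarrow> ksym m (\<zeta> w)"
    and bd: "\<And>w x. w \<in> \<Omega> \<Longrightarrow> \<bar>ip m x (kapp m (\<zeta> w) x)\<bar> \<le> 3/2 * nsq m x"
    and mean: "\<And>x. (\<Sum>w\<in>\<Omega>. q w * ip m x (kapp m (\<zeta> w) x)) = 0"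
    and var: "\<And>x. (\<Sum>w\<in>\<Omega>. q w * nsq m (kapp m (\<zeta> w) x)) \<le> v * nsq m x"
  shows "(\<Sum>w\<in>\<Omega>. q w * trexp m (\<lambda>i j. A i j + \<zeta> w i j)) \<le> (1 + v) * trexp m A"
proof -
  obtain a \<psi>A where oA: "orthonormal_on m {..<m} \<psi>A"
    and eA: "\<And>i j. i < m \<Longrightarrow> j < m \<Longrightarrow> A i j = spec {..<m} a \<psi>A i j"
    and tA: "trexp m A = (\<Sum>k<m. exp (a k))" by (rule trexp_spectral[OF assms(1)]) blast
  \<comment> \<open>The quadratic form of \<open>1 + \<zeta> + \<zeta>^2\<close>, with the square
    written as a norm by symmetry.\<close>
  define h where "h w x = nsq m x + ip m x (kapp m (\<zeta> w) x) + nsq m (kapp m (\<zeta> w) x)"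
    for w x
  have 1: "trexp m (\<lambda>i j. A i j + \<zeta> w i j) \<le> (\<Sum>k<m. exp (a k) * h w (\<psi>A k))" if w: "w \<in> \<Omega>" for w
  proof -
    obtain b \<psi>B where oB: "orthonormal_on m {..<m} \<psi>B"
      and eB: "\<And>i j. i < m \<Longrightarrow> j < m \<Longrightarrow> \<zeta> w i j = spec {..<m} b \<psi>B i j"
      by (rule trexp_spectral[OF sym[OF w]]) blast
    have "ksym m (\<lambda>i j. A i j + \<zeta> w i j)" using assms(1) sym[OF w] by (auto simp: ksym_def)
    then obtain c \<psi>C where oC: "orthonormal_on m {..<m} \<psi>C"
      and eC: "\<And>i j. i < m \<Longrightarrow> j < m \<Longrightarrow> A i j + \<zeta> w i j = spec {..<m} c \<psi>C i j"
      and tC: "trexp m (\<lambda>i j. A i j + \<zeta> w i j) = (\<Sum>k<m. exp (c k))" by (rule trexp_spectral) blast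
    have b: "\<bar>b l\<bar> \<le> 3/2" if "l < m" for l
    proof -
      have "ip m (\<psi>B l) (kapp m (\<zeta> w) (\<psi>B l)) = b l"
        using eigenvalue_quadratic_form[OF oB that, of b] ip_kapp_cong[OF eB] by simp
      moreover have "nsq m (\<psi>B l) = 1" using oB that by (simp add: orthonormal_on_def)
      ultimately show ?thesis using bd[OF w, of "\<psi>B l"] by simp
    qed
    have quad: "ip m x (kapp m (spec {..<m} (\<lambda>k. exp (b k)) \<psi>B) x) \<le> h w x" for x
    proof -
      have "ip m x (kapp m (spec {..<m} (\<lambda>k. exp (b k)) \<psi>B) x) = (\<Sum>k<m. exp (b k) * (ip m (\<psi>B k) x)\<^sup>2)"
        by (rule ip_kapp_spec)
      also have "\<dots> \<le> (\<Sum>k<m. (1 + b k + (b k)\<^sup>2) * (ip m (\<psi>B k) x)\<^sup>2)"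
        using b by (intro sum_mono mult_right_mono exp_le_quadratic) auto
      also have "\<dots> = (\<Sum>k<m. (ip m (\<psi>B k) x)\<^sup>2) + (\<Sum>k<m. b k * (ip m (\<psi>B k) x)\<^sup>2)
          + (\<Sum>k<m. (b k)\<^sup>2 * (ip m (\<psi>B k) x)\<^sup>2)"
        by (simp add: algebra_simps sum.distrib)
      also have "(\<Sum>k<m. (ip m (\<psi>B k) x)\<^sup>2) = nsq m x"
        using Parseval[OF _ _ oB, of x x] by (simp add: power2_eq_square)
      also have "(\<Sum>k<m. b k * (ip m (\<psi>B k) x)\<^sup>2) = ip m x (kapp m (\<zeta> w) x)"
        unfolding ip_kapp_spec[symmetric] by (rule ip_kapp_cong) (simp add: eB)
      also have "(\<Sum>k<m. (b k)\<^sup>2 * (ip m (\<psi>B k) x)\<^sup>2) = nsq m (kapp m (\<zeta> w) x)"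
        unfolding norm_kapp_spec[OF finite_lessThan oB, symmetric]
        by (intro ip_cong; rule kapp_cong) (simp_all add: eB)
      finally show ?thesis by (simp add: h_def)
    qed
    have "(\<Sum>k<m. exp (c k)) \<le>
        ktrace m (kmult m (spec {..<m} (\<lambda>k. exp (a k)) \<psi>A) (spec {..<m} (\<lambda>k. exp (b k)) \<psi>B))"
      by (rule Golden_Thompson[OF oA oB oC]) (simp add: eA[symmetric] eB[symmetric] eC)
    also have "\<dots> \<le> (\<Sum>k<m. exp (a k) * h w (\<psi>A k))"
      unfolding ktrace_kmult_spec by (intro sum_mono mult_left_mono quad) simp
    finally show ?thesis by (simp add: tC)
  qed
  have "(\<Sum>w\<in>\<Omega>. q w * trexp m (\<lambda>i j. A i j + \<zeta> w i j)) \<le> (\<Sum>w\<in>\<Omega>. q w * (\<Sum>k<m. exp (a k) * h w (\<psi>A k)))"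
    by (intro sum_mono mult_left_mono 1 q)
  also have "\<dots> = (\<Sum>w\<in>\<Omega>. \<Sum>k<m. exp (a k) * (q w * h w (\<psi>A k)))"
    by (simp add: sum_distrib_left mult_ac)
  also have "\<dots> = (\<Sum>k<m. exp (a k) * (\<Sum>w\<in>\<Omega>. q w * h w (\<psi>A k)))"
    by (subst sum.swap) (simp add: sum_distrib_left)
  also have "\<dots> \<le> (\<Sum>k<m. exp (a k) * (1 + v))"
  proof (intro sum_mono mult_left_mono)
    fix k assume "k \<in> {..<m}"
    then have n: "nsq m (\<psi>A k) = 1" using oA by (simp add: orthonormal_on_def)
    have "(\<Sum>w\<in>\<Omega>. q w * h w x) = nsq m x + (\<Sum>w\<in>\<Omega>. q w * nsq m (kapp m (\<zeta> w) x))" for x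
      unfolding h_def using mean[of x] q1 by (simp add: distrib_left sum.distrib sum_distrib_right[symmetric])
    then show "(\<Sum>w\<in>\<Omega>. q w * h w (\<psi>A k)) \<le> 1 + v" using var[of "\<psi>A k"] n by simp
  qed simp
  also have "\<dots> = (1 + v) * trexp m A" by (simp add: tA sum_distrib_left mult_ac)
  finally show ?thesis .
qed

text \<open>Markov's inequality for \<open>trexp\<close> of the sum. The prefactor \<open>m\<close>
  is its value at the zero matrix, and \<open>(1 + v) ^ n\<close> is at most
  \<open>exp (n v)\<close>.\<close>

theorem matrix_tail:
  assumes "finite \<Omega>" and q: "\<And>w. w \<in> \<Omega> \<Longrightarrow> 0 \<le> q w" and q1: "(\<Sum>w\<in>\<Omega>. q w) = 1"
    and sym: "\<And>w. w \<in> \<Omega> \<Longrightarrow> ksym m (\<zeta> w)"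
    and bd: "\<And>w x. w \<in> \<Omega> \<Longrightarrow> \<bar>ip m x (kapp m (\<zeta> w) x)\<bar> \<le> 3/2 * nsq m x"
    and mean: "\<And>x. (\<Sum>w\<in>\<Omega>. q w * ip m x (kapp m (\<zeta> w) x)) = 0"
    and var: "\<And>x. (\<Sum>w\<in>\<Omega>. q w * nsq m (kapp m (\<zeta> w) x)) \<le> v * nsq m x"
    and "v \<ge> 0"
    and B: "B \<subseteq> PiE {1..n} (\<lambda>_. \<Omega>)"
    and big: "\<And>z. z \<in> B \<Longrightarrow> \<exists>x. R * nsq m x < ip m x (kapp m (\<lambda>i k. \<Sum>j=1..n. \<zeta> (z j) i k) x)"
  shows "(\<Sum>z\<in>B. \<Prod>j=1..n. q (z j)) \<le> real m * exp (real n * v - R)"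
proof -
  define P where "P s = ksym m (\<lambda>i k. s (i, k))" for s :: "nat \<times> nat \<Rightarrow> real"
  define g where "g w = (\<lambda>(i, k). \<zeta> w i k)" for w
  define F where "F s = trexp m (\<lambda>i k. s (i, k))" for s :: "nat \<times> nat \<Rightarrow> real"
  have ks: "P (\<lambda>i. \<Sum>j=1..n. g (z j) i)" if "z \<in> PiE {1..n} (\<lambda>_. \<Omega>)" for z
    using sym that unfolding P_def ksym_def g_def by (auto intro!: sum.cong simp: PiE_iff)
  have le: "pexp q \<Omega> n (\<lambda>z. F (\<lambda>i. \<Sum>j=1..n. g (z j) i)) \<le> (1 + v) ^ n * F (\<lambda>_. 0)"
  proof (rule pexp_partial_sums_le[where P = P])
    fix s assume "P s"
    then show "(\<Sum>w\<in>\<Omega>. q w * F (\<lambda>i. s i + g w i)) \<le> (1 + v) * F s"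
      unfolding F_def g_def P_def prod.case by (intro Ahlswede_Winter_step q q1 sym bd mean var)
  next
    fix s w assume "P s" "w \<in> \<Omega>"
    then show "P (\<lambda>i. s i + g w i)" using sym[of w] by (auto simp: P_def g_def ksym_def)
  qed (use q \<open>v \<ge> 0\<close> in \<open>auto simp: P_def ksym_def\<close>)
  \<comment> \<open>Markov's inequality wants a function that is nonnegative everywhere, and
    \<open>trexp\<close> is known to be nonnegative on symmetric matrices, hence the value 0
    elsewhere.\<close>
  define f where "f z = (if z \<in> PiE {1..n} (\<lambda>_. \<Omega>) then F (\<lambda>i. \<Sum>j=1..n. g (z j) i) else 0)" for z
  have "(\<Sum>z\<in>B. \<Prod>j=1..n. q (z j)) \<le> pexp q \<Omega> n f / exp R"
  proof (rule pexp_Markov[OF assms(1)])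
    show "0 \<le> f z" for z
      unfolding f_def F_def using ks[of z] by (auto simp: P_def intro!: trexp_nonneg)
    fix z assume z: "z \<in> B"
    then obtain x where "R * nsq m x < ip m x (kapp m (\<lambda>i k. \<Sum>j=1..n. \<zeta> (z j) i k) x)"
      using big by blast
    moreover have "ksym m (\<lambda>i k. \<Sum>j=1..n. \<zeta> (z j) i k)" using ks[of z] z B by (auto simp: P_def g_def)
    ultimately have "exp R \<le> trexp m (\<lambda>i k. \<Sum>j=1..n. \<zeta> (z j) i k)" by (intro exp_le_trexp)
    then show "exp R \<le> f z" using z B by (auto simp: f_def F_def g_def)
  qed (use q B in auto)
  also have "pexp q \<Omega> n f = pexp q \<Omega> n (\<lambda>z. F (\<lambda>i. \<Sum>j=1..n. g (z j) i))"
    unfolding pexp_def f_def by (intro sum.cong refl) simp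
  also have "\<dots> / exp R \<le> ((1 + v) ^ n * real m) / exp R"
    using le by (intro divide_right_mono) (auto simp: F_def trexp_zero)
  also have "\<dots> \<le> (exp v ^ n * real m) / exp R"
    using \<open>v \<ge> 0\<close> by (intro divide_right_mono mult_right_mono power_mono exp_ge_add_one_self) auto
  also have "\<dots> = real m * exp (real n * v - R)"
    by (simp add: exp_diff exp_of_nat_mult)
  finally show ?thesis .
qed

text \<open>In the power series \<open>cosh (sqrt z) = (\<Sum>k. z ^ k / fact (2 * k))\<close> each
  term is convex in \<open>z \<ge> 0\<close>; the comparison is made term by term.\<close>

lemma cosh_sqrt_convex:
  fixes u w l :: real
  assumes "0 \<le> u" "0 \<le> w" "0 \<le> l" "l \<le> 1"
  shows "cosh (sqrt (l * u\<^sup>2 + (1 - l) * w\<^sup>2)) \<le> l * cosh u + (1 - l) * cosh w"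
proof (rule sums_le)
  let ?z = "l * u\<^sup>2 + (1 - l) * w\<^sup>2"
  have z: "0 \<le> ?z" using assms by simp
  show "(\<lambda>n. if even n then sqrt ?z ^ n /\<^sub>R fact n else 0) sums cosh (sqrt ?z)" by (rule cosh_converges)
  show "(\<lambda>n. l * (if even n then u ^ n /\<^sub>R fact n else 0) + (1 - l) * (if even n then w ^ n /\<^sub>R fact n else 0))
      sums (l * cosh u + (1 - l) * cosh w)"
    by (intro sums_add sums_mult cosh_converges)
  fix n
  have "sqrt ?z ^ n \<le> l * u ^ n + (1 - l) * w ^ n" if ev: "even n"
  proof -
    obtain k where k: "n = 2 * k" using ev by (rule evenE)
    have "sqrt ?z ^ n = ?z ^ k" using z by (simp add: k power_mult)
    also have "\<dots> \<le> l * (u\<^sup>2) ^ k + (1 - l) * (w\<^sup>2) ^ k"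
    proof (cases "k = 0")
      case False
      have "convex_on {0..} (\<lambda>x::real. x ^ k)"
        using convex_power_odd[of k] convex_on_subset[OF convex_power_even[of k], of "{0..}"] by auto
      from convex_onD[OF this, of "1 - l" "u\<^sup>2" "w\<^sup>2"] show ?thesis using assms by simp
    qed simp
    finally show ?thesis by (simp add: k power_mult)
  qed
  then have "even n \<Longrightarrow> sqrt ?z ^ n / fact n \<le> (l * u ^ n + (1 - l) * w ^ n) / fact n"
    by (intro divide_right_mono) auto
  then show "(if even n then sqrt ?z ^ n /\<^sub>R fact n else 0) \<le>
      l * (if even n then u ^ n /\<^sub>R fact n else 0) + (1 - l) * (if even n then w ^ n /\<^sub>R fact n else 0)"
    by (simp add: add_divide_distrib divide_inverse_commute distrib_left mult_ac)
qed

lemma sinh_ge_self: "0 \<le> b \<Longrightarrow> b \<le> sinh (b::real)"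
proof -
  assume "0 \<le> b"
  have "sinh 0 - 0 \<le> sinh b - b"
  proof (rule DERIV_nonneg_imp_nondecreasing[OF \<open>0 \<le> b\<close>])
    fix x :: real
    show "\<exists>y. ((\<lambda>b. sinh b - b) has_real_derivative y) (at x) \<and> 0 \<le> y"
      by (intro exI[of _ "cosh x - 1"] conjI) (auto intro!: derivative_eq_intros simp: cosh_real_ge_1)
  qed
  then show ?thesis by simp
qed

text \<open>
  The left-hand side is convex in \<open>c\<close>, hence lies below the chord between its values
  \<open>cosh (a - b)\<close> and \<open>cosh (a + b)\<close> at \<open>c = \<plusminus>a b\<close>.  The term linear in \<open>c\<close> vanishes in expectation.
\<close>

lemma cosh_norm_add:
  fixes a b c :: real
  assumes "0 \<le> a" "0 \<le> b" "b \<le> 1" "\<bar>c\<bar> \<le> a * b"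
  shows "cosh (sqrt (a\<^sup>2 + b\<^sup>2 + 2 * c)) \<le> cosh a * (1 + b\<^sup>2) + c * (sinh a / a)"
proof (cases "a = 0 \<or> b = 0")
  \<comment> \<open>Here \<open>c = 0\<close>, so the last summand vanishes whatever value
    \<open>sinh a / a\<close> takes at \<open>a = 0\<close>.\<close>
  case True
  then have "c = 0" using assms by auto
  moreover have "cosh b \<le> 1 + b\<^sup>2"
  proof -
    have "cosh b + sinh b = exp b" by (simp add: cosh_plus_sinh)
    then show ?thesis using sinh_ge_self[OF assms(2)] exp_bound[of b] assms by simp
  qed
  ultimately show ?thesis using True assms by (auto intro: order_trans)
next
  case False
  then have ab: "0 < a" "0 < b" using assms by auto
  define \<rho> where "\<rho> = c / (a * b)"
  \<comment> \<open>The position of \<open>a^2 + b^2 + 2 c\<close> between \<open>(a - b)^2\<close>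
    at \<open>l = 0\<close> and \<open>(a + b)^2\<close> at \<open>l = 1\<close>.\<close>
  define l where "l = (1 + \<rho>) / 2"
  have \<rho>: "\<bar>\<rho>\<bar> \<le> 1" using assms ab by (simp add: \<rho>_def abs_mult)
  then have l: "0 \<le> l" "l \<le> 1" by (auto simp: l_def)
  have z: "a\<^sup>2 + b\<^sup>2 + 2 * c = l * (a + b)\<^sup>2 + (1 - l) * \<bar>a - b\<bar>\<^sup>2"
    using ab by (simp add: l_def \<rho>_def field_simps power2_eq_square)
  have "cosh (sqrt (a\<^sup>2 + b\<^sup>2 + 2 * c)) \<le> l * cosh (a + b) + (1 - l) * cosh \<bar>a - b\<bar>"
    unfolding z by (rule cosh_sqrt_convex) (use l ab in auto)
  also have "cosh \<bar>a - b\<bar> = cosh (a - b)" by (simp add: abs_if cosh_minus[of "a - b", symmetric] del: cosh_minus)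
  also have "l * cosh (a + b) + (1 - l) * cosh (a - b) = cosh a * cosh b + (2 * l - 1) * (sinh a * sinh b)"
    by (simp add: cosh_add cosh_diff algebra_simps)
  \<comment> \<open>Writing \<open>sinh b = b + (sinh b - b)\<close> isolates the term linear in
    \<open>c\<close>. The rest joins \<open>cosh b\<close> to form \<open>exp b - b\<close>, which
    is at most \<open>1 + b^2\<close>.\<close>
  also have "(2 * l - 1) * (sinh a * sinh b) = c * (sinh a / a) + \<rho> * (sinh a * (sinh b - b))"
    using ab by (simp add: l_def \<rho>_def field_simps)
  also have "\<rho> * (sinh a * (sinh b - b)) \<le> 1 * (sinh a * (sinh b - b))"
    using \<rho> ab sinh_ge_self[of b] by (intro mult_right_mono) auto
  also have "1 * (sinh a * (sinh b - b)) \<le> cosh a * (sinh b - b)"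
    using ab sinh_ge_self[of b] sinh_less_cosh_real[of a] by (simp add: mult_right_mono)
  finally have "cosh (sqrt (a\<^sup>2 + b\<^sup>2 + 2 * c)) \<le> cosh a * (cosh b + sinh b - b) + c * (sinh a / a)"
    by (simp add: algebra_simps)
  also have "cosh a * (cosh b + sinh b - b) \<le> cosh a * (1 + b\<^sup>2)"
    using exp_bound[of b] assms by (intro mult_left_mono) (auto simp: cosh_plus_sinh)
  finally show ?thesis by simp
qed

text \<open>The function \<open>cosh\<close> of the norm takes the place of the trace exponential:
  unlike \<open>exp\<close> of the norm it is smooth at the origin. Its prefactor 2 comes from
  \<open>exp R / 2 \<le> cosh R\<close> and does not grow with the dimension.\<close>

theorem vector_tail:
  fixes g :: "'w \<Rightarrow> 'i \<Rightarrow> real"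
  assumes "finite \<Omega>" and q: "\<And>w. w \<in> \<Omega> \<Longrightarrow> 0 \<le> q w" and q1: "(\<Sum>w\<in>\<Omega>. q w) = 1"
    and bd: "\<And>w. w \<in> \<Omega> \<Longrightarrow> L2_set (g w) I \<le> 1"
    and mean: "\<And>i. i \<in> I \<Longrightarrow> (\<Sum>w\<in>\<Omega>. q w * g w i) = 0"
    and var: "(\<Sum>w\<in>\<Omega>. q w * (L2_set (g w) I)\<^sup>2) \<le> v"
    and B: "B \<subseteq> PiE {1..n} (\<lambda>_. \<Omega>)" and "R \<ge> 0"
    and big: "\<And>z. z \<in> B \<Longrightarrow> R \<le> L2_set (\<lambda>i. \<Sum>j=1..n. g (z j) i) I"
  shows "(\<Sum>z\<in>B. \<Prod>j=1..n. q (z j)) \<le> 2 * exp (real n * v - R)"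
proof -
  have "0 \<le> (\<Sum>w\<in>\<Omega>. q w * (L2_set (g w) I)\<^sup>2)" using q by (intro sum_nonneg) auto
  then have "v \<ge> 0" using var by simp
  define F where "F s = cosh (L2_set s I)" for s :: "'i \<Rightarrow> real"
  have le: "pexp q \<Omega> n (\<lambda>z. F (\<lambda>i. \<Sum>j=1..n. g (z j) i)) \<le> (1 + v) ^ n * F (\<lambda>_. 0)"
  proof (rule pexp_partial_sums_le[where P = "\<lambda>_. True"])
    fix s :: "'i \<Rightarrow> real"
    define k where "k = sinh (L2_set s I) / L2_set s I"
    have *: "F (\<lambda>i. s i + g w i) \<le> F s * (1 + (L2_set (g w) I)\<^sup>2) + (\<Sum>i\<in>I. s i * g w i) * k"
      if "w \<in> \<Omega>" for w
    proof -
      let ?c = "\<Sum>i\<in>I. s i * g w i"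
      have "L2_set (\<lambda>i. s i + g w i) I = sqrt ((L2_set s I)\<^sup>2 + (L2_set (g w) I)\<^sup>2 + 2 * ?c)"
        by (simp add: L2_set_def sum_nonneg power2_sum sum.distrib sum_distrib_left mult.assoc)
      moreover have "\<bar>?c\<bar> \<le> L2_set s I * L2_set (g w) I"
        by (rule order_trans[OF sum_abs]) (use L2_set_mult_ineq[of s "g w" I] in \<open>simp add: abs_mult\<close>)
      ultimately show ?thesis
        unfolding F_def k_def using cosh_norm_add[of "L2_set s I" "L2_set (g w) I" ?c] bd[OF that]
        by (simp add: L2_set_nonneg)
    qed
    have "(\<Sum>w\<in>\<Omega>. q w * F (\<lambda>i. s i + g w i)) \<le>
        (\<Sum>w\<in>\<Omega>. q w * (F s * (1 + (L2_set (g w) I)\<^sup>2) + (\<Sum>i\<in>I. s i * g w i) * k))"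
      by (intro sum_mono mult_left_mono * q)
    also have "\<dots> = F s * ((\<Sum>w\<in>\<Omega>. q w) + (\<Sum>w\<in>\<Omega>. q w * (L2_set (g w) I)\<^sup>2)) +
        (\<Sum>w\<in>\<Omega>. \<Sum>i\<in>I. s i * (q w * g w i)) * k"
      by (simp add: distrib_left sum.distrib sum_distrib_left sum_distrib_right mult_ac)
    also have "(\<Sum>w\<in>\<Omega>. \<Sum>i\<in>I. s i * (q w * g w i)) = (\<Sum>i\<in>I. s i * (\<Sum>w\<in>\<Omega>. q w * g w i))"
      by (subst sum.swap) (simp add: sum_distrib_left)
    also have "\<dots> = 0" using mean by simp
    finally have "(\<Sum>w\<in>\<Omega>. q w * F (\<lambda>i. s i + g w i)) \<le> F s * (1 + (\<Sum>w\<in>\<Omega>. q w * (L2_set (g w) I)\<^sup>2))"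
      using q1 by simp
    also have "\<dots> \<le> F s * (1 + v)"
      using var by (intro mult_left_mono) (auto simp: F_def)
    finally show "(\<Sum>w\<in>\<Omega>. q w * F (\<lambda>i. s i + g w i)) \<le> (1 + v) * F s" by (simp add: mult.commute)
  qed (use q \<open>v \<ge> 0\<close> in auto)
  have "(\<Sum>z\<in>B. \<Prod>j=1..n. q (z j)) \<le> pexp q \<Omega> n (\<lambda>z. F (\<lambda>i. \<Sum>j=1..n. g (z j) i)) / (exp R / 2)"
  proof (rule pexp_Markov[OF assms(1)])
    fix z assume "z \<in> B"
    have "exp R / 2 \<le> cosh R" by (simp add: cosh_def)
    also have "\<dots> \<le> F (\<lambda>i. \<Sum>j=1..n. g (z j) i)"
      unfolding F_def using big[OF \<open>z \<in> B\<close>] \<open>R \<ge> 0\<close> by (simp add: cosh_real_nonneg_le_iff)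
    finally show "exp R / 2 \<le> F (\<lambda>i. \<Sum>j=1..n. g (z j) i)" .
  qed (use q B in \<open>auto simp: F_def\<close>)
  also have "\<dots> \<le> (1 + v) ^ n / (exp R / 2)"
    using le by (intro divide_right_mono) (auto simp: F_def L2_set_def)
  also have "\<dots> \<le> exp v ^ n / (exp R / 2)"
    using \<open>v \<ge> 0\<close> by (intro divide_right_mono power_mono exp_ge_add_one_self) auto
  also have "\<dots> = 2 * exp (real n * v - R)"
    by (simp add: exp_diff exp_of_nat_mult)
  finally show ?thesis .
qed

section \<open>Nuclear norm duality and the coherence function\<close>

definition kip :: "nat \<Rightarrow> (nat \<Rightarrow> nat \<Rightarrow> real) \<Rightarrow> (nat \<Rightarrow> nat \<Rightarrow> real) \<Rightarrow> real" where
  "kip m A B = (\<Sum>i<m. \<Sum>j<m. A i j * B i j)"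

lemma kip_commute: "kip m A B = kip m B A"
  by (simp add: kip_def mult.commute)

lemma kip_cong:
  "(\<And>i j. i < m \<Longrightarrow> j < m \<Longrightarrow> A i j = A' i j) \<Longrightarrow>
   (\<And>i j. i < m \<Longrightarrow> j < m \<Longrightarrow> B i j = B' i j) \<Longrightarrow> kip m A B = kip m A' B'"
  by (simp add: kip_def)

lemma kip_add_right: "kip m A (\<lambda>i j. B i j + C i j) = kip m A B + kip m A C"
  by (simp add: kip_def distrib_left sum.distrib)

lemma kip_diff_right: "kip m A (\<lambda>i j. B i j - C i j) = kip m A B - kip m A C"
  by (simp add: kip_def right_diff_distrib sum_subtractf)

lemma kip_scale_right: "kip m A (\<lambda>i j. c * B i j) = c * kip m A B"
  by (simp add: kip_def sum_distrib_left mult_ac)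

lemma kip_add_left: "kip m (\<lambda>i j. B i j + C i j) A = kip m B A + kip m C A"
  by (simp add: kip_def distrib_right sum.distrib)

lemma kip_diff_left: "kip m (\<lambda>i j. B i j - C i j) A = kip m B A - kip m C A"
  by (simp add: kip_def left_diff_distrib sum_subtractf)

lemma kip_scale_left: "kip m (\<lambda>i j. c * B i j) A = c * kip m B A"
  by (simp add: kip_def sum_distrib_left mult_ac)

lemma kip_self_nonneg: "0 \<le> kip m A A"
  by (simp add: kip_def sum_nonneg)

lemma kip_transpose: "kip m (\<lambda>i j. A j i) (\<lambda>i j. B j i) = kip m A B"
  unfolding kip_def by (rule sum.swap)

lemma kip_spec: "kip m (spec I a \<psi>) B = (\<Sum>k\<in>I. a k * ip m (\<psi> k) (kapp m B (\<psi> k)))"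
proof -
  have "kip m (spec I a \<psi>) B = (\<Sum>i<m. \<Sum>l<m. \<Sum>k\<in>I. a k * (\<psi> k i * (B i l * \<psi> k l)))"
    by (simp add: kip_def spec_def sum_distrib_left mult_ac)
  also have "\<dots> = (\<Sum>i<m. \<Sum>k\<in>I. \<Sum>l<m. a k * (\<psi> k i * (B i l * \<psi> k l)))"
    by (intro sum.cong refl sum.swap)
  also have "\<dots> = (\<Sum>k\<in>I. \<Sum>i<m. \<Sum>l<m. a k * (\<psi> k i * (B i l * \<psi> k l)))" by (rule sum.swap)
  finally show ?thesis by (simp add: ip_def kapp_def sum_distrib_left)
qed

lemma kip_basis:
  assumes "finite J" "card J = m" "orthonormal_on m J \<phi>"
  shows "kip m B A = (\<Sum>k\<in>J. ip m (kapp m B (\<phi> k)) (kapp m A (\<phi> k)))"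
proof -
  have k: "kapp m B (\<phi> k) i = ip m (\<phi> k) (B i)" for B :: "nat \<Rightarrow> nat \<Rightarrow> real" and k i
    by (simp add: kapp_def ip_def mult.commute)
  have "kip m B A = (\<Sum>i<m. ip m (B i) (A i))" by (simp add: kip_def ip_def)
  also have "\<dots> = (\<Sum>i<m. \<Sum>k\<in>J. kapp m B (\<phi> k) i * kapp m A (\<phi> k) i)"
    unfolding k Parseval[OF assms] ..
  also have "\<dots> = (\<Sum>k\<in>J. \<Sum>i<m. kapp m B (\<phi> k) i * kapp m A (\<phi> k) i)" by (rule sum.swap)
  finally show ?thesis by (simp add: ip_def)
qed

text \<open>For each basis vector, \<open>0 \<le> nsq m (x - d y)\<close> with
  \<open>d = \<kappa> * a k\<close>. The free factor \<open>\<kappa>\<close> lets several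
  applications share one quadratic term.\<close>

lemma kip_weighted_AM_GM:
  assumes J: "finite J" "card J = m" "orthonormal_on m J \<phi>"
    and a: "\<And>k. k \<in> J \<Longrightarrow> 0 < a k" and "0 < \<kappa>"
  shows "2 * kip m B A \<le> (\<Sum>k\<in>J. 1 / a k * nsq m (kapp m B (\<phi> k))) / \<kappa>
    + \<kappa> * (\<Sum>k\<in>J. a k * nsq m (kapp m A (\<phi> k)))"
proof -
  have "2 * kip m B A \<le> (\<Sum>k\<in>J. (1 / a k * nsq m (kapp m B (\<phi> k))) / \<kappa>
      + \<kappa> * (a k * nsq m (kapp m A (\<phi> k))))"
    unfolding kip_basis[OF J] sum_distrib_left
  proof (intro sum_mono)
    fix k assume "k \<in> J"
    let ?x = "kapp m B (\<phi> k)" and ?y = "kapp m A (\<phi> k)"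
    define d where "d = \<kappa> * a k"
    have "d > 0" using a[OF \<open>k \<in> J\<close>] \<open>0 < \<kappa>\<close> by (simp add: d_def)
    have "0 \<le> nsq m (\<lambda>i. ?x i - d * ?y i)" by (rule ip_self_nonneg)
    also have "\<dots> = nsq m ?x - 2 * d * ip m ?x ?y + d * d * nsq m ?y"
      by (simp add: ip_diff_left ip_diff_right ip_scale_left ip_scale_right ip_commute[of m ?y ?x] algebra_simps)
    finally have "2 * d * ip m ?x ?y / d \<le> (nsq m ?x + d * d * nsq m ?y) / d"
      using \<open>d > 0\<close> by (intro divide_right_mono) auto
    then have "2 * ip m ?x ?y \<le> nsq m ?x / d + d * nsq m ?y"
      using \<open>d > 0\<close> by (simp add: add_divide_distrib)
    then show "2 * ip m ?x ?y \<le> (1 / a k * nsq m ?x) / \<kappa> + \<kappa> * (a k * nsq m ?y)"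
      by (simp add: d_def mult_ac)
  qed
  then show ?thesis by (simp add: sum.distrib sum_divide_distrib sum_distrib_left)
qed

text \<open>The component of \<open>\<Xi>\<close> acting non-trivially on the range of the projection \<open>1 - R\<close>.\<close>

definition comp_part ::
    "nat \<Rightarrow> (nat \<Rightarrow> nat \<Rightarrow> real) \<Rightarrow> (nat \<Rightarrow> nat \<Rightarrow> real) \<Rightarrow> nat \<Rightarrow> nat \<Rightarrow> real" where
  "comp_part m R \<Xi> i j = \<Xi> i j - kmult m R (kmult m \<Xi> R) i j"

lemma kapp_comp_part: "kapp m (comp_part m R \<Xi>) x i = kapp m \<Xi> x i - kapp m R (kapp m \<Xi> (kapp m R x)) i"
  unfolding kapp_kmult[symmetric]
  by (simp add: kapp_def comp_part_def left_diff_distrib sum_subtractf)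

lemma kapp_spec_eigenvector:
  assumes "finite I" "orthonormal_on m I \<psi>" "k \<in> I"
  shows "kapp m (spec I a \<psi>) (\<psi> k) i = a k * \<psi> k i"
proof -
  have "kapp m (spec I a \<psi>) (\<psi> k) i = (\<Sum>l\<in>I. (a l * \<psi> l i) * (if l = k then 1 else 0))"
    unfolding kapp_spec using assms by (intro sum.cong refl) (auto simp: orthonormal_on_def)
  then show ?thesis by (simp only: sum_mult_delta[OF assms(1,3)])
qed

text \<open>
  Duality for the nuclear norm: the test matrix \<open>sgn S\<^sub>0 + (2/\<epsilon>) R \<Xi> R\<close> has operator norm at
  most one, so the nuclear norm penalty absorbs the part of the noise \<open>\<Xi>\<close> orthogonal to the
  support of \<open>S\<^sub>0\<close>.
\<close>

lemma nuclear_penalty_bound: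
  fixes \<mu> :: "nat \<Rightarrow> real"
  assumes o: "orthonormal_on m {..<m} \<psi>" and o': "orthonormal_on m {..<m} \<eta>"
    and sym: "ksym m \<Xi>" and "0 < \<epsilon>"
    and noise: "\<And>x. \<bar>ip m x (kapp m \<Xi> x)\<bar> \<le> \<epsilon> / 2 * nsq m x"
    and A: "\<And>i j. i < m \<Longrightarrow> j < m \<Longrightarrow> A i j = spec {..<m} \<nu> \<eta> i j - spec {..<m} \<mu> \<psi> i j"
  defines "R \<equiv> spec {..<m} (\<lambda>k. if \<mu> k = 0 then 1 else 0) \<psi>"
    and "G \<equiv> spec {..<m} (\<lambda>k. sgn (\<mu> k)) \<psi>"
  shows "2 * kip m \<Xi> A - \<epsilon> * ((\<Sum>k<m. \<bar>\<nu> k\<bar>) - (\<Sum>k<m. \<bar>\<mu> k\<bar>)) \<le>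
    2 * kip m (comp_part m R \<Xi>) A - \<epsilon> * kip m G A"
proof -
  define T where "T = kmult m R (kmult m \<Xi> R)"
  define K where "K = (\<lambda>i j. G i j + 2 / \<epsilon> * T i j)"
  have R: "ksym m R" by (simp add: R_def ksym_def spec_sym)
  have T: "ip m x (kapp m T x) = ip m (kapp m R x) (kapp m \<Xi> (kapp m R x))" for x
    unfolding T_def kapp_kmult by (rule ip_kapp[OF R])
  have K: "ip m x (kapp m K x) = ip m x (kapp m G x) + 2 / \<epsilon> * ip m (kapp m R x) (kapp m \<Xi> (kapp m R x))" for x
  proof -
    have "kapp m K x = (\<lambda>i. kapp m G x i + 2 / \<epsilon> * kapp m T x i)"
      unfolding K_def by (simp add: fun_eq_iff kapp_def distrib_right sum.distrib sum_distrib_left mult.assoc)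
    then show ?thesis by (simp only: ip_add_right ip_scale_right T)
  qed
  \<comment> \<open>\<open>G\<close> and \<open>T\<close> act on complementary eigenspaces. Their
    forms are bounded by the two complementary parts of one Parseval sum, so the total is
    \<open>nsq m x\<close> and not twice that.\<close>
  have K1: "\<bar>ip m x (kapp m K x)\<bar> \<le> nsq m x" for x
  proof -
    have "\<bar>ip m x (kapp m G x)\<bar> \<le> (\<Sum>k<m. \<bar>sgn (\<mu> k) * (ip m (\<psi> k) x)\<^sup>2\<bar>)"
      unfolding G_def ip_kapp_spec by (rule sum_abs)
    moreover have "\<bar>2 / \<epsilon> * ip m (kapp m R x) (kapp m \<Xi> (kapp m R x))\<bar> \<le>
        2 / \<epsilon> * (\<epsilon> / 2 * nsq m (kapp m R x))"
      unfolding abs_mult using \<open>0 < \<epsilon>\<close> noise[of "kapp m R x"] by (intro mult_mono) auto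
    moreover have "2 / \<epsilon> * (\<epsilon> / 2 * nsq m (kapp m R x)) =
        (\<Sum>k<m. (if \<mu> k = 0 then 1 else 0)\<^sup>2 * (ip m (\<psi> k) x)\<^sup>2)"
      using \<open>0 < \<epsilon>\<close> unfolding R_def norm_kapp_spec[OF finite_lessThan o] by simp
    moreover have "(\<Sum>k<m. \<bar>sgn (\<mu> k) * (ip m (\<psi> k) x)\<^sup>2\<bar>) +
        (\<Sum>k<m. (if \<mu> k = 0 then 1 else 0)\<^sup>2 * (ip m (\<psi> k) x)\<^sup>2) = nsq m x"
      unfolding sum.distrib[symmetric] Parseval[OF finite_lessThan card_lessThan o, of x x, symmetric]
      by (intro sum.cong refl) (auto simp: abs_mult power2_eq_square sgn_if)
    ultimately show ?thesis unfolding K by linarith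
  qed
  have "kip m (spec {..<m} \<nu> \<eta>) K \<le> (\<Sum>k<m. \<bar>\<nu> k\<bar>)"
    unfolding kip_spec
  proof (intro sum_mono)
    fix k assume "k \<in> {..<m}"
    then have "nsq m (\<eta> k) = 1" using o' by (simp add: orthonormal_on_def)
    then have "\<bar>\<nu> k * ip m (\<eta> k) (kapp m K (\<eta> k))\<bar> \<le> \<bar>\<nu> k\<bar> * 1"
      unfolding abs_mult using K1[of "\<eta> k"] by (intro mult_left_mono) auto
    then show "\<nu> k * ip m (\<eta> k) (kapp m K (\<eta> k)) \<le> \<bar>\<nu> k\<bar>" by simp
  qed
  \<comment> \<open>The test matrix attains the norm of the second kernel: its noise part vanishes
    at every \<open>\<psi> k\<close> with \<open>\<mu> k \<noteq> 0\<close>.\<close>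
  moreover have "kip m (spec {..<m} \<mu> \<psi>) K = (\<Sum>k<m. \<bar>\<mu> k\<bar>)"
    unfolding kip_spec
  proof (intro sum.cong refl)
    fix k assume k: "k \<in> {..<m}"
    have "ip m (\<psi> k) (kapp m G (\<psi> k)) = sgn (\<mu> k)"
      unfolding G_def using eigenvalue_quadratic_form[OF o] k by simp
    moreover have "\<mu> k \<noteq> 0 \<Longrightarrow> kapp m R (\<psi> k) = (\<lambda>i. 0)"
      unfolding R_def using kapp_spec_eigenvector[OF _ o k] by (simp add: fun_eq_iff)
    then have "\<mu> k * ip m (kapp m R (\<psi> k)) (kapp m \<Xi> (kapp m R (\<psi> k))) = 0"
      by (cases "\<mu> k = 0") (simp_all add: ip_def)
    ultimately show "\<mu> k * ip m (\<psi> k) (kapp m K (\<psi> k)) = \<bar>\<mu> k\<bar>"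
      unfolding K by (simp add: distrib_left abs_sgn)
  qed
  moreover have "kip m A K = kip m (spec {..<m} \<nu> \<eta>) K - kip m (spec {..<m} \<mu> \<psi>) K"
    unfolding kip_diff_left[symmetric] by (rule kip_cong) (simp_all add: A)
  ultimately have "kip m A K \<le> (\<Sum>k<m. \<bar>\<nu> k\<bar>) - (\<Sum>k<m. \<bar>\<mu> k\<bar>)" by simp
  then have "\<epsilon> * kip m A K \<le> \<epsilon> * ((\<Sum>k<m. \<bar>\<nu> k\<bar>) - (\<Sum>k<m. \<bar>\<mu> k\<bar>))"
    using \<open>0 < \<epsilon>\<close> by (intro mult_left_mono) auto
  moreover have "\<epsilon> * kip m A K = \<epsilon> * kip m G A + 2 * kip m T A"
    using \<open>0 < \<epsilon>\<close> unfolding K_def kip_add_right kip_scale_right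
    by (simp add: distrib_left kip_commute)
  moreover have "kip m (comp_part m R \<Xi>) A = kip m \<Xi> A - kip m T A"
    unfolding kip_diff_left[symmetric] by (rule kip_cong) (simp_all add: comp_part_def T_def)
  ultimately show ?thesis by simp
qed

text \<open>Summation by parts: against nonincreasing weights, \<open>f\<close> may be replaced by
  the constant \<open>\<tau>\<close> that dominates its averages. The term
  \<open>real s * g s\<close> pays for the mass of \<open>f\<close> up to \<open>s\<close>.\<close>

lemma decreasing_weights_sum:
  fixes f g :: "nat \<Rightarrow> real"
  assumes "1 \<le> s" and f: "\<And>k. 0 \<le> f k" and g: "\<And>k. s \<le> k \<Longrightarrow> k \<le> m \<Longrightarrow> 0 \<le> g k"
    and mono: "\<And>k. s \<le> k \<Longrightarrow> k < m \<Longrightarrow> g (Suc k) \<le> g k"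
    and F: "\<And>j. s \<le> j \<Longrightarrow> j \<le> m \<Longrightarrow> (\<Sum>i=1..j. f i) \<le> real j * \<tau>"
    and "s \<le> m"
  shows "(\<Sum>k=s..m. f k * g k) \<le> \<tau> * (real s * g s + (\<Sum>k=s..m. g k))"
proof -
  define F where "F j = (\<Sum>i=1..j. f i)" for j
  have "0 \<le> real s * \<tau>" using F[of s] \<open>s \<le> m\<close> f by (meson order_refl order_trans sum_nonneg)
  then have "\<tau> \<ge> 0" using \<open>1 \<le> s\<close> by (simp add: zero_le_mult_iff)
  \<comment> \<open>The extra summand is the unspent allowance \<open>M * \<tau> - F M\<close>,
    valued at the current weight. It is nonnegative, so passing to the next, smaller weight can only
    lower it.\<close>
  have main: "(\<Sum>k=s..M. f k * g k) + (real M * \<tau> - F M) * g M \<le> \<tau> * (real s * g s + (\<Sum>k=s..M. g k))"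
    if "s \<le> M" "M \<le> m" for M
    using that
  proof (induction M rule: dec_induct)
    case base
    have "f s \<le> F s" unfolding F_def using \<open>1 \<le> s\<close> f by (intro member_le_sum) auto
    then have "f s * g s \<le> F s * g s" using g[of s] base by (intro mult_right_mono) auto
    moreover have "0 \<le> \<tau> * g s" using \<open>\<tau> \<ge> 0\<close> g[of s] base by simp
    ultimately show ?case by (simp add: algebra_simps)
  next
    case (step M)
    have "F (Suc M) = F M + f (Suc M)" by (simp add: F_def)
    then have "(\<Sum>k=s..Suc M. f k * g k) + (real (Suc M) * \<tau> - F (Suc M)) * g (Suc M) =
        (\<Sum>k=s..M. f k * g k) + (real M * \<tau> - F M) * g (Suc M) + \<tau> * g (Suc M)"
      using step.hyps by (simp add: algebra_simps)
    moreover have "(real M * \<tau> - F M) * g (Suc M) \<le> (real M * \<tau> - F M) * g M"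
      using mono[of M] F[of M] step by (intro mult_left_mono) (auto simp: F_def)
    moreover have "(\<Sum>k=s..Suc M. g k) = (\<Sum>k=s..M. g k) + g (Suc M)" using step.hyps by simp
    ultimately show ?case using step.IH step.prems by (simp add: algebra_simps)
  qed
  have "0 \<le> (real m * \<tau> - F m) * g m" using F[of m] g[of m] \<open>s \<le> m\<close> by (auto simp: F_def)
  then show ?thesis using main[of m] \<open>s \<le> m\<close> by simp
qed

text \<open>
  The weights \<open>a k\<close> interpolate between the \<open>L\<^sub>2\<close> norm (\<open>k < s\<close>) and the smoothness penalty
  (\<open>k \<ge> s\<close>); \<open>\<rho>\<close> stands for the coherence function at \<open>s\<close>.
\<close>

lemma coherence_weighted_sums:
  fixes lam f :: "nat \<Rightarrow> real"
  assumes s: "k0 + 1 \<le> s" "s \<le> m + 1" "1 \<le> k0" and pos: "0 < lam k0"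
    and mono: "\<And>i j. 1 \<le> i \<Longrightarrow> i \<le> j \<Longrightarrow> j \<le> m \<Longrightarrow> lam i \<le> lam j"
    and f: "\<And>k. 0 \<le> f k" and "0 < c"
    and tail: "s \<le> m \<Longrightarrow> (\<Sum>k=s..m. 1 / lam k) \<le> c * (real s / lam s)"
    and e: "s \<le> m \<Longrightarrow> 1 / lam s \<le> e"
    and coh: "\<And>l j. 1 \<le> l \<Longrightarrow> l \<le> min s m \<Longrightarrow> l \<le> j \<Longrightarrow> j \<le> m \<Longrightarrow>
      real l * (1 / real j * (\<Sum>i=1..j. f i)) \<le> \<rho>"
  defines "a \<equiv> \<lambda>k. if k < s then 1 else e * lam k"
  shows "\<And>k. 1 \<le> k \<Longrightarrow> k \<le> m \<Longrightarrow> 1 \<le> a k"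
    and "(\<Sum>k=1..m. 1 / a k * f k) \<le> (2 + c) * \<rho>"
    and "(\<Sum>k=1..m. 1 / a k * ((\<Sum>i=1..m. f i) / real m)) \<le> (1 + c) * \<rho>"
proof -
  define r where "r = (\<Sum>i=1..m. f i)"
  have "r \<ge> 0" unfolding r_def using f by (intro sum_nonneg) auto
  have "1 \<le> m" using s by simp
  have lp: "0 < lam k" if "s \<le> k" "k \<le> m" for k
    using mono[of k0 k] pos s that by simp
  show a1: "1 \<le> a k" if "1 \<le> k" "k \<le> m" for k
  proof (cases "k < s")
    case False
    then have "s \<le> m" using that by simp
    have "0 \<le> e" using order_trans[OF _ e[OF \<open>s \<le> m\<close>], of 0] lp[of s] \<open>s \<le> m\<close> by simp
    have "1 = 1 / lam s * lam s" using lp[of s] \<open>s \<le> m\<close> by simp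
    also have "\<dots> \<le> e * lam k"
      using \<open>0 \<le> e\<close> e[OF \<open>s \<le> m\<close>] mono[of s k] False that s lp[of s] \<open>s \<le> m\<close> by (intro mult_mono) auto
    finally show ?thesis using False by (simp add: a_def)
  qed (simp add: a_def)
  have split: "(\<Sum>k=1..m. h k) = (\<Sum>k=1..s-1. h k) + (\<Sum>k=s..m. h k)" for h :: "nat \<Rightarrow> real"
  proof -
    have "{1..m} = {1..s-1} \<union> {s..m}" using s by auto
    then show ?thesis using s by (simp add: sum.union_disjoint)
  qed
  have low: "(\<Sum>k=1..s-1. 1 / a k * h k) = (\<Sum>k=1..s-1. h k)" for h
    using s by (intro sum.cong refl) (auto simp: a_def)
  \<comment> \<open>Since \<open>1 / e \<le> lam s\<close>, the weight
    \<open>1 / (e * lam k)\<close> is at most \<open>lam s / lam k\<close>.\<close>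
  have high: "(\<Sum>k=s..m. 1 / a k * h k) \<le> lam s * (\<Sum>k=s..m. h k * (1 / lam k))"
    if "s \<le> m" "\<And>k. 0 \<le> h k" for h
    unfolding sum_distrib_left
  proof (intro sum_mono)
    fix k assume k: "k \<in> {s..m}"
    have "0 < e" using less_le_trans[OF _ e[OF that(1)], of 0] lp[of s] that(1) by simp
    have "1 / a k * h k = (1 / e) * (h k * (1 / lam k))" using k by (simp add: a_def)
    moreover have "1 / e \<le> lam s"
      using e[OF that(1)] lp[of s] that(1) \<open>0 < e\<close> by (simp add: field_simps)
    then have "1 / e * (h k * (1 / lam k)) \<le> lam s * (h k * (1 / lam k))"
      using lp[of k] k that(2)[of k] by (intro mult_right_mono) auto
    ultimately show "1 / a k * h k \<le> lam s * (h k * (1 / lam k))" by (simp only:)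
  qed
  \<comment> \<open>The choice \<open>l = j = s - 1\<close>; it is admissible because
    \<open>s \<ge> k0 + 1 \<ge> 2\<close>. The next bound takes \<open>l = s - 1\<close> and
    \<open>j = m\<close>.\<close>
  have "real (s-1) * (1 / real (s-1) * (\<Sum>i=1..s-1. f i)) \<le> \<rho>"
    using s by (intro coh) auto
  then have lowf: "(\<Sum>k=1..s-1. f k) \<le> \<rho>" using s by simp
  have lowr: "real (s-1) * (r / real m) \<le> \<rho>"
    using coh[of "s-1" m] s by (simp add: r_def)
  have "\<rho> \<ge> 0" using lowf f by (meson order_trans sum_nonneg)
  show "(\<Sum>k=1..m. 1 / a k * f k) \<le> (2 + c) * \<rho>"
  proof (cases "s \<le> m")
    case True
    \<comment> \<open>Here \<open>\<tau> = \<rho> / s\<close>, which is the coherence bound with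
      \<open>l = s\<close> and all \<open>j \<ge> s\<close>.\<close>
    have "(\<Sum>k=s..m. f k * (1 / lam k)) \<le> (\<rho> / real s) * (real s * (1 / lam s) + (\<Sum>k=s..m. 1 / lam k))"
    proof (rule decreasing_weights_sum)
      fix j assume j: "s \<le> j" "j \<le> m"
      then have "real s * (1 / real j * (\<Sum>i=1..j. f i)) \<le> \<rho>" using s True by (intro coh) auto
      then show "(\<Sum>i=1..j. f i) \<le> real j * (\<rho> / real s)" using j s by (simp add: field_simps)
    next
      fix k assume "s \<le> k" "k < m"
      then show "1 / lam (Suc k) \<le> 1 / lam k"
        using mono[of k "Suc k"] lp[of k] s by (intro divide_left_mono) auto
    qed (use s True f lp in \<open>auto simp: less_imp_le\<close>)
    also have "\<dots> \<le> (\<rho> / real s) * (real s * (1 / lam s) + c * (real s / lam s))"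
      using tail[OF True] \<open>\<rho> \<ge> 0\<close> by (intro mult_left_mono add_left_mono) auto
    also have "\<dots> = (1 + c) * \<rho> / lam s" using s lp[of s] True by (simp add: field_simps)
    finally have "lam s * (\<Sum>k=s..m. f k * (1 / lam k)) \<le> (1 + c) * \<rho>"
      using lp[of s] True by (simp add: field_simps)
    then have "(\<Sum>k=s..m. 1 / a k * f k) \<le> (1 + c) * \<rho>"
      using high[OF True f] by (rule order_trans[rotated])
    then show ?thesis unfolding split low using lowf by (simp add: algebra_simps)
  next
    case False
    then have "(\<Sum>k=s..m. 1 / a k * f k) = 0" by simp
    moreover have "\<rho> \<le> (2 + c) * \<rho>" using \<open>\<rho> \<ge> 0\<close> \<open>0 < c\<close> by (simp add: algebra_simps)
    ultimately show ?thesis unfolding split low using lowf by linarith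
  qed
  show "(\<Sum>k=1..m. 1 / a k * ((\<Sum>i=1..m. f i) / real m)) \<le> (1 + c) * \<rho>"
    unfolding r_def[symmetric]
  proof (cases "s \<le> m")
    case True
    have "lam s * (\<Sum>k=s..m. r / real m * (1 / lam k)) = r / real m * (lam s * (\<Sum>k=s..m. 1 / lam k))"
      by (simp add: sum_distrib_left mult_ac)
    also have "\<dots> \<le> r / real m * (lam s * (c * (real s / lam s)))"
      using tail[OF True] lp[of s] True \<open>r \<ge> 0\<close> by (intro mult_left_mono) (auto simp: less_imp_le)
    also have "\<dots> = c * (real s * (1 / real m * r))" using lp[of s] True by simp
    also have "\<dots> \<le> c * \<rho>"
      using coh[of s m] s True \<open>0 < c\<close> unfolding r_def by (intro mult_left_mono) auto
    finally have "(\<Sum>k=s..m. 1 / a k * (r / real m)) \<le> c * \<rho>"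
      using order_trans[OF high[OF True, of "\<lambda>_. r / real m"]] \<open>r \<ge> 0\<close> by simp
    moreover have "(\<Sum>k=1..s-1. r / real m) \<le> \<rho>" using lowr by simp
    ultimately show "(\<Sum>k=1..m. 1 / a k * (r / real m)) \<le> (1 + c) * \<rho>"
      unfolding split low by (simp add: algebra_simps)
  next
    case False
    then have "(\<Sum>k=s..m. 1 / a k * (r / real m)) = 0" by simp
    moreover have "(\<Sum>k=1..s-1. r / real m) \<le> \<rho>" using lowr by simp
    moreover have "\<rho> \<le> (1 + c) * \<rho>" using \<open>\<rho> \<ge> 0\<close> \<open>0 < c\<close> by (simp add: algebra_simps)
    ultimately show "(\<Sum>k=1..m. 1 / a k * (r / real m)) \<le> (1 + c) * \<rho>" unfolding split low by linarith
  qed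
qed

section \<open>The sampling noise\<close>

lemma double_delta:
  fixes g :: "nat \<Rightarrow> nat \<Rightarrow> real"
  assumes "i < m" "j < m"
  shows "(\<Sum>u<m. \<Sum>v<m. g u v * ((if i = u then 1 else 0) * (if j = v then 1 else 0))) = g i j"
proof -
  have "(\<Sum>u<m. \<Sum>v<m. g u v * ((if i = u then 1 else 0) * (if j = v then 1 else 0))) =
      (\<Sum>u<m. (\<Sum>v<m. g u v * (if j = v then 1 else 0)) * (if i = u then 1 else 0))"
    unfolding sum_distrib_right by (intro sum.cong refl) (simp only: mult_ac)
  also have "\<dots> = (\<Sum>v<m. g i v * (if j = v then 1 else 0))"
    using assms by (intro sum_mult_delta(2)) auto
  also have "\<dots> = g i j" using assms by (intro sum_mult_delta(2)) auto
  finally show ?thesis .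
qed

lemma centred_second_moment:
  fixes f q :: "'w \<Rightarrow> real"
  assumes "(\<Sum>w\<in>\<Omega>. q w) = 1" and b: "(\<Sum>w\<in>\<Omega>. q w * (f w - b)) = 0"
  shows "(\<Sum>w\<in>\<Omega>. q w * (f w - b)\<^sup>2) = (\<Sum>w\<in>\<Omega>. q w * (f w)\<^sup>2) - b\<^sup>2"
proof -
  have "(\<Sum>w\<in>\<Omega>. q w * (f w - b)\<^sup>2) =
      (\<Sum>w\<in>\<Omega>. q w * (f w)\<^sup>2) - 2 * b * (\<Sum>w\<in>\<Omega>. q w * (f w - b)) - b\<^sup>2 * (\<Sum>w\<in>\<Omega>. q w)"
    unfolding sum_distrib_left sum_subtractf[symmetric]
    by (intro sum.cong refl) (simp add: power2_eq_square algebra_simps)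
  then show ?thesis using assms by simp
qed

lemma kapp_diff_kernel: "kapp m (\<lambda>i j. A i j - B i j) x i = kapp m A x i - kapp m B x i"
  by (simp add: kapp_def left_diff_distrib sum_subtractf)

lemma kapp_scale_kernel: "kapp m (\<lambda>i j. c * A i j) x i = c * kapp m A x i"
  by (simp add: kapp_def sum_distrib_left mult.assoc)

lemma kapp_sum_kernel: "kapp m (\<lambda>i j. \<Sum>l\<in>L. A l i j) x i = (\<Sum>l\<in>L. kapp m (A l) x i)"
  unfolding kapp_def by (subst sum.swap) (simp add: sum_distrib_right)

lemma kapp_diff: "kapp m A (\<lambda>j. x j - y j) i = kapp m A x i - kapp m A y i"
  by (simp add: kapp_def right_diff_distrib sum_subtractf)

lemma kapp_scale: "kapp m A (\<lambda>j. c * x j) i = c * kapp m A x i"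
  by (simp add: kapp_def sum_distrib_left mult_ac)

lemma kapp_sum: "kapp m A (\<lambda>j. \<Sum>l\<in>L. x l j) i = (\<Sum>l\<in>L. kapp m A (x l) i)"
  unfolding kapp_def by (subst sum.swap) (simp add: sum_distrib_left)

lemma kapp_cong_vec: "(\<And>j. j < m \<Longrightarrow> x j = y j) \<Longrightarrow> kapp m A x i = kapp m A y i"
  by (simp add: kapp_def)

text \<open>With \<open>P + R = 1\<close> one has \<open>K - R K R = P K + R K P\<close>. The two
  terms have orthogonal ranges, so their squared norms add, and the outer \<open>R\<close> is a
  contraction.\<close>

lemma comp_part_norm:
  fixes \<mu> :: "nat \<Rightarrow> real"
  assumes o: "orthonormal_on m {..<m} \<psi>"
  defines "P \<equiv> spec {..<m} (\<lambda>k. if \<mu> k = 0 then 0 else 1) \<psi>"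
    and "R \<equiv> spec {..<m} (\<lambda>k. if \<mu> k = 0 then 1 else 0) \<psi>"
  shows "nsq m (kapp m (comp_part m R K) x) \<le>
    nsq m (kapp m P (kapp m K x)) + nsq m (kapp m K (kapp m P x))"
proof -
  let ?p = "\<lambda>k. if \<mu> k = 0 then 0 else (1::real)" and ?r = "\<lambda>k. if \<mu> k = 0 then 1 else (0::real)"
  have PR: "kapp m P z i + kapp m R z i = z i" if "i < m" for z i
  proof -
    have "kapp m P z i + kapp m R z i = (\<Sum>k<m. ip m (\<psi> k) z * \<psi> k i)"
      unfolding P_def R_def kapp_spec sum.distrib[symmetric] by (intro sum.cong refl) auto
    then show ?thesis using orthonormal_expansion[OF _ _ o that] by simp
  qed
  let ?y = "kapp m K x" and ?y' = "kapp m K (kapp m P x)"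
  have "kapp m (comp_part m R K) x i = (\<Sum>k<m. (?p k * ip m (\<psi> k) ?y + ?r k * ip m (\<psi> k) ?y') * \<psi> k i)"
    if "i < m" for i
  proof -
    have y': "?y' = (\<lambda>l. ?y l - kapp m K (kapp m R x) l)"
      unfolding kapp_diff[symmetric] using PR[of _ x]
      by (intro ext kapp_cong_vec) (simp add: eq_diff_eq)
    have "kapp m R ?y' i = kapp m R ?y i - kapp m R (kapp m K (kapp m R x)) i"
      unfolding y' by (rule kapp_diff)
    then have "kapp m (comp_part m R K) x i = kapp m P ?y i + kapp m R ?y' i"
      unfolding kapp_comp_part using PR[OF that, of ?y] by simp
    then show ?thesis by (simp add: P_def R_def kapp_spec distrib_right sum.distrib)
  qed
  then have "nsq m (kapp m (comp_part m R K) x) =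
      nsq m (\<lambda>i. \<Sum>k<m. (?p k * ip m (\<psi> k) ?y + ?r k * ip m (\<psi> k) ?y') * \<psi> k i)"
    by (intro ip_cong)
  also have "\<dots> = (\<Sum>k<m. (?p k * ip m (\<psi> k) ?y + ?r k * ip m (\<psi> k) ?y')\<^sup>2)"
    unfolding ip_combination[OF finite_lessThan o] by (simp only: power2_eq_square)
  also have "\<dots> = (\<Sum>k<m. (?p k)\<^sup>2 * (ip m (\<psi> k) ?y)\<^sup>2) + (\<Sum>k<m. (?r k)\<^sup>2 * (ip m (\<psi> k) ?y')\<^sup>2)"
    unfolding sum.distrib[symmetric] by (intro sum.cong refl) auto
  finally have 1: "nsq m (kapp m (comp_part m R K) x) =
      (\<Sum>k<m. (?p k)\<^sup>2 * (ip m (\<psi> k) ?y)\<^sup>2) + (\<Sum>k<m. (?r k)\<^sup>2 * (ip m (\<psi> k) ?y')\<^sup>2)" .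
  have 2: "(\<Sum>k<m. (?p k)\<^sup>2 * (ip m (\<psi> k) ?y)\<^sup>2) = nsq m (kapp m P ?y)"
    unfolding P_def norm_kapp_spec[OF finite_lessThan o] ..
  have "(\<Sum>k<m. (?r k)\<^sup>2 * (ip m (\<psi> k) ?y')\<^sup>2) \<le> (\<Sum>k<m. (ip m (\<psi> k) ?y')\<^sup>2)"
    by (intro sum_mono) auto
  also have "\<dots> \<le> nsq m ?y'" by (rule Bessel[OF finite_lessThan o])
  finally show ?thesis unfolding 1 2 by (rule add_left_mono)
qed

text \<open>The law of one observation as a weight function. Sums over the sign express that the
  pair is uniform, differences over the sign express the regression function.\<close>

locale sampling_model =
  fixes m :: nat and q :: "nat \<times> nat \<times> real \<Rightarrow> real" and S0 :: "nat \<Rightarrow> nat \<Rightarrow> real"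
  assumes m2: "2 \<le> m"
    and q_nonneg: "\<And>w. 0 \<le> q w"
    and q_marginal: "\<And>u v. u < m \<Longrightarrow> v < m \<Longrightarrow> q (u, v, -1) + q (u, v, 1) = 1 / (real m)\<^sup>2"
    and q_regression: "\<And>u v. u < m \<Longrightarrow> v < m \<Longrightarrow> q (u, v, 1) - q (u, v, -1) = S0 u v / (real m)\<^sup>2"
    and S0_sym: "ksym m S0"
begin

definition \<Omega> :: "(nat \<times> nat \<times> real) set" where
  "\<Omega> = {..<m} \<times> {..<m} \<times> {-1, 1}"

text \<open>The symmetrised observation \<open>Y (E\<^bsub>u v\<^esub> + E\<^bsub>v u\<^esub>) / 2\<close>.\<close>

definition obs :: "nat \<times> nat \<times> real \<Rightarrow> nat \<Rightarrow> nat \<Rightarrow> real" where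
  "obs = (\<lambda>(u, v, y) i j. y / 2 *
     ((if i = u then 1 else 0) * (if j = v then 1 else 0) + (if i = v then 1 else 0) * (if j = u then 1 else 0)))"

definition cen :: "nat \<times> nat \<times> real \<Rightarrow> nat \<Rightarrow> nat \<Rightarrow> real" where
  "cen w i j = obs w i j - 1 / (real m)\<^sup>2 * S0 i j"

definition noise :: "nat \<Rightarrow> (nat \<Rightarrow> nat \<times> nat \<times> real) \<Rightarrow> nat \<Rightarrow> nat \<Rightarrow> real" where
  "noise n z i k = 1 / real n * (\<Sum>j=1..n. cen (z j) i k)"

lemma finite_\<Omega>: "finite \<Omega>"
  by (simp add: \<Omega>_def)

lemma sum_\<Omega>: "(\<Sum>w\<in>\<Omega>. f w) = (\<Sum>u<m. \<Sum>v<m. f (u, v, -1) + f (u, v, 1))"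
  for f :: "nat \<times> nat \<times> real \<Rightarrow> real"
proof -
  have "(\<Sum>w\<in>\<Omega>. f w) = (\<Sum>u<m. \<Sum>v<m. \<Sum>y\<in>{-1,1}. f (u, v, y))"
    unfolding \<Omega>_def sum.cartesian_product by (simp add: case_prod_unfold)
  then show ?thesis by simp
qed

lemma expectation_sign_free:
  assumes "\<And>u v y. u < m \<Longrightarrow> v < m \<Longrightarrow> y\<^sup>2 = 1 \<Longrightarrow> f (u, v, y) = h u v"
  shows "(\<Sum>w\<in>\<Omega>. q w * f w) = 1 / (real m)\<^sup>2 * (\<Sum>u<m. \<Sum>v<m. h u v)"
  unfolding sum_\<Omega> sum_distrib_left
proof (intro sum.cong refl)
  fix u v assume "u \<in> {..<m}" "v \<in> {..<m}"
  then show "q (u, v, -1) * f (u, v, -1) + q (u, v, 1) * f (u, v, 1) = 1 / (real m)\<^sup>2 * h u v"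
    using assms[of u v 1] assms[of u v "-1"] q_marginal[of u v] by (simp add: distrib_right[symmetric])
qed

lemma q_total: "(\<Sum>w\<in>\<Omega>. q w) = 1"
  using expectation_sign_free[of "\<lambda>_. 1" "\<lambda>_ _. 1"] m2 by (simp add: power2_eq_square)

lemma S0_bounded: "u < m \<Longrightarrow> v < m \<Longrightarrow> \<bar>S0 u v\<bar> \<le> 1"
proof -
  assume "u < m" "v < m"
  have "\<bar>q (u, v, 1) - q (u, v, -1)\<bar> \<le> q (u, v, -1) + q (u, v, 1)"
    using q_nonneg[of "(u, v, 1)"] q_nonneg[of "(u, v, -1)"] by linarith
  then have "\<bar>S0 u v\<bar> / (real m)\<^sup>2 \<le> 1 / (real m)\<^sup>2"
    unfolding q_marginal[OF \<open>u < m\<close> \<open>v < m\<close>] q_regression[OF \<open>u < m\<close> \<open>v < m\<close>] by simp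
  then show ?thesis using m2 by (simp add: divide_le_cancel)
qed

lemma mean_obs:
  assumes "i < m" "j < m"
  shows "(\<Sum>w\<in>\<Omega>. q w * obs w i j) = 1 / (real m)\<^sup>2 * S0 i j"
proof -
  let ?d = "\<lambda>u v. (if i = u then 1 else 0) * (if j = v then 1 else (0::real))"
  have "(\<Sum>w\<in>\<Omega>. q w * obs w i j) =
      (\<Sum>u<m. \<Sum>v<m. S0 u v / (real m)\<^sup>2 / 2 * ?d u v + S0 u v / (real m)\<^sup>2 / 2 * ?d v u)"
    unfolding sum_\<Omega>
  proof (intro sum.cong refl)
    fix u v assume "u \<in> {..<m}" "v \<in> {..<m}"
    have "q (u, v, -1) * obs (u, v, -1) i j + q (u, v, 1) * obs (u, v, 1) i j =
        (q (u, v, 1) - q (u, v, -1)) / 2 * (?d u v + ?d v u)"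
      unfolding obs_def prod.case by argo
    then show "q (u, v, -1) * obs (u, v, -1) i j + q (u, v, 1) * obs (u, v, 1) i j =
        S0 u v / (real m)\<^sup>2 / 2 * ?d u v + S0 u v / (real m)\<^sup>2 / 2 * ?d v u"
      using q_regression[of u v] \<open>u \<in> {..<m}\<close> \<open>v \<in> {..<m}\<close> by (simp only: distrib_left lessThan_iff)
  qed
  also have "\<dots> = (\<Sum>u<m. \<Sum>v<m. S0 u v / (real m)\<^sup>2 / 2 * ?d u v) + (\<Sum>u<m. \<Sum>v<m. S0 u v / (real m)\<^sup>2 / 2 * ?d v u)"
    by (simp add: sum.distrib)
  also have "(\<Sum>u<m. \<Sum>v<m. S0 u v / (real m)\<^sup>2 / 2 * ?d v u) = (\<Sum>v<m. \<Sum>u<m. S0 u v / (real m)\<^sup>2 / 2 * ?d v u)"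
    by (rule sum.swap)
  also have "(\<Sum>u<m. \<Sum>v<m. S0 u v / (real m)\<^sup>2 / 2 * ?d u v) = S0 i j / (real m)\<^sup>2 / 2"
    by (rule double_delta[OF assms])
  also have "(\<Sum>v<m. \<Sum>u<m. S0 u v / (real m)\<^sup>2 / 2 * ?d v u) = S0 j i / (real m)\<^sup>2 / 2"
    by (rule double_delta[OF assms, of "\<lambda>v u. S0 u v / (real m)\<^sup>2 / 2"])
  also have "S0 j i = S0 i j" using S0_sym assms by (simp add: ksym_def)
  finally show ?thesis by simp
qed

lemma ksym_cen: "ksym m (cen w)"
proof -
  obtain u v y where w: "w = (u, v, y)" by (cases w)
  show ?thesis using S0_sym by (auto simp: ksym_def cen_def obs_def w)
qed

lemma kapp_obs:
  assumes "u < m" "v < m"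
  shows "kapp m (obs (u, v, y)) x i = y / 2 * ((if i = u then 1 else 0) * x v + (if i = v then 1 else 0) * x u)"
proof -
  have "kapp m (obs (u, v, y)) x i = y / 2 *
      ((if i = u then 1 else 0) * (\<Sum>j<m. (if j = v then 1 else 0) * x j) +
       (if i = v then 1 else 0) * (\<Sum>j<m. (if j = u then 1 else 0) * x j))"
    by (simp only: kapp_def obs_def prod.case sum_distrib_left sum.distrib[symmetric] distrib_left distrib_right mult.assoc)
  then show ?thesis using assms by (simp only: sum_mult_delta finite_lessThan lessThan_iff)
qed

lemma mean_kapp_cen:
  assumes "i < m"
  shows "(\<Sum>w\<in>\<Omega>. q w * kapp m (cen w) x i) = 0"
proof -
  have "(\<Sum>w\<in>\<Omega>. q w * kapp m (cen w) x i) = (\<Sum>j<m. x j * (\<Sum>w\<in>\<Omega>. q w * cen w i j))"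
    unfolding kapp_def sum_distrib_left by (subst sum.swap) (simp add: mult_ac)
  also have "\<dots> = (\<Sum>j<m. x j * 0)"
  proof (intro sum.cong refl)
    fix j assume "j \<in> {..<m}"
    have "(\<Sum>w\<in>\<Omega>. q w * cen w i j) = (\<Sum>w\<in>\<Omega>. q w * obs w i j) - (\<Sum>w\<in>\<Omega>. q w) * (1 / (real m)\<^sup>2 * S0 i j)"
      unfolding cen_def by (simp only: right_diff_distrib sum_subtractf sum_distrib_right)
    then show "x j * (\<Sum>w\<in>\<Omega>. q w * cen w i j) = x j * 0"
      using mean_obs[of i j] assms \<open>j \<in> {..<m}\<close> q_total by simp
  qed
  finally show ?thesis by simp
qed

lemma mean_quadratic_cen: "(\<Sum>w\<in>\<Omega>. q w * ip m x (kapp m (cen w) x)) = 0"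
proof -
  have "(\<Sum>w\<in>\<Omega>. q w * ip m x (kapp m (cen w) x)) = (\<Sum>i<m. x i * (\<Sum>w\<in>\<Omega>. q w * kapp m (cen w) x i))"
    unfolding ip_def sum_distrib_left by (subst sum.swap) (simp add: mult_ac)
  also have "\<dots> = 0" by (intro sum.neutral) (simp add: mean_kapp_cen)
  finally show ?thesis .
qed

lemma mean_comp_cen:
  assumes "i < m"
  shows "(\<Sum>w\<in>\<Omega>. q w * kapp m (comp_part m R (cen w)) x i) = 0"
proof -
  have "(\<Sum>w\<in>\<Omega>. q w * kapp m (comp_part m R (cen w)) x i) =
      (\<Sum>w\<in>\<Omega>. q w * kapp m (cen w) x i) - (\<Sum>w\<in>\<Omega>. q w * kapp m R (kapp m (cen w) (kapp m R x)) i)"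
    unfolding kapp_comp_part by (simp add: right_diff_distrib sum_subtractf)
  also have "(\<Sum>w\<in>\<Omega>. q w * kapp m R (kapp m (cen w) (kapp m R x)) i) =
      (\<Sum>l<m. R i l * (\<Sum>w\<in>\<Omega>. q w * kapp m (cen w) (kapp m R x) l))"
    unfolding kapp_def[of m R "kapp m (cen _) (kapp m R x)"] sum_distrib_left
    by (subst sum.swap) (intro sum.cong refl, simp only: mult_ac)
  also have "\<dots> = 0" by (intro sum.neutral) (simp add: mean_kapp_cen)
  finally show ?thesis using mean_kapp_cen[OF assms] by simp
qed

lemma second_moment_obs:
  "(\<Sum>w\<in>\<Omega>. q w * nsq m (kapp m (obs w) x)) = (real m + 1) / (2 * (real m)\<^sup>2) * nsq m x"
proof -
  let ?d = "\<lambda>i j. if i = j then 1 else (0::real)"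
  have "nsq m (kapp m (obs (u, v, y)) x) =
      ((x v)\<^sup>2 + (x u)\<^sup>2) / 4 + x u * x v * ?d u v / 2"
    if "u < m" "v < m" "y\<^sup>2 = 1" for u v y
  proof -
    have "nsq m (kapp m (obs (u, v, y)) x) =
        (\<Sum>i<m. y\<^sup>2 / 4 * (?d i u * (x v)\<^sup>2 + ?d i v * (x u)\<^sup>2 + ?d i u * (2 * ?d u v * x u * x v)))"
      unfolding ip_def kapp_obs[OF that(1,2)]
      by (intro sum.cong refl) (auto simp: power2_eq_square algebra_simps)
    also have "\<dots> = y\<^sup>2 / 4 * ((\<Sum>i<m. ?d i u * (x v)\<^sup>2) + (\<Sum>i<m. ?d i v * (x u)\<^sup>2) + (\<Sum>i<m. ?d i u * (2 * ?d u v * x u * x v)))"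
      by (simp only: sum_distrib_left[symmetric] sum.distrib)
    also have "\<dots> = y\<^sup>2 / 4 * ((x v)\<^sup>2 + (x u)\<^sup>2 + 2 * ?d u v * x u * x v)"
      using that by (simp only: sum_mult_delta finite_lessThan lessThan_iff)
    finally show ?thesis unfolding that(3) by (simp add: field_simps)
  qed
  then have "(\<Sum>w\<in>\<Omega>. q w * nsq m (kapp m (obs w) x)) =
      1 / (real m)\<^sup>2 * (\<Sum>u<m. \<Sum>v<m. ((x v)\<^sup>2 + (x u)\<^sup>2) / 4 + x u * x v * ?d u v / 2)"
    by (rule expectation_sign_free)
  also have "(\<Sum>u<m. \<Sum>v<m. ((x v)\<^sup>2 + (x u)\<^sup>2) / 4 + x u * x v * ?d u v / 2) =
      (\<Sum>u<m. \<Sum>v<m. (x v)\<^sup>2) / 4 + (\<Sum>u<m. \<Sum>v<m. (x u)\<^sup>2) / 4 + (\<Sum>u<m. \<Sum>v<m. x u * x v * ?d u v) / 2"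
    by (simp only: sum.distrib sum_divide_distrib add_divide_distrib)
  also have "(\<Sum>u<m. \<Sum>v<m. x u * x v * ?d u v) = nsq m x"
    unfolding ip_def by (intro sum.cong refl sum_mult_delta(2)) auto
  also have "(\<Sum>u<m. \<Sum>v<m. (x v)\<^sup>2) = real m * nsq m x"
    by (simp add: ip_def power2_eq_square)
  also have "(\<Sum>u<m. \<Sum>v<m. (x u)\<^sup>2) = real m * nsq m x"
    by (simp add: ip_def power2_eq_square sum_distrib_left)
  finally show ?thesis using m2 by (simp add: field_simps)
qed

text \<open>Coordinate by coordinate, a variance is at most a second moment.\<close>

lemma second_moment_cen_le:
  "(\<Sum>w\<in>\<Omega>. q w * nsq m (kapp m (cen w) x)) \<le>
   (\<Sum>w\<in>\<Omega>. q w * nsq m (kapp m (obs w) x))"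
proof -
  define b where "b = kapp m (\<lambda>i j. 1 / (real m)\<^sup>2 * S0 i j) x"
  have k: "kapp m (cen w) x i = kapp m (obs w) x i - b i" for w i
    unfolding b_def kapp_diff_kernel[symmetric] cen_def[abs_def] ..
  have "(\<Sum>w\<in>\<Omega>. q w * nsq m (kapp m (cen w) x)) =
      (\<Sum>i<m. \<Sum>w\<in>\<Omega>. q w * (kapp m (obs w) x i - b i)\<^sup>2)"
    unfolding ip_def sum_distrib_left k power2_eq_square by (rule sum.swap)
  also have "\<dots> \<le> (\<Sum>i<m. \<Sum>w\<in>\<Omega>. q w * (kapp m (obs w) x i)\<^sup>2)"
  proof (rule sum_mono)
    fix i assume "i \<in> {..<m}"
    then show "(\<Sum>w\<in>\<Omega>. q w * (kapp m (obs w) x i - b i)\<^sup>2) \<le> (\<Sum>w\<in>\<Omega>. q w * (kapp m (obs w) x i)\<^sup>2)"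
      using centred_second_moment[OF q_total, of "\<lambda>w. kapp m (obs w) x i" "b i"] mean_kapp_cen[of i x]
      by (simp add: k)
  qed
  also have "\<dots> = (\<Sum>w\<in>\<Omega>. q w * nsq m (kapp m (obs w) x))"
    unfolding ip_def sum_distrib_left power2_eq_square by (rule sum.swap)
  finally show ?thesis .
qed

text \<open>The observation itself contributes 1, as \<open>\<bar>x u * x v\<bar>\<close> is at most
  \<open>nsq m x\<close>. Its mean \<open>S0 / m^2\<close> contributes \<open>1 / m\<close>, which
  is at most 1/2.\<close>

lemma quadratic_cen_bounded:
  assumes "w \<in> \<Omega>"
  shows "\<bar>ip m x (kapp m (cen w) x)\<bar> \<le> 3/2 * nsq m x"
proof -
  obtain u v y where w: "w = (u, v, y)" "u < m" "v < m" "y = -1 \<or> y = 1"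
    using assms by (auto simp: \<Omega>_def)
  have sq: "(x i)\<^sup>2 \<le> nsq m x" if "i < m" for i
    unfolding ip_def power2_eq_square using that by (intro member_le_sum) auto
  have "ip m x (kapp m (obs w) x) = y / 2 * ((\<Sum>i<m. (if i = u then 1 else 0) * (x i * x v)) + (\<Sum>i<m. (if i = v then 1 else 0) * (x i * x u)))"
    unfolding w(1) ip_def kapp_obs[OF w(2,3)] sum.distrib[symmetric] sum_distrib_left
    by (intro sum.cong refl) (simp add: algebra_simps)
  also have "\<dots> = y / 2 * (x u * x v + x v * x u)"
    using w(2,3) by (simp only: sum_mult_delta finite_lessThan lessThan_iff)
  also have "\<dots> = y * (x u * x v)" by simp
  finally have "\<bar>ip m x (kapp m (obs w) x)\<bar> = \<bar>x u * x v\<bar>" using w(4) by (auto simp: abs_mult)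
  moreover have "2 * \<bar>x u * x v\<bar> \<le> (x u)\<^sup>2 + (x v)\<^sup>2"
    using zero_le_power2[of "\<bar>x u\<bar> - \<bar>x v\<bar>"] by (simp add: power2_diff abs_mult)
  ultimately have 1: "\<bar>ip m x (kapp m (obs w) x)\<bar> \<le> nsq m x" using sq[OF w(2)] sq[OF w(3)] by linarith
  have "\<bar>ip m x (kapp m (\<lambda>i j. 1 / (real m)\<^sup>2 * S0 i j) x)\<bar> \<le> (\<Sum>i<m. \<Sum>j<m. 1 / (real m)\<^sup>2 * (\<bar>x i\<bar> * \<bar>x j\<bar>))"
    unfolding ip_def kapp_def sum_distrib_left
  proof (intro order_trans[OF sum_abs] sum_mono)
    fix i j assume ij: "i \<in> {..<m}" "j \<in> {..<m}"
    have "\<bar>x i * (1 / (real m)\<^sup>2 * S0 i j * x j)\<bar> = 1 / (real m)\<^sup>2 * (\<bar>x i\<bar> * \<bar>x j\<bar>) * \<bar>S0 i j\<bar>"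
      by (simp add: abs_mult)
    also have "\<dots> \<le> 1 / (real m)\<^sup>2 * (\<bar>x i\<bar> * \<bar>x j\<bar>) * 1"
      using S0_bounded ij by (intro mult_left_mono) auto
    finally show "\<bar>x i * (1 / (real m)\<^sup>2 * S0 i j * x j)\<bar> \<le> 1 / (real m)\<^sup>2 * (\<bar>x i\<bar> * \<bar>x j\<bar>)" by simp
  qed
  also have "\<dots> = 1 / (real m)\<^sup>2 * (\<Sum>i<m. \<bar>x i\<bar>)\<^sup>2"
    unfolding power2_eq_square[of "\<Sum>i<m. \<bar>x i\<bar>"] sum_product by (simp only: sum_distrib_left)
  also have "\<dots> \<le> 1 / (real m)\<^sup>2 * (real m * nsq m x)"
  proof (intro mult_left_mono)
    show "(\<Sum>i<m. \<bar>x i\<bar>)\<^sup>2 \<le> real m * nsq m x"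
      using Cauchy_Schwarz_ineq_sum[of "\<lambda>_. 1" "\<lambda>i. \<bar>x i\<bar>" "{..<m}"]
      by (simp add: ip_def power2_eq_square)
  qed simp
  also have "\<dots> = nsq m x / real m" by (simp add: power2_eq_square)
  also have "\<dots> \<le> nsq m x / 2" using m2 ip_self_nonneg[of m x] by (intro divide_left_mono) auto
  finally have 2: "\<bar>ip m x (kapp m (\<lambda>i j. 1 / (real m)\<^sup>2 * S0 i j) x)\<bar> \<le> nsq m x / 2" .
  have "kapp m (cen w) x = (\<lambda>i. kapp m (obs w) x i - kapp m (\<lambda>i j. 1 / (real m)\<^sup>2 * S0 i j) x i)"
    unfolding kapp_diff_kernel[symmetric] cen_def[abs_def] ..
  then have "ip m x (kapp m (cen w) x) = ip m x (kapp m (obs w) x) - ip m x (kapp m (\<lambda>i j. 1 / (real m)\<^sup>2 * S0 i j) x)"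
    by (simp add: ip_diff_right)
  then show ?thesis using 1 2 by linarith
qed

lemma noise_quadratic_tail:
  assumes "0 < T" "real m * T \<le> real n" "1 \<le> n"
  shows "(\<Sum>z | z \<in> PiE {1..n} (\<lambda>_. \<Omega>) \<and>
      (\<exists>x. 2 * sqrt (T / (real n * real m)) * nsq m x < \<bar>ip m x (kapp m (noise n z) x)\<bar>). \<Prod>j=1..n. q (z j))
    \<le> 2 * real m * exp (- (5/4 * T))"
proof -
  define x0 where "x0 = 2 * sqrt (T / (real n * real m))"
  \<comment> \<open>The Laplace parameter. It turns the level into \<open>2 * T\<close> and the
    variance cost into \<open>3/4 * T\<close>, whence the exponent \<open>5/4 * T\<close>. The
    hypothesis \<open>m T \<le> n\<close> gives \<open>\<theta> \<le> 1\<close>, so the scaled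
    summands still obey the bound 3/2.\<close>
  define \<theta> where "\<theta> = sqrt (real m * T / real n)"
  have mn: "0 < real m" "0 < real n" using m2 assms by auto
  have \<theta>: "0 < \<theta>" "\<theta> \<le> 1" "\<theta>\<^sup>2 = real m * T / real n"
    using assms mn by (auto simp: \<theta>_def)
  have \<theta>x: "real n * \<theta> * x0 = 2 * T"
  proof -
    have "\<theta> * sqrt (T / (real n * real m)) = sqrt ((T / real n)\<^sup>2)"
      unfolding \<theta>_def real_sqrt_mult[symmetric] using mn by (simp add: power2_eq_square)
    also have "\<dots> = T / real n" using assms by simp
    finally show ?thesis using mn by (simp add: x0_def)
  qed
  \<comment> \<open>Uses \<open>(m + 1) / (2 * m^2) \<le> 3 / (4 * m)\<close>, which is where
    \<open>m \<ge> 2\<close> enters.\<close>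
  define v where "v = \<theta>\<^sup>2 * (3 / (4 * real m))"
  have nv: "real n * v = 3/4 * T" unfolding v_def \<theta>(3) using mn by simp
  let ?Pi = "PiE {1..n} (\<lambda>_. \<Omega>)"
  define B where "B \<sigma> = {z \<in> ?Pi. \<exists>x. x0 * nsq m x < \<sigma> * ip m x (kapp m (noise n z) x)}" for \<sigma> :: real
  have tail: "(\<Sum>z\<in>B \<sigma>. \<Prod>j=1..n. q (z j)) \<le> real m * exp (real n * v - 2 * T)" if "\<sigma> = 1 \<or> \<sigma> = -1" for \<sigma>
  proof (rule matrix_tail[where \<zeta> = "\<lambda>w i j. (\<sigma> * \<theta>) * cen w i j"])
    have k: "kapp m (\<lambda>i j. (\<sigma> * \<theta>) * cen w i j) x = (\<lambda>i. (\<sigma> * \<theta>) * kapp m (cen w) x i)" for w x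
      by (rule ext) (rule kapp_scale_kernel)
    have s2: "(\<sigma> * \<theta>)\<^sup>2 = \<theta>\<^sup>2" "\<bar>\<sigma> * \<theta>\<bar> = \<theta>" using that \<theta>(1) by (auto simp: abs_mult)
    show "ksym m (\<lambda>i j. (\<sigma> * \<theta>) * cen w i j)" for w using ksym_cen[of w] by (simp add: ksym_def)
    show "\<bar>ip m x (kapp m (\<lambda>i j. (\<sigma> * \<theta>) * cen w i j) x)\<bar> \<le> 3/2 * nsq m x" if "w \<in> \<Omega>" for w x
    proof -
      have "\<bar>ip m x (kapp m (\<lambda>i j. (\<sigma> * \<theta>) * cen w i j) x)\<bar> = \<theta> * \<bar>ip m x (kapp m (cen w) x)\<bar>"
        unfolding k ip_scale_right abs_mult[of "\<sigma> * \<theta>"] s2 ..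
      also have "\<dots> \<le> 1 * (3/2 * nsq m x)"
        using \<theta> quadratic_cen_bounded[OF that, of x] by (intro mult_mono) auto
      finally show ?thesis by simp
    qed
    have "(\<Sum>w\<in>\<Omega>. q w * ip m x (kapp m (\<lambda>i j. (\<sigma> * \<theta>) * cen w i j) x)) =
        (\<sigma> * \<theta>) * (\<Sum>w\<in>\<Omega>. q w * ip m x (kapp m (cen w) x))" for x
      unfolding k ip_scale_right by (simp only: sum_distrib_left mult.left_commute)
    then show "(\<Sum>w\<in>\<Omega>. q w * ip m x (kapp m (\<lambda>i j. (\<sigma> * \<theta>) * cen w i j) x)) = 0" for x
      by (simp add: mean_quadratic_cen)
    show "(\<Sum>w\<in>\<Omega>. q w * nsq m (kapp m (\<lambda>i j. (\<sigma> * \<theta>) * cen w i j) x))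
        \<le> v * nsq m x" for x
    proof -
      have "(\<Sum>w\<in>\<Omega>. q w * nsq m (kapp m (\<lambda>i j. (\<sigma> * \<theta>) * cen w i j) x)) =
          (\<sigma> * \<theta>)\<^sup>2 * (\<Sum>w\<in>\<Omega>. q w * nsq m (kapp m (cen w) x))"
        unfolding k ip_scale_right ip_scale_left power2_eq_square sum_distrib_left
        by (simp only: mult_ac)
      also have "\<dots> \<le> \<theta>\<^sup>2 * ((real m + 1) / (2 * (real m)\<^sup>2) * nsq m x)"
        using second_moment_cen_le[of x] unfolding second_moment_obs s2(1) by (intro mult_left_mono) auto
      also have "\<dots> \<le> \<theta>\<^sup>2 * (3 / (4 * real m) * nsq m x)"
        using m2 by (intro mult_left_mono mult_right_mono ip_self_nonneg) (auto simp: field_simps power2_eq_square)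
      finally show ?thesis by (simp add: v_def)
    qed
    fix z assume "z \<in> B \<sigma>"
    then obtain x where x: "x0 * nsq m x < \<sigma> * ip m x (kapp m (noise n z) x)" by (auto simp: B_def)
    have "kapp m (\<lambda>i k. \<Sum>j=1..n. (\<sigma> * \<theta>) * cen (z j) i k) x =
        (\<lambda>i. real n * \<theta> * \<sigma> * kapp m (noise n z) x i)"
    proof -
      have "(\<lambda>i k. \<Sum>j=1..n. (\<sigma> * \<theta>) * cen (z j) i k) = (\<lambda>i k. (real n * \<theta> * \<sigma>) * noise n z i k)"
        using mn by (simp add: fun_eq_iff noise_def sum_distrib_left mult_ac)
      then show ?thesis by (simp only: kapp_scale_kernel[abs_def])
    qed
    then have "ip m x (kapp m (\<lambda>i k. \<Sum>j=1..n. (\<sigma> * \<theta>) * cen (z j) i k) x) =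
        real n * \<theta> * (\<sigma> * ip m x (kapp m (noise n z) x))"
      by (simp only: ip_scale_right mult.assoc)
    moreover have "real n * \<theta> * (x0 * nsq m x) < real n * \<theta> * (\<sigma> * ip m x (kapp m (noise n z) x))"
      using x mn \<theta> by (intro mult_strict_left_mono) auto
    moreover have "real n * \<theta> * (x0 * nsq m x) = 2 * T * nsq m x"
      unfolding \<theta>x[symmetric] by (simp only: mult.assoc)
    ultimately show "\<exists>x. 2 * T * nsq m x < ip m x (kapp m (\<lambda>i k. \<Sum>j=1..n. (\<sigma> * \<theta>) * cen (z j) i k) x)"
      by (intro exI[of _ x]) simp
  qed (use finite_\<Omega> q_nonneg q_total in \<open>auto simp: B_def v_def\<close>)
  have "{z. z \<in> ?Pi \<and> (\<exists>x. x0 * nsq m x < \<bar>ip m x (kapp m (noise n z) x)\<bar>)} \<subseteq> B 1 \<union> B (-1)"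
    by (auto simp: B_def abs_if split: if_splits)
  moreover have fB: "finite (B \<sigma>)" for \<sigma> unfolding B_def using finite_\<Omega> by (auto intro!: finite_PiE)
  ultimately have "(\<Sum>z | z \<in> ?Pi \<and> (\<exists>x. x0 * nsq m x < \<bar>ip m x (kapp m (noise n z) x)\<bar>). \<Prod>j=1..n. q (z j))
      \<le> (\<Sum>z\<in>B 1 \<union> B (-1). \<Prod>j=1..n. q (z j))"
    by (intro sum_mono2 prod_nonneg) (auto simp: q_nonneg)
  also have "\<dots> \<le> (\<Sum>z\<in>B 1. \<Prod>j=1..n. q (z j)) + (\<Sum>z\<in>B (-1). \<Prod>j=1..n. q (z j))"
    using sum.union_inter[OF fB fB, of "\<lambda>z. \<Prod>j=1..n. q (z j)" 1 "-1"]
      sum_nonneg[of "B 1 \<inter> B (-1)" "\<lambda>z. \<Prod>j=1..n. q (z j)"]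
    by (simp add: prod_nonneg q_nonneg)
  also have "\<dots> \<le> real m * exp (real n * v - 2 * T) + real m * exp (real n * v - 2 * T)"
    by (intro add_mono tail) auto
  also have "\<dots> = 2 * real m * exp (- (5/4 * T))" by (simp add: nv)
  finally show ?thesis by (simp only: x0_def)
qed

end

section \<open>The weighted Hilbert-Schmidt norm of the noise\<close>

context sampling_model
begin

context
  fixes \<psi> :: "nat \<Rightarrow> nat \<Rightarrow> real" and \<mu> :: "nat \<Rightarrow> real"
    and J :: "nat set" and \<phi> :: "nat \<Rightarrow> nat \<Rightarrow> real" and a :: "nat \<Rightarrow> real"
begin

definition P where "P = spec {..<m} (\<lambda>k. if \<mu> k = 0 then 0 else 1) \<psi>"
definition R where "R = spec {..<m} (\<lambda>k. if \<mu> k = 0 then 1 else 0) \<psi>"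

text \<open>The squared norm dual to the weights \<open>a\<close>, as it appears in
  \<open>kip_weighted_AM_GM\<close>.\<close>

definition wnorm :: "(nat \<Rightarrow> nat \<Rightarrow> real) \<Rightarrow> real" where
  "wnorm K = (\<Sum>k\<in>J. 1 / a k * nsq m (kapp m (comp_part m R K) (\<phi> k)))"

context
  assumes o: "orthonormal_on m {..<m} \<psi>"
    and J: "finite J" "card J = m" "orthonormal_on m J \<phi>"
    and a1: "\<And>k. k \<in> J \<Longrightarrow> 1 \<le> a k"
begin

lemma wnorm_le:
  "wnorm K \<le> (\<Sum>k\<in>J. 1 / a k * (nsq m (kapp m P (kapp m K (\<phi> k))) +
     nsq m (kapp m K (kapp m P (\<phi> k)))))"
  unfolding wnorm_def
proof (rule sum_mono)
  fix k assume "k \<in> J"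
  then have "0 \<le> 1 / a k" using a1[of k] by simp
  then show "1 / a k * nsq m (kapp m (comp_part m R K) (\<phi> k)) \<le>
      1 / a k * (nsq m (kapp m P (kapp m K (\<phi> k))) + nsq m (kapp m K (kapp m P (\<phi> k))))"
    unfolding P_def R_def using comp_part_norm[OF o] by (rule mult_left_mono[rotated])
qed

lemma P_sym: "P i j = P j i"
  by (simp add: P_def spec_sym)

lemma kapp_P_obs:
  assumes "u < m" "v < m"
  shows "kapp m P (kapp m (obs (u, v, y)) x) i = y / 2 * (P i u * x v + P i v * x u)"
proof -
  have "kapp m P (kapp m (obs (u, v, y)) x) i =
      y / 2 * ((\<Sum>l<m. (P i l * x v) * (if l = u then 1 else 0)) + (\<Sum>l<m. (P i l * x u) * (if l = v then 1 else 0)))"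
    unfolding kapp_def[of m P] kapp_obs[OF assms] sum_distrib_left sum.distrib[symmetric]
    by (intro sum.cong refl) (simp add: algebra_simps)
  then show ?thesis using assms by (simp only: sum_mult_delta finite_lessThan lessThan_iff)
qed

lemma half_square_le:
  fixes y b c :: real
  assumes "y\<^sup>2 = 1" shows "(y / 2 * (b + c))\<^sup>2 \<le> (b\<^sup>2 + c\<^sup>2) / 2"
proof -
  have "(y / 2 * (b + c))\<^sup>2 = (b + c)\<^sup>2 / 4" using assms by (simp add: power_mult_distrib power_divide)
  moreover have "(b + c)\<^sup>2 + (b - c)\<^sup>2 = 2 * (b\<^sup>2 + c\<^sup>2)" by (simp add: power2_eq_square algebra_simps)
  ultimately show ?thesis using zero_le_power2[of "b - c"] by linarith
qed

text \<open>The product has at most two nonzero columns, multiples of the columns \<open>u\<close>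
  and \<open>v\<close> of \<open>P\<close>. They overlap when \<open>u = v\<close>, and
  \<open>half_square_le\<close> covers both cases.\<close>

lemma frobenius_P_obs:
  assumes U: "\<And>u. u < m \<Longrightarrow> (\<Sum>i<m. (P i u)\<^sup>2) \<le> U" and "u < m" "v < m" "y\<^sup>2 = 1"
  shows "kip m (kmult m P (obs (u, v, y))) (kmult m P (obs (u, v, y))) \<le> U"
proof -
  let ?d = "\<lambda>i j. if i = j then 1 else (0::real)"
  have k: "kmult m P (obs (u, v, y)) i j = y / 2 * (P i u * ?d j v + P i v * ?d j u)" for i j
  proof -
    have "kmult m P (obs (u, v, y)) i j =
        y / 2 * ((\<Sum>l<m. (P i l * ?d j v) * ?d l u) + (\<Sum>l<m. (P i l * ?d j u) * ?d l v))"
      unfolding kmult_def obs_def prod.case sum_distrib_left sum.distrib[symmetric]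
      by (intro sum.cong refl) (simp add: algebra_simps)
    then show ?thesis using assms by (simp only: sum_mult_delta finite_lessThan lessThan_iff)
  qed
  have "kip m (kmult m P (obs (u, v, y))) (kmult m P (obs (u, v, y))) \<le>
      (\<Sum>i<m. \<Sum>j<m. ((P i u * ?d j v)\<^sup>2 + (P i v * ?d j u)\<^sup>2) / 2)"
    unfolding kip_def k using half_square_le[OF assms(4)] by (intro sum_mono) (simp add: power2_eq_square)
  also have "\<dots> = (\<Sum>i<m. ((\<Sum>j<m. (P i u)\<^sup>2 * ?d j v) + (\<Sum>j<m. (P i v)\<^sup>2 * ?d j u)) / 2)"
    unfolding sum.distrib[symmetric] sum_divide_distrib by (intro sum.cong refl) auto
  also have "\<dots> = (\<Sum>i<m. ((P i u)\<^sup>2 + (P i v)\<^sup>2) / 2)"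
    using assms by (simp only: sum_mult_delta finite_lessThan lessThan_iff)
  also have "\<dots> = ((\<Sum>i<m. (P i u)\<^sup>2) + (\<Sum>i<m. (P i v)\<^sup>2)) / 2"
    by (simp only: sum.distrib sum_divide_distrib add_divide_distrib)
  also have "\<dots> \<le> U" using U[OF assms(2)] U[OF assms(3)] by simp
  finally show ?thesis .
qed

text \<open>The weights are at most 1, so the sum is bounded by the squared Frobenius norms of
  \<open>P obs\<close> and \<open>obs P\<close>, which are transposes of each other.\<close>

lemma wnorm_obs_le:
  assumes U: "\<And>u. u < m \<Longrightarrow> (\<Sum>i<m. (P i u)\<^sup>2) \<le> U" and "w \<in> \<Omega>"
  shows "wnorm (obs w) \<le> 2 * U"
proof -
  obtain u v y where w: "w = (u, v, y)" "u < m" "v < m" "y\<^sup>2 = 1"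
    using assms(2) by (auto simp: \<Omega>_def)
  let ?A = "kmult m P (obs w)" and ?B = "kmult m (obs w) P"
  have "wnorm (obs w) \<le> (\<Sum>k\<in>J. 1 * (nsq m (kapp m ?A (\<phi> k)) + nsq m (kapp m ?B (\<phi> k))))"
    unfolding kapp_kmult
  proof (rule order_trans[OF wnorm_le sum_mono])
    fix k assume "k \<in> J"
    then have "1 / a k \<le> 1" using a1[of k] by (simp add: divide_le_eq_1)
    then show "1 / a k * (nsq m (kapp m P (kapp m (obs w) (\<phi> k))) +
        nsq m (kapp m (obs w) (kapp m P (\<phi> k)))) \<le>
      1 * (nsq m (kapp m P (kapp m (obs w) (\<phi> k))) +
        nsq m (kapp m (obs w) (kapp m P (\<phi> k))))"
      by (intro mult_right_mono add_nonneg_nonneg ip_self_nonneg)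
  qed
  also have "\<dots> = kip m ?A ?A + kip m ?B ?B"
    by (simp only: mult_1 sum.distrib kip_basis[OF J])
  also have "kip m ?B ?B = kip m ?A ?A"
  proof -
    have "(\<lambda>i j. obs w j i) = obs w" by (simp add: w(1) obs_def fun_eq_iff algebra_simps)
    moreover have "(\<lambda>i j. P j i) = P" using P_sym by (simp add: fun_eq_iff)
    ultimately have B: "?B = (\<lambda>i j. ?A j i)" by (simp add: kmult_transpose)
    show ?thesis unfolding B by (rule kip_transpose)
  qed
  finally show ?thesis using frobenius_P_obs[OF U w(2-4)] w(1) by simp
qed

text \<open>On average \<open>P obs\<close> contributes at most \<open>kip m P P / m^2\<close> at
  every basis vector, and \<open>obs P\<close> contributes at most
  \<open>nsq m (P \<phi>) / m\<close>. Keeping the weights leaves exactly the two sums treated in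
  \<open>coherence_weighted_sums\<close>.\<close>

lemma mean_wnorm_obs_le:
  "(\<Sum>w\<in>\<Omega>. q w * wnorm (obs w)) \<le>
   (\<Sum>k\<in>J. 1 / a k * (nsq m (kapp m P (\<phi> k)) + kip m P P / real m)) / real m"
proof -
  let ?x = "\<lambda>k. kapp m P (\<phi> k)"
  have 1: "(\<Sum>w\<in>\<Omega>. q w * nsq m (kapp m P (kapp m (obs w) x))) \<le>
      kip m P P / (real m)\<^sup>2 * nsq m x" for x
  proof -
    define h where "h u v = (\<Sum>i<m. ((P i u)\<^sup>2 * (x v)\<^sup>2 + (P i v)\<^sup>2 * (x u)\<^sup>2) / 2)" for u v
    have "(\<Sum>w\<in>\<Omega>. q w * nsq m (kapp m P (kapp m (obs w) x))) \<le>
        (\<Sum>w\<in>\<Omega>. q w * h (fst w) (fst (snd w)))"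
    proof (intro sum_mono mult_left_mono q_nonneg)
      fix w assume "w \<in> \<Omega>"
      then obtain u v y where w: "w = (u, v, y)" "u < m" "v < m" "y\<^sup>2 = 1" by (auto simp: \<Omega>_def)
      show "nsq m (kapp m P (kapp m (obs w) x)) \<le> h (fst w) (fst (snd w))"
        unfolding w(1) ip_def kapp_P_obs[OF w(2,3)] h_def power2_eq_square[symmetric] fst_conv snd_conv
        using half_square_le[OF w(4)] by (intro sum_mono) (metis power_mult_distrib)
    qed
    also have "\<dots> = 1 / (real m)\<^sup>2 * (\<Sum>u<m. \<Sum>v<m. h u v)"
      by (rule expectation_sign_free) simp
    also have "(\<Sum>u<m. \<Sum>v<m. h u v) = kip m P P * nsq m x"
    proof -
      have "(\<Sum>u<m. \<Sum>v<m. \<Sum>i<m. (P i u)\<^sup>2 * (x v)\<^sup>2) = (\<Sum>u<m. \<Sum>i<m. \<Sum>v<m. (P i u)\<^sup>2 * (x v)\<^sup>2)"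
        by (intro sum.cong refl sum.swap)
      also have "\<dots> = (\<Sum>i<m. \<Sum>u<m. \<Sum>v<m. (P i u)\<^sup>2 * (x v)\<^sup>2)" by (rule sum.swap)
      also have "\<dots> = kip m P P * nsq m x"
        by (simp only: kip_def ip_def power2_eq_square[symmetric] sum_distrib_left[symmetric] sum_distrib_right[symmetric])
      finally have e1: "(\<Sum>u<m. \<Sum>v<m. \<Sum>i<m. (P i u)\<^sup>2 * (x v)\<^sup>2) = kip m P P * nsq m x" .
      have e2: "(\<Sum>u<m. \<Sum>v<m. \<Sum>i<m. (P i v)\<^sup>2 * (x u)\<^sup>2) = kip m P P * nsq m x"
        unfolding e1[symmetric] by (rule sum.swap)
      have "(\<Sum>u<m. \<Sum>v<m. h u v) = ((\<Sum>u<m. \<Sum>v<m. \<Sum>i<m. (P i u)\<^sup>2 * (x v)\<^sup>2) + (\<Sum>u<m. \<Sum>v<m. \<Sum>i<m. (P i v)\<^sup>2 * (x u)\<^sup>2)) / 2"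
        unfolding h_def by (simp only: sum.distrib sum_divide_distrib add_divide_distrib)
      then show ?thesis unfolding e1 e2 by simp
    qed
    finally show ?thesis by simp
  qed
  have 2: "(\<Sum>w\<in>\<Omega>. q w * nsq m (kapp m (obs w) x)) \<le> nsq m x / real m" for x
  proof -
    have "(real m + 1) / (2 * (real m)\<^sup>2) \<le> 1 / real m" using m2 by (simp add: field_simps power2_eq_square)
    then show ?thesis unfolding second_moment_obs using mult_right_mono[OF _ ip_self_nonneg[of m x]] by fastforce
  qed
  have "(\<Sum>w\<in>\<Omega>. q w * wnorm (obs w)) \<le> (\<Sum>w\<in>\<Omega>. q w * (\<Sum>k\<in>J. 1 / a k *
      (nsq m (kapp m P (kapp m (obs w) (\<phi> k))) + nsq m (kapp m (obs w) (?x k)))))"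
    by (intro sum_mono mult_left_mono q_nonneg wnorm_le)
  also have "\<dots> = (\<Sum>k\<in>J. 1 / a k * (\<Sum>w\<in>\<Omega>. q w *
      (nsq m (kapp m P (kapp m (obs w) (\<phi> k))) + nsq m (kapp m (obs w) (?x k)))))"
    unfolding sum_distrib_left by (subst sum.swap) (simp only: mult.left_commute)
  also have "\<dots> \<le> (\<Sum>k\<in>J. 1 / a k * ((nsq m (?x k) + kip m P P / real m) / real m))"
  proof (rule sum_mono)
    fix k assume "k \<in> J"
    have "0 \<le> 1 / a k" using a1[OF \<open>k \<in> J\<close>] by simp
    have n: "nsq m (\<phi> k) = 1" using J(3) \<open>k \<in> J\<close> by (simp add: orthonormal_on_def)
    have "(\<Sum>w\<in>\<Omega>. q w *
      (nsq m (kapp m P (kapp m (obs w) (\<phi> k))) + nsq m (kapp m (obs w) (?x k))))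
      = (\<Sum>w\<in>\<Omega>. q w * nsq m (kapp m P (kapp m (obs w) (\<phi> k)))) +
        (\<Sum>w\<in>\<Omega>. q w * nsq m (kapp m (obs w) (?x k)))"
      by (simp only: distrib_left sum.distrib)
    also have "\<dots> \<le> kip m P P / (real m)\<^sup>2 * 1 + nsq m (?x k) / real m"
      using 1[of "\<phi> k"] 2[of "?x k"] unfolding n by (rule add_mono)
    also have "\<dots> = (nsq m (?x k) + kip m P P / real m) / real m"
      by (simp add: power2_eq_square add_divide_distrib)
    finally show "1 / a k * (\<Sum>w\<in>\<Omega>. q w *
      (nsq m (kapp m P (kapp m (obs w) (\<phi> k))) + nsq m (kapp m (obs w) (?x k))))
      \<le> 1 / a k * ((nsq m (?x k) + kip m P P / real m) / real m)"
      using \<open>0 \<le> 1 / a k\<close> by (rule mult_left_mono)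
  qed
  finally show ?thesis by (simp only: sum_divide_distrib times_divide_eq_right)
qed

lemma comp_part_diff:
  "comp_part m R (\<lambda>i j. A i j - B i j) = (\<lambda>i j. comp_part m R A i j - comp_part m R B i j)"
  by (simp add: fun_eq_iff comp_part_def kmult_def left_diff_distrib right_diff_distrib sum_subtractf algebra_simps)

text \<open>Flattens the weighted operator into one vector with squared Euclidean length
  \<open>wnorm K\<close>, the form required by \<open>vector_tail\<close>.\<close>

definition coords :: "(nat \<Rightarrow> nat \<Rightarrow> real) \<Rightarrow> nat \<times> nat \<Rightarrow> real" where
  "coords K = (\<lambda>(k, i). sqrt (1 / a k) * kapp m (comp_part m R K) (\<phi> k) i)"

lemma sum_coords: "(\<Sum>l\<in>J \<times> {..<m}. (coords K l)\<^sup>2) = wnorm K"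
proof -
  have "(\<Sum>l\<in>J \<times> {..<m}. (coords K l)\<^sup>2) = (\<Sum>k\<in>J. \<Sum>i<m. (coords K (k, i))\<^sup>2)"
    by (simp add: sum.cartesian_product case_prod_unfold)
  also have "\<dots> = wnorm K"
    unfolding wnorm_def ip_def sum_distrib_left
  proof (intro sum.cong refl)
    fix k i assume "k \<in> J"
    have "(sqrt (1 / a k))\<^sup>2 = 1 / a k" using a1[OF \<open>k \<in> J\<close>] by simp
    then show "(coords K (k, i))\<^sup>2 = 1 / a k * (kapp m (comp_part m R K) (\<phi> k) i * kapp m (comp_part m R K) (\<phi> k) i)"
      by (simp only: coords_def prod.case power_mult_distrib) (simp only: power2_eq_square)
  qed
  finally show ?thesis .
qed

lemma mean_coords_cen:
  assumes "l \<in> J \<times> {..<m}"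
  shows "(\<Sum>w\<in>\<Omega>. q w * coords (cen w) l) = 0"
proof -
  obtain k i where l: "l = (k, i)" "i < m" using assms by auto
  have "(\<Sum>w\<in>\<Omega>. q w * coords (cen w) l) =
      sqrt (1 / a k) * (\<Sum>w\<in>\<Omega>. q w * kapp m (comp_part m R (cen w)) (\<phi> k) i)"
    by (simp only: l(1) coords_def prod.case sum_distrib_left mult.left_commute)
  then show ?thesis using mean_comp_cen[OF l(2)] by simp
qed

definition coords0 where "coords0 = coords (\<lambda>i j. 1 / (real m)\<^sup>2 * S0 i j)"

lemma coords_cen: "coords (cen w) l = coords (obs w) l - coords0 l"
proof -
  have "comp_part m R (cen w) =
      (\<lambda>i j. comp_part m R (obs w) i j - comp_part m R (\<lambda>i j. 1 / (real m)\<^sup>2 * S0 i j) i j)"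
    unfolding cen_def[abs_def] by (rule comp_part_diff)
  then show ?thesis
    by (simp only: coords0_def coords_def kapp_diff_kernel case_prod_unfold right_diff_distrib)
qed

lemma variance_coords:
  assumes "l \<in> J \<times> {..<m}"
  shows "(\<Sum>w\<in>\<Omega>. q w * (coords (cen w) l)\<^sup>2) = (\<Sum>w\<in>\<Omega>. q w * (coords (obs w) l)\<^sup>2) - (coords0 l)\<^sup>2"
  unfolding coords_cen
  by (rule centred_second_moment[OF q_total]) (use mean_coords_cen[OF assms] in \<open>simp only: coords_cen\<close>)

lemma sum_variance_coords:
  "(\<Sum>w\<in>\<Omega>. q w * wnorm (cen w)) = (\<Sum>w\<in>\<Omega>. q w * wnorm (obs w)) - (\<Sum>l\<in>J \<times> {..<m}. (coords0 l)\<^sup>2)"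
proof -
  have s: "(\<Sum>w\<in>\<Omega>. q w * wnorm (K w)) = (\<Sum>l\<in>J \<times> {..<m}. \<Sum>w\<in>\<Omega>. q w * (coords (K w) l)\<^sup>2)" for K
    unfolding sum_coords[symmetric] sum_distrib_left by (rule sum.swap)
  show ?thesis unfolding s sum_subtractf[symmetric] by (intro sum.cong refl variance_coords)
qed

lemma wnorm_nonneg: "0 \<le> wnorm K"
  unfolding sum_coords[symmetric] by (intro sum_nonneg) simp

text \<open>By \<open>(x - y)^2 \<le> 2 x^2 + 2 y^2\<close> the constant is
  \<open>2 * 2 + 2 * 2\<close>. The mean part \<open>coords0\<close> is bounded by the mean of
  \<open>wnorm (obs w)\<close> because a variance is nonnegative.\<close>

lemma wnorm_cen_le:
  assumes U: "\<And>u. u < m \<Longrightarrow> (\<Sum>i<m. (P i u)\<^sup>2) \<le> U" and "w \<in> \<Omega>"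
  shows "wnorm (cen w) \<le> 8 * U"
proof -
  have "0 \<le> (\<Sum>w\<in>\<Omega>. q w * wnorm (cen w))" by (intro sum_nonneg mult_nonneg_nonneg q_nonneg wnorm_nonneg)
  then have "(\<Sum>l\<in>J \<times> {..<m}. (coords0 l)\<^sup>2) \<le> (\<Sum>w\<in>\<Omega>. q w * wnorm (obs w))"
    unfolding sum_variance_coords by simp
  also have "\<dots> \<le> (\<Sum>w\<in>\<Omega>. q w * (2 * U))"
    by (intro sum_mono mult_left_mono q_nonneg wnorm_obs_le U)
  also have "\<dots> = 2 * U" by (simp only: sum_distrib_right[symmetric] q_total mult_1)
  finally have c0: "(\<Sum>l\<in>J \<times> {..<m}. (coords0 l)\<^sup>2) \<le> 2 * U" .
  have "wnorm (cen w) \<le> (\<Sum>l\<in>J \<times> {..<m}. 2 * (coords (obs w) l)\<^sup>2 + 2 * (coords0 l)\<^sup>2)"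
    unfolding sum_coords[symmetric] coords_cen
  proof (intro sum_mono)
    fix l
    have "0 \<le> (coords (obs w) l + coords0 l)\<^sup>2" by simp
    then show "(coords (obs w) l - coords0 l)\<^sup>2 \<le> 2 * (coords (obs w) l)\<^sup>2 + 2 * (coords0 l)\<^sup>2"
      by (simp add: power2_eq_square algebra_simps)
  qed
  also have "\<dots> = 2 * wnorm (obs w) + 2 * (\<Sum>l\<in>J \<times> {..<m}. (coords0 l)\<^sup>2)"
    by (simp only: sum.distrib sum_distrib_left[symmetric] sum_coords)
  finally show ?thesis using c0 wnorm_obs_le[OF U assms(2)] by simp
qed

lemma coords_scale: "coords (\<lambda>i j. c * K i j) l = c * coords K l"
proof -
  have "comp_part m R (\<lambda>i j. c * K i j) = (\<lambda>i j. c * comp_part m R K i j)"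
    by (simp add: fun_eq_iff comp_part_def kmult_def sum_distrib_left right_diff_distrib mult_ac)
  then show ?thesis by (simp only: coords_def kapp_scale_kernel case_prod_unfold mult.left_commute)
qed

lemma coords_sum: "coords (\<lambda>i j. \<Sum>x\<in>S. K x i j) l = (\<Sum>x\<in>S. coords (K x) l)"
proof -
  have "kapp m (comp_part m R (\<lambda>i j. \<Sum>x\<in>S. K x i j)) y i = (\<Sum>x\<in>S. kapp m (comp_part m R (K x)) y i)" for y i
    unfolding kapp_comp_part kapp_sum_kernel[abs_def] kapp_sum by (simp add: sum_subtractf)
  then show ?thesis by (simp add: coords_def case_prod_unfold sum_distrib_left)
qed

lemma noise_wnorm_tail:
  assumes U: "\<And>u. u < m \<Longrightarrow> (\<Sum>i<m. (P i u)\<^sup>2) \<le> U"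
    and var: "(\<Sum>k\<in>J. 1 / a k * (nsq m (kapp m P (\<phi> k)) + kip m P P / real m)) / real m \<le> \<sigma>"
    and "0 < T" "1 \<le> n"
  shows "(\<Sum>z | z \<in> PiE {1..n} (\<lambda>_. \<Omega>) \<and>
      4 * (real n * \<sigma> * T + 8 * U * T\<^sup>2) / (real n)\<^sup>2 < wnorm (noise n z). \<Prod>j=1..n. q (z j))
    \<le> 2 * exp (- T)"
proof -
  \<comment> \<open>The normalisation: \<open>8 * U \<le> d\<close> makes each scaled summand at
    most 1, and \<open>real n * \<sigma> / T \<le> d\<close> keeps the total variance at most
    \<open>T\<close>. At level \<open>2 * T\<close> the exponent is then
    \<open>T - 2 * T\<close>.\<close>
  define d where "d = real n * \<sigma> / T + 8 * U"
  let ?B = "{z. z \<in> PiE {1..n} (\<lambda>_. \<Omega>) \<and>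
      4 * (real n * \<sigma> * T + 8 * U * T\<^sup>2) / (real n)\<^sup>2 < wnorm (noise n z)}"
  let ?I = "J \<times> {..<m}"
  have n0: "0 < real n" using \<open>1 \<le> n\<close> by simp
  have v\<sigma>: "(\<Sum>w\<in>\<Omega>. q w * wnorm (cen w)) \<le> \<sigma>"
    using sum_variance_coords mean_wnorm_obs_le var sum_nonneg[of ?I "\<lambda>l. (coords0 l)\<^sup>2"] by simp
  have "0 \<le> (\<Sum>w\<in>\<Omega>. q w * wnorm (cen w))" by (intro sum_nonneg mult_nonneg_nonneg q_nonneg wnorm_nonneg)
  then have "\<sigma> \<ge> 0" using v\<sigma> by simp
  have "0 \<le> (\<Sum>i<m. (P i 0)\<^sup>2)" by (intro sum_nonneg) simp
  then have "U \<ge> 0" using U[of 0] m2 by simp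
  have thr: "4 * (real n * \<sigma> * T + 8 * U * T\<^sup>2) = 4 * T\<^sup>2 * d"
    using \<open>0 < T\<close> by (simp add: d_def power2_eq_square field_simps)
  have noise: "coords (noise n z) l = 1 / real n * (\<Sum>j=1..n. coords (cen (z j)) l)" for z l
    unfolding noise_def[abs_def] coords_scale coords_sum ..
  show ?thesis
  proof (cases "d = 0")
    \<comment> \<open>Now \<open>U = 0\<close>, every summand vanishes, and the strict inequality
      that defines the event reads \<open>0 < 0\<close>.\<close>
    case True
    then have "U = 0" "d = 0" using \<open>\<sigma> \<ge> 0\<close> \<open>U \<ge> 0\<close> \<open>0 < T\<close> n0 by (auto simp: d_def add_nonneg_eq_0_iff)
    have "wnorm (noise n z) = 0" if "z \<in> PiE {1..n} (\<lambda>_. \<Omega>)" for z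
    proof -
      have "coords (cen (z j)) l = 0" if "j \<in> {1..n}" "l \<in> ?I" for j l
      proof -
        have "z j \<in> \<Omega>" using \<open>z \<in> _\<close> that by (auto simp: PiE_iff)
        then have "wnorm (cen (z j)) = 0"
          using wnorm_cen_le[OF U] \<open>U = 0\<close> wnorm_nonneg[of "cen (z j)"] by fastforce
        then show ?thesis
          unfolding sum_coords[symmetric] using that(2) J(1) by (subst (asm) sum_nonneg_eq_0_iff) auto
      qed
      then show ?thesis unfolding sum_coords[symmetric] noise by (intro sum.neutral) auto
    qed
    then have "?B = {}" using thr True by auto
    then show ?thesis by (simp only: sum.empty) simp
  next
    case False
    have "0 \<le> d" using \<open>\<sigma> \<ge> 0\<close> \<open>U \<ge> 0\<close> \<open>0 < T\<close> by (simp add: d_def)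
    then have d: "0 < d" using False by simp
    define \<theta> where "\<theta> = 1 / sqrt d"
    have \<theta>: "0 < \<theta>" "\<theta>\<^sup>2 = 1 / d" using d by (auto simp: \<theta>_def power_divide)
    have L: "L2_set (\<lambda>l. c * coords K l) ?I = \<bar>c\<bar> * sqrt (wnorm K)" for c K
      by (simp add: L2_set_def power_mult_distrib sum_distrib_left[symmetric] sum_coords real_sqrt_mult)
    have "(\<Sum>z\<in>?B. \<Prod>j=1..n. q (z j)) \<le> 2 * exp (real n * (\<theta>\<^sup>2 * \<sigma>) - 2 * T)"
    proof (rule vector_tail[where g = "\<lambda>w l. \<theta> * coords (cen w) l" and I = ?I and \<Omega> = \<Omega>])
      show "L2_set (\<lambda>l. \<theta> * coords (cen w) l) ?I \<le> 1" if "w \<in> \<Omega>" for w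
      proof -
        have "wnorm (cen w) \<le> d"
          using wnorm_cen_le[OF U that] \<open>\<sigma> \<ge> 0\<close> \<open>0 < T\<close> by (simp add: d_def add_increasing)
        then have "sqrt (wnorm (cen w)) \<le> sqrt d" by simp
        then show ?thesis unfolding L using d \<theta>(1) by (simp add: \<theta>_def)
      qed
      show "(\<Sum>w\<in>\<Omega>. q w * (\<theta> * coords (cen w) l)) = 0" if "l \<in> ?I" for l
      proof -
        have "(\<Sum>w\<in>\<Omega>. q w * (\<theta> * coords (cen w) l)) = \<theta> * (\<Sum>w\<in>\<Omega>. q w * coords (cen w) l)"
          by (simp only: sum_distrib_left mult.left_commute)
        then show ?thesis using mean_coords_cen[OF that] by simp
      qed
      have "(\<Sum>w\<in>\<Omega>. q w * (L2_set (\<lambda>l. \<theta> * coords (cen w) l) ?I)\<^sup>2) = \<theta>\<^sup>2 * (\<Sum>w\<in>\<Omega>. q w * wnorm (cen w))"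
        unfolding L by (simp add: power_mult_distrib wnorm_nonneg sum_distrib_left mult_ac)
      also have "\<dots> \<le> \<theta>\<^sup>2 * \<sigma>" using v\<sigma> by (intro mult_left_mono) auto
      finally show "(\<Sum>w\<in>\<Omega>. q w * (L2_set (\<lambda>l. \<theta> * coords (cen w) l) ?I)\<^sup>2) \<le> \<theta>\<^sup>2 * \<sigma>" .
      fix z assume "z \<in> ?B"
      then have "4 * T\<^sup>2 * d / (real n)\<^sup>2 \<le> wnorm (noise n z)" unfolding thr by simp
      then have "sqrt (4 * T\<^sup>2 * d / (real n)\<^sup>2) \<le> sqrt (wnorm (noise n z))" by (rule real_sqrt_le_mono)
      moreover have "sqrt (4 * T\<^sup>2 * d / (real n)\<^sup>2) = 2 * T * sqrt d / real n"
        using \<open>0 < T\<close> by (simp add: real_sqrt_mult real_sqrt_divide)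
      ultimately have "(\<theta> * real n) * (2 * T * sqrt d / real n) \<le> (\<theta> * real n) * sqrt (wnorm (noise n z))"
        using \<theta>(1) by (intro mult_left_mono) auto
      moreover have "(\<theta> * real n) * (2 * T * sqrt d / real n) = 2 * T" using n0 d by (simp add: \<theta>_def)
      moreover have "(\<lambda>l. \<Sum>j=1..n. \<theta> * coords (cen (z j)) l) = (\<lambda>l. (\<theta> * real n) * coords (noise n z) l)"
        unfolding noise using n0 by (simp add: fun_eq_iff sum_distrib_left)
      ultimately show "2 * T \<le> L2_set (\<lambda>l. \<Sum>j=1..n. \<theta> * coords (cen (z j)) l) ?I"
        using \<theta>(1) by (simp only: L) simp
    qed (use finite_\<Omega> q_nonneg q_total \<open>0 < T\<close> in auto)
    also have "\<dots> \<le> 2 * exp (- T)"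
    proof -
      have "real n * (\<theta>\<^sup>2 * \<sigma>) = (real n * \<sigma>) / d" by (simp add: \<theta>(2))
      also have "\<dots> \<le> T"
      proof -
        have "real n * \<sigma> = T * (real n * \<sigma> / T)" using \<open>0 < T\<close> by simp
        also have "\<dots> \<le> T * d" using \<open>0 < T\<close> \<open>U \<ge> 0\<close> by (intro mult_left_mono) (auto simp: d_def)
        finally show ?thesis using d by (simp add: divide_le_eq)
      qed
      finally show ?thesis by simp
    qed
    finally show ?thesis .
  qed
qed

end

end

end

section \<open>Matrices, projections and the penalised risk\<close>

abbreviation ent :: "real mat \<Rightarrow> nat \<Rightarrow> nat \<Rightarrow> real" where
  "ent S \<equiv> (\<lambda>i j. S $$ (i, j))"

abbreviation vent :: "real Matrix.vec \<Rightarrow> nat \<Rightarrow> real" where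
  "vent v \<equiv> (\<lambda>i. vec_index v i)"

lemma ip_sum_left: "ip m (\<lambda>i. \<Sum>k\<in>I. c k * f k i) x = (\<Sum>k\<in>I. c k * ip m (f k) x)"
  unfolding ip_commute[of m _ x] by (rule ip_sum_right)

lemma proots_prod_linear: "proots (\<Prod>a\<leftarrow>xs. [:- a, 1:]) = mset (xs :: real list)"
proof (induction xs)
  case (Cons b xs)
  have "(\<Prod>a\<leftarrow>xs. [:- a, 1:]) \<noteq> 0" by (auto simp: prod_list_zero_iff)
  then have "proots ([:- b, 1:] * (\<Prod>a\<leftarrow>xs. [:- a, 1:])) = proots [:- b, 1:] + proots (\<Prod>a\<leftarrow>xs. [:- a, 1:])"
    by (intro proots_mult) auto
  moreover have "proots [:- b, 1:] = {#b#}" using proots_linear_factor[of "b"] by simp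
  ultimately show ?case using Cons.IH by simp
qed simp

text \<open>The eigenvectors form an orthogonal matrix that conjugates \<open>S\<close> to a
  diagonal one, and similar matrices have the same characteristic polynomial. This connects
  \<open>nuclear_norm\<close> with the spectral sums.\<close>

lemma nuclear_norm_spectral:
  assumes S: "S \<in> carrier_mat m m" and o: "orthonormal_on m {..<m} \<psi>"
    and e: "\<And>i j. i < m \<Longrightarrow> j < m \<Longrightarrow> S $$ (i, j) = spec {..<m} \<mu> \<psi> i j"
  shows "nuclear_norm S = (\<Sum>k<m. \<bar>\<mu> k\<bar>)"
proof -
  define U where "U = mat m m (\<lambda>(i, k). \<psi> k i)"
  define D where "D = mat m m (\<lambda>(i, k). if i = k then \<mu> i else 0)"
  have U: "U \<in> carrier_mat m m" "D \<in> carrier_mat m m" by (auto simp: U_def D_def)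
  have 1: "transpose_mat U * U = 1\<^sub>m m"
    using o by (intro eq_matI) (auto simp: U_def scalar_prod_def orthonormal_on_def ip_def lessThan_atLeast0)
  have 2: "U * transpose_mat U = 1\<^sub>m m"
    using completeness[OF _ _ o] by (intro eq_matI) (auto simp: U_def scalar_prod_def lessThan_atLeast0)
  have DU: "D * transpose_mat U = mat m m (\<lambda>(k, j). \<mu> k * \<psi> k j)"
  proof (intro eq_matI)
    fix k j assume "k < dim_row (mat m m (\<lambda>(k, j). \<mu> k * \<psi> k j))" "j < dim_col (mat m m (\<lambda>(k, j). \<mu> k * \<psi> k j))"
    then have kj: "k < m" "j < m" by auto
    have "(D * transpose_mat U) $$ (k, j) = (\<Sum>l<m. (if k = l then 1 else 0) * (\<mu> k * \<psi> l j))"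
      using kj by (auto simp: U_def D_def scalar_prod_def lessThan_atLeast0 intro!: sum.cong)
    also have "\<dots> = \<mu> k * \<psi> k j"
      using kj by (simp only: sum_mult_delta finite_lessThan lessThan_iff)
    finally show "(D * transpose_mat U) $$ (k, j) = mat m m (\<lambda>(k, j). \<mu> k * \<psi> k j) $$ (k, j)"
      using kj by simp
  qed (auto simp: D_def U_def)
  have "S = U * (D * transpose_mat U)"
    unfolding DU using S by (intro eq_matI) (auto simp: e spec_def U_def scalar_prod_def lessThan_atLeast0 intro!: sum.cong)
  then have "S = U * D * transpose_mat U" using U by (simp add: assoc_mult_mat[of U m m D m "transpose_mat U" m])
  then have "similar_mat_wit S D U (transpose_mat U)"
    using S U 1 2 by (simp add: similar_mat_wit_def Let_def)
  then have "char_poly S = char_poly D" by (intro char_poly_similar) (auto simp: similar_mat_def)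
  also have "\<dots> = (\<Prod>a\<leftarrow>diag_mat D. [:- a, 1:])"
    by (rule char_poly_upper_triangular[OF U(2)]) (auto simp: D_def upper_triangular_def)
  also have "diag_mat D = map \<mu> [0..<m]" by (auto simp: diag_mat_def D_def)
  finally have "proots (char_poly S) = mset (map \<mu> [0..<m])" by (simp only: proots_prod_linear)
  then have "nuclear_norm S = (\<Sum>x\<in>#mset (map \<mu> [0..<m]). \<bar>x\<bar>)" by (simp only: nuclear_norm_def)
  also have "\<dots> = sum_list (map (\<lambda>k. \<bar>\<mu> k\<bar>) [0..<m])"
    by (simp only: mset_map[symmetric] sum_mset_sum_list map_map comp_def)
  also have "\<dots> = (\<Sum>k<m. \<bar>\<mu> k\<bar>)"
    by (simp add: sum_list_distinct_conv_sum_set lessThan_atLeast0)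
  finally show ?thesis .
qed

lemma scalar_prod_ip: "w \<in> carrier_vec m \<Longrightarrow> scalar_prod v w = ip m (vent v) (vent w)"
  by (simp add: scalar_prod_def ip_def lessThan_atLeast0)

lemma orth_projI:
  assumes "L \<subseteq> carrier_vec m" "x \<in> carrier_vec m" "y \<in> L"
    and "\<And>z. z \<in> L \<Longrightarrow> scalar_prod (x - y) z = 0"
  shows "orth_proj L x = y"
  unfolding orth_proj_def
proof (rule the_equality)
  fix y' assume y': "y' \<in> L \<and> (\<forall>z\<in>L. scalar_prod (x - y') z = 0)"
  have c: "y \<in> carrier_vec m" "y' \<in> carrier_vec m" using assms y' by auto
  have "ip m (vent (y' - y)) (vent z) = 0" if "z \<in> L" for z
  proof -
    have z: "z \<in> carrier_vec m" using that assms by auto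
    have "ip m (vent (x - y)) (vent z) = 0" "ip m (vent (x - y')) (vent z) = 0"
      using assms(4)[OF that] y' that
      unfolding scalar_prod_ip[OF z, of "x - y", symmetric] scalar_prod_ip[OF z, of "x - y'", symmetric] by blast+
    moreover have "ip m (vent (y' - y)) (vent z) = ip m (vent (x - y)) (vent z) - ip m (vent (x - y')) (vent z)"
      unfolding ip_diff_left[symmetric] by (rule ip_cong) (use c assms(2) in auto)
    ultimately show ?thesis by simp
  qed
  then have "ip m (vent (y' - y)) (vent y') - ip m (vent (y' - y)) (vent y) = 0" using assms(3) y' by simp
  moreover have "nsq m (vent (y' - y)) = ip m (vent (y' - y)) (vent y') - ip m (vent (y' - y)) (vent y)"
    unfolding ip_diff_right[symmetric] by (rule ip_cong) (use c in auto)
  ultimately have "nsq m (vent (y' - y)) = 0" by simp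
  from ip_self_zero[OF this] show "y' = y"
    using c by (intro eq_vecI) auto
qed (use assms in auto)

lemma mult_mat_vec_kapp:
  "A \<in> carrier_mat m m \<Longrightarrow> v \<in> carrier_vec m \<Longrightarrow> i < m \<Longrightarrow> vec_index (A *\<^sub>v v) i = kapp m (ent A) (vent v) i"
  by (simp add: kapp_def scalar_prod_def lessThan_atLeast0)

lemma eigensystem_kernel:
  assumes "orthonormal_eigensystem m W lam \<phi>"
  shows "finite {1..m}" "card {1..m} = m" "orthonormal_on m {1..m} (\<lambda>k. vent (\<phi> k))"
  using assms by (auto simp: orthonormal_eigensystem_def orthonormal_on_def scalar_prod_ip[symmetric])

text \<open>The projector onto an eigenspace is the sum over those \<open>\<phi> k\<close> that
  belong to the eigenvalue, so grouping by eigenvalues turns \<open>mat_fun\<close> into a sum over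
  \<open>k\<close>.\<close>

lemma mat_fun_eigensystem:
  assumes W: "W \<in> carrier_mat m m" and es: "orthonormal_eigensystem m W lam \<phi>"
    and "i < m" "j < m"
  shows "mat_fun f W $$ (i, j) = spec {1..m} (\<lambda>k. f (lam k)) (\<lambda>k. vent (\<phi> k)) i j"
proof -
  let ?J = "{1..m}" and ?f = "\<lambda>k. vent (\<phi> k)"
  note J = eigensystem_kernel[OF es]
  have \<phi>: "\<phi> k \<in> carrier_vec m" "W *\<^sub>v \<phi> k = lam k \<cdot>\<^sub>v \<phi> k" if "k \<in> ?J" for k
    using es that by (auto simp: orthonormal_eigensystem_def)
  have ev: "kapp m (ent W) (?f k) i = lam k * ?f k i" if "k \<in> ?J" "i < m" for k i
    using mult_mat_vec_kapp[OF W \<phi>(1)[OF that(1)] that(2)] \<phi>[OF that(1)] that(2) by simp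
  have sym: "ksym m (ent W)"
    unfolding ksym_def
  proof (intro allI impI)
    fix i j assume ij: "i < m" "j < m"
    have "ent W i j = spec ?J lam ?f i j" by (rule spec_of_eigenvectors[OF J ev ij])
    also have "\<dots> = spec ?J lam ?f j i" by (rule spec_sym)
    also have "\<dots> = ent W j i" by (rule spec_of_eigenvectors[OF J ev ij(2,1), symmetric])
    finally show "ent W i j = ent W j i" .
  qed
  \<comment> \<open>Eigenvectors for distinct eigenvalues are orthogonal. This shows both that
    \<open>lam\<close> exhausts the spectrum and that \<open>y\<close> below is the
    projection.\<close>
  have ortho: "ip m (?f k) (vent v) = 0"
    if v: "v \<in> carrier_vec m" "W *\<^sub>v v = x \<cdot>\<^sub>v v" and k: "k \<in> ?J" "lam k \<noteq> x" for v x k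
  proof -
    have kv: "kapp m (ent W) (vent v) i = x * vent v i" if "i < m" for i
      using mult_mat_vec_kapp[OF W v(1) that] v that by simp
    have "x * ip m (?f k) (vent v) = ip m (?f k) (kapp m (ent W) (vent v))"
      unfolding ip_scale_right[symmetric] by (rule ip_cong) (simp_all add: kv)
    also have "\<dots> = ip m (kapp m (ent W) (?f k)) (vent v)" by (rule ip_kapp[OF sym])
    also have "\<dots> = lam k * ip m (?f k) (vent v)"
      unfolding ip_scale_left[symmetric] by (rule ip_cong) (simp_all add: ev[OF k(1)])
    finally show ?thesis using k(2) by simp
  qed
  have kernel: "v \<in> mat_kernel (char_matrix W x) \<longleftrightarrow> v \<in> carrier_vec m \<and> W *\<^sub>v v = x \<cdot>\<^sub>v v" for v x
  proof (cases "v \<in> carrier_vec m")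
    case True
    define y z where "y = char_matrix W x *\<^sub>v v" and "z = W *\<^sub>v v"
    have d: "dim_vec y = m" "dim_vec z = m"
      using W carrier_matD(1)[OF char_matrix_closed[OF W, of x]] by (auto simp: y_def z_def)
    have "vec_index y i = vec_index z i - x * vec_index v i" if "i < m" for i
    proof -
      have "vec_index (char_matrix W x *\<^sub>v v) i = kapp m (ent (char_matrix W x)) (vent v) i"
        by (rule mult_mat_vec_kapp[OF char_matrix_closed[OF W] True that])
      also have "\<dots> = (\<Sum>j<m. W $$ (i, j) * vec_index v j - (if i = j then 1 else 0) * (x * vec_index v j))"
        unfolding kapp_def using W that
        by (intro sum.cong refl) (auto simp: char_matrix_def algebra_simps)
      also have "\<dots> = kapp m (ent W) (vent v) i - (\<Sum>j<m. (if i = j then 1 else 0) * (x * vec_index v j))"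
        by (simp only: sum_subtractf kapp_def)
      also have "(\<Sum>j<m. (if i = j then 1 else 0) * (x * vec_index v j)) = x * vec_index v i"
        using that by (simp only: sum_mult_delta finite_lessThan lessThan_iff)
      also have "kapp m (ent W) (vent v) i = vec_index (W *\<^sub>v v) i"
        by (rule mult_mat_vec_kapp[OF W True that, symmetric])
      finally show ?thesis unfolding y_def z_def .
    qed
    then have "y = 0\<^sub>v m \<longleftrightarrow> z = x \<cdot>\<^sub>v v"
      using True d by (auto simp: Matrix.vec_eq_iff)
    then have "char_matrix W x *\<^sub>v v = 0\<^sub>v m \<longleftrightarrow> W *\<^sub>v v = x \<cdot>\<^sub>v v"
      by (simp only: y_def z_def)
    then show ?thesis using W True carrier_matD[OF char_matrix_closed[OF W, of x]] by (auto simp: mat_kernel_def)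
  next
    case False
    then show ?thesis using carrier_matD[OF char_matrix_closed[OF W, of x]] by (auto simp: mat_kernel_def)
  qed
  have "spectrum W = lam ` ?J"
  proof (intro Set.set_eqI iffI)
    fix x assume "x \<in> spectrum W"
    then obtain v where v: "v \<in> carrier_vec m" "v \<noteq> 0\<^sub>v m" "W *\<^sub>v v = x \<cdot>\<^sub>v v"
      using W by (auto simp: spectrum_def eigenvalue_def eigenvector_def)
    show "x \<in> lam ` ?J"
    proof (rule ccontr)
      assume "x \<notin> lam ` ?J"
      then have "ip m (?f k) (vent v) = 0" if "k \<in> ?J" for k
        using ortho[OF v(1,3) that] that by blast
      then have "vent v i = 0" if "i < m" for i using orthonormal_expansion[OF J that, of "vent v"] by simp
      then show False using v by (auto simp: Matrix.vec_eq_iff)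
    qed
  next
    fix x assume "x \<in> lam ` ?J"
    then obtain k where k: "k \<in> ?J" "x = lam k" by blast
    have "\<phi> k \<noteq> 0\<^sub>v m"
    proof
      assume "\<phi> k = 0\<^sub>v m"
      then have "nsq m (?f k) = 0" by (simp add: ip_def)
      then show False using J(3) k(1) by (simp add: orthonormal_on_def)
    qed
    then show "x \<in> spectrum W"
      using W \<phi>[OF k(1)] k(2) by (auto simp: spectrum_def eigenvalue_def eigenvector_def)
  qed
  moreover have "vec_index (orth_proj (mat_kernel (char_matrix W x)) (unit_vec m j)) i =
      (\<Sum>k\<in>{k\<in>?J. lam k = x}. ?f k i * ?f k j)" for x
  proof -
    define y where "y = Matrix.vec m (\<lambda>i. \<Sum>k\<in>{k\<in>?J. lam k = x}. ?f k j * ?f k i)"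
    have "orth_proj (mat_kernel (char_matrix W x)) (unit_vec m j) = y"
    proof (rule orth_projI)
      show "mat_kernel (char_matrix W x) \<subseteq> carrier_vec m" using kernel by auto
      have "vec_index (W *\<^sub>v y) i = x * vec_index y i" if "i < m" for i
      proof -
        have "vec_index (W *\<^sub>v y) i = kapp m (ent W) (\<lambda>i. \<Sum>k\<in>{k\<in>?J. lam k = x}. ?f k j * ?f k i) i"
          unfolding y_def by (subst mult_mat_vec_kapp[OF W _ that]) (auto intro: kapp_cong_vec)
        also have "\<dots> = (\<Sum>k\<in>{k\<in>?J. lam k = x}. ?f k j * kapp m (ent W) (?f k) i)"
          unfolding kapp_sum kapp_scale ..
        also have "\<dots> = (\<Sum>k\<in>{k\<in>?J. lam k = x}. x * (?f k j * ?f k i))"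
          using that by (intro sum.cong refl) (auto simp: ev)
        also have "\<dots> = x * vec_index y i" using that by (simp add: y_def sum_distrib_left)
        finally show ?thesis .
      qed
      then show "y \<in> mat_kernel (char_matrix W x)"
        unfolding kernel using W by (auto simp: y_def Matrix.vec_eq_iff)
      fix z assume "z \<in> mat_kernel (char_matrix W x)"
      then have z: "z \<in> carrier_vec m" "W *\<^sub>v z = x \<cdot>\<^sub>v z" by (auto simp: kernel)
      have "scalar_prod (unit_vec m j - y) z = ip m (\<lambda>i. (if i = j then 1 else 0) - (\<Sum>k\<in>{k\<in>?J. lam k = x}. ?f k j * ?f k i)) (vent z)"
        unfolding scalar_prod_ip[OF z(1)] by (rule ip_cong) (use assms(4) in \<open>auto simp: y_def\<close>)
      also have "\<dots> = vent z j - (\<Sum>k\<in>{k\<in>?J. lam k = x}. ?f k j * ip m (?f k) (vent z))"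
        unfolding ip_diff_left ip_unit[OF assms(4)] ip_sum_left ..
      also have "(\<Sum>k\<in>{k\<in>?J. lam k = x}. ?f k j * ip m (?f k) (vent z)) = (\<Sum>k\<in>?J. ip m (?f k) (vent z) * ?f k j)"
        using ortho[OF z] by (intro sum.mono_neutral_cong_left) auto
      also have "\<dots> = vent z j" by (rule orthonormal_expansion[OF J assms(4)])
      finally show "scalar_prod (unit_vec m j - y) z = 0" by simp
    qed simp
    then show ?thesis using assms(3) by (simp add: y_def mult.commute)
  qed
  ultimately have "mat_fun f W $$ (i, j) = (\<Sum>x\<in>lam ` ?J. f x * (\<Sum>k\<in>{k\<in>?J. lam k = x}. ?f k i * ?f k j))"
    using W assms(3,4) by (simp add: mat_fun_def)
  also have "\<dots> = (\<Sum>x\<in>lam ` ?J. \<Sum>k\<in>{k\<in>?J. lam k = x}. f (lam k) * ?f k i * ?f k j)"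
    by (intro sum.cong refl) (simp add: sum_distrib_left mult.assoc)
  also have "\<dots> = (\<Sum>k\<in>?J. f (lam k) * ?f k i * ?f k j)"
    by (rule sum.image_gen[symmetric]) simp
  finally show ?thesis by (simp add: spec_def)
qed

text \<open>\<open>P x\<close> is a combination of eigenvectors with nonzero eigenvalue, and
  \<open>P S = S\<close> implies that \<open>P\<close> fixes every such eigenvector. Hence
  \<open>x - P x\<close> is orthogonal to all of them.\<close>

lemma orth_proj_support:
  fixes \<mu> :: "nat \<Rightarrow> real"
  assumes S: "S \<in> carrier_mat m m" and o: "orthonormal_on m {..<m} \<psi>"
    and e: "\<And>i j. i < m \<Longrightarrow> j < m \<Longrightarrow> S $$ (i, j) = spec {..<m} \<mu> \<psi> i j"
    and x: "x \<in> carrier_vec m"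
  defines "P \<equiv> spec {..<m} (\<lambda>k. if \<mu> k = 0 then 0 else 1) \<psi>"
  shows "orth_proj (support m S) x = Matrix.vec m (kapp m P (vent x))"
proof -
  interpret V: vec_space "TYPE(real)" m .
  let ?B = "{v. \<exists>x. x \<noteq> 0 \<and> eigenvector S v x}"
  have B: "?B \<subseteq> carrier_vec m" using S by (auto simp: eigenvector_def)
  have sp: "support m S = V.span ?B" by (simp add: support_def)
  have PS: "kapp m P (vent v) i = vent v i" if "v \<in> ?B" "i < m" for v i
  proof -
    obtain x where v: "x \<noteq> 0" "v \<in> carrier_vec m" "S *\<^sub>v v = x \<cdot>\<^sub>v v"
      using \<open>v \<in> ?B\<close> S by (auto simp: eigenvector_def)
    have sv: "vent v i = 1 / x * kapp m (spec {..<m} \<mu> \<psi>) (vent v) i" if "i < m" for i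
    proof -
      have "x * vent v i = kapp m (ent S) (vent v) i" using mult_mat_vec_kapp[OF S v(2) that] v that by simp
      also have "\<dots> = kapp m (spec {..<m} \<mu> \<psi>) (vent v) i" by (rule kapp_cong[OF e that])
      finally show ?thesis using v(1) by (simp add: field_simps)
    qed
    have "kapp m P (vent v) i = kapp m P (\<lambda>i. 1 / x * kapp m (spec {..<m} \<mu> \<psi>) (vent v) i) i"
      by (rule kapp_cong_vec) (rule sv)
    also have "\<dots> = 1 / x * kapp m (kmult m P (spec {..<m} \<mu> \<psi>)) (vent v) i"
      unfolding kapp_kmult by (rule kapp_scale)
    also have "kmult m P (spec {..<m} \<mu> \<psi>) = spec {..<m} \<mu> \<psi>"
      unfolding P_def kmult_spec[OF finite_lessThan o] by (intro arg_cong[where f = "\<lambda>a. spec _ a _"]) auto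
    finally show ?thesis using sv[OF that(2)] by simp
  qed
  show ?thesis
    unfolding sp
  proof (rule orth_projI)
    show "V.span ?B \<subseteq> carrier_vec m" using V.span_is_subset2[OF B] by (simp add: module_vec_simps)
    have psi: "Matrix.vec m (\<psi> k) \<in> ?B" if "k < m" "\<mu> k \<noteq> 0" for k
    proof -
      let ?v = "Matrix.vec m (\<psi> k)"
      have "vec_index (S *\<^sub>v ?v) i = \<mu> k * \<psi> k i" if "i < m" for i
      proof -
        have "vec_index (S *\<^sub>v ?v) i = kapp m (ent S) (vent ?v) i" by (rule mult_mat_vec_kapp[OF S _ that]) simp
        also have "\<dots> = kapp m (spec {..<m} \<mu> \<psi>) (vent ?v) i" by (rule kapp_cong[OF e that])
        also have "\<dots> = kapp m (spec {..<m} \<mu> \<psi>) (\<psi> k) i" by (rule kapp_cong_vec) simp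
        also have "\<dots> = \<mu> k * \<psi> k i" using kapp_spec_eigenvector[OF _ o, of k] \<open>k < m\<close> by simp
        finally show ?thesis .
      qed
      then have "S *\<^sub>v ?v = \<mu> k \<cdot>\<^sub>v ?v" using S by (intro eq_vecI) auto
      moreover have "?v \<noteq> 0\<^sub>v m"
      proof
        assume z: "?v = 0\<^sub>v m"
        have "\<psi> k i = 0" if "i < m" for i using arg_cong[OF z, of "\<lambda>v. vec_index v i"] that by simp
        then have "nsq m (\<psi> k) = 0" by (simp add: ip_def)
        then show False using o that(1) by (simp add: orthonormal_on_def)
      qed
      ultimately show ?thesis using S that(2) by (auto simp: eigenvector_def)
    qed
    have zero: "0\<^sub>v m \<in> V.span ?B"
      by (rule V.in_spanI[of _ undefined "{}"]) (simp_all add: V.lincomb_def)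
    have "Matrix.vec m (\<lambda>i. \<Sum>k<n. (if \<mu> k = 0 then 0 else 1) * ip m (\<psi> k) (vent x) * \<psi> k i) \<in> V.span ?B"
      if "n \<le> m" for n using that
    proof (induction n)
      case 0
      have e: "Matrix.vec m (\<lambda>i. \<Sum>k<0. (if \<mu> k = 0 then 0 else 1) * ip m (\<psi> k) (vent x) * \<psi> k i) = 0\<^sub>v m"
        by auto
      show ?case unfolding e by (rule zero)
    next
      case (Suc n)
      let ?c = "(if \<mu> n = 0 then 0 else 1) * ip m (\<psi> n) (vent x)"
      have "?c \<cdot>\<^sub>v Matrix.vec m (\<psi> n) \<in> V.span ?B"
      proof (cases "\<mu> n = 0")
        case True
        then have "?c \<cdot>\<^sub>v Matrix.vec m (\<psi> n) = 0\<^sub>v m" by auto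
        then show ?thesis using zero by simp
      next
        case False
        then have "Matrix.vec m (\<psi> n) \<in> V.span ?B"
          using psi[of n] Suc.prems V.in_own_span[OF B] by auto
        then show ?thesis using V.smult_in_span[OF B] by simp
      qed
      moreover have "Matrix.vec m (\<lambda>i. \<Sum>k<n. (if \<mu> k = 0 then 0 else 1) * ip m (\<psi> k) (vent x) * \<psi> k i) \<in> V.span ?B"
        using Suc by simp
      ultimately have "Matrix.vec m (\<lambda>i. \<Sum>k<n. (if \<mu> k = 0 then 0 else 1) * ip m (\<psi> k) (vent x) * \<psi> k i)
          + ?c \<cdot>\<^sub>v Matrix.vec m (\<psi> n) \<in> V.span ?B"
        using V.span_add1[OF B] by simp
      also have "Matrix.vec m (\<lambda>i. \<Sum>k<n. (if \<mu> k = 0 then 0 else 1) * ip m (\<psi> k) (vent x) * \<psi> k i)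
          + ?c \<cdot>\<^sub>v Matrix.vec m (\<psi> n) =
        Matrix.vec m (\<lambda>i. \<Sum>k<Suc n. (if \<mu> k = 0 then 0 else 1) * ip m (\<psi> k) (vent x) * \<psi> k i)"
        by (intro eq_vecI) auto
      finally show ?case .
    qed
    from this[of m] show "Matrix.vec m (kapp m P (vent x)) \<in> V.span ?B"
      by (simp add: P_def kapp_spec[abs_def])
    have w0: "x - Matrix.vec m (kapp m P (vent x)) \<in> carrier_vec m" using x by auto
    \<comment> \<open>Vectors orthogonal to a fixed one form a submodule, which extends
      orthogonality from the generators to their span.\<close>
    have sm: "submodule class_ring {z \<in> carrier_vec m. scalar_prod (x - Matrix.vec m (kapp m P (vent x))) z = 0} V.V"
      by (unfold_locales)
        (auto simp: module_vec_simps class_ring_simps scalar_prod_add_distrib[OF w0] scalar_prod_right_zero[OF w0])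
    have "?B \<subseteq> {z \<in> carrier_vec m. scalar_prod (x - Matrix.vec m (kapp m P (vent x))) z = 0}"
    proof
      fix v assume v: "v \<in> ?B"
      then have vc: "v \<in> carrier_vec m" using B by auto
      have "scalar_prod (x - Matrix.vec m (kapp m P (vent x))) v = ip m (\<lambda>i. vent x i - kapp m P (vent x) i) (vent v)"
        unfolding scalar_prod_ip[OF vc] by (rule ip_cong) (use x in auto)
      also have "\<dots> = ip m (vent x) (vent v) - ip m (vent x) (kapp m P (vent v))"
        unfolding ip_diff_left by (subst ip_kapp) (auto simp: P_def ksym_def spec_sym)
      also have "ip m (vent x) (kapp m P (vent v)) = ip m (vent x) (vent v)"
        by (rule ip_cong) (use PS[OF v] in auto)
      finally show "v \<in> {z \<in> carrier_vec m. scalar_prod (x - Matrix.vec m (kapp m P (vent x))) z = 0}"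
        using vc by simp
    qed
    then show "scalar_prod (x - Matrix.vec m (kapp m P (vent x))) z = 0" if "z \<in> V.span ?B" for z
      using V.span_is_subset[OF _ sm] that by blast
  qed (rule x)
qed

lemma L2_sq_kip: "A \<in> carrier_mat m m \<Longrightarrow> L2_sq A = kip m (ent A) (ent A) / (real m)\<^sup>2"
  by (simp add: L2_sq_def frobenius_sq_def kip_def power2_eq_square)

text \<open>The real \<open>sqrt\<close> is an odd function, so its square is the absolute value and
  negative \<open>lam k\<close> are covered too. Columns of \<open>A\<close> become rows by
  symmetry.\<close>

lemma kip_sqrt_spec:
  fixes lam :: "'i \<Rightarrow> real"
  assumes "finite J" "orthonormal_on m J \<phi>" "ksym m A"
  defines "H \<equiv> kmult m (spec J (\<lambda>k. sqrt (lam k)) \<phi>) A"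
  shows "kip m H H = (\<Sum>k\<in>J. \<bar>lam k\<bar> * nsq m (kapp m A (\<phi> k)))"
proof -
  have "kip m H H = (\<Sum>j<m. \<Sum>i<m. H i j * H i j)" unfolding kip_def by (rule sum.swap)
  also have "\<dots> = (\<Sum>j<m. \<Sum>k\<in>J. (sqrt (lam k))\<^sup>2 * (ip m (\<phi> k) (\<lambda>i. A i j))\<^sup>2)"
    unfolding H_def kmult_kapp ip_def[symmetric] norm_kapp_spec[OF assms(1,2)] ..
  also have "\<dots> = (\<Sum>j<m. \<Sum>k\<in>J. \<bar>lam k\<bar> * (kapp m A (\<phi> k) j * kapp m A (\<phi> k) j))"
  proof (intro sum.cong refl)
    fix j k assume "j \<in> {..<m}"
    then have "ip m (\<phi> k) (\<lambda>i. A i j) = kapp m A (\<phi> k) j"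
      unfolding ip_def kapp_def using assms(3) by (intro sum.cong refl) (auto simp: ksym_def mult.commute)
    then show "(sqrt (lam k))\<^sup>2 * (ip m (\<phi> k) (\<lambda>i. A i j))\<^sup>2 = \<bar>lam k\<bar> * (kapp m A (\<phi> k) j * kapp m A (\<phi> k) j)"
      by (simp add: power2_eq_square)
  qed
  also have "\<dots> = (\<Sum>k\<in>J. \<Sum>j<m. \<bar>lam k\<bar> * (kapp m A (\<phi> k) j * kapp m A (\<phi> k) j))" by (rule sum.swap)
  finally show ?thesis by (simp only: ip_def sum_distrib_left)
qed

section \<open>Convexity of the nuclear norm and of the risk\<close>

lemma sym_kernels_ksym: "S \<in> sym_kernels m \<Longrightarrow> ksym m (ent S)"
proof -
  assume S: "S \<in> sym_kernels m"
  have "S $$ (i, j) = S $$ (j, i)" if "i < m" "j < m" for i j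
  proof -
    have "transpose_mat S $$ (i, j) = S $$ (j, i)"
      using S that by (intro index_transpose_mat) (auto simp: sym_kernels_def)
    moreover have "transpose_mat S = S" using S by (simp add: sym_kernels_def)
    ultimately show ?thesis by metis
  qed
  then show ?thesis by (simp add: ksym_def)
qed

text \<open>Duality with the sign \<open>K\<close> of the combination: the pairing with
  \<open>K\<close> is linear, attains the norm at the combination, and is at most the norm at
  \<open>S\<close> and \<open>T\<close>.\<close>

lemma nuclear_norm_convex:
  assumes S: "S \<in> sym_kernels m" and T: "T \<in> sym_kernels m"
    and a: "0 \<le> a" "0 \<le> b" and Q: "a \<cdot>\<^sub>m S + b \<cdot>\<^sub>m T \<in> sym_kernels m"
  shows "nuclear_norm (a \<cdot>\<^sub>m S + b \<cdot>\<^sub>m T) \<le> a * nuclear_norm S + b * nuclear_norm T"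
proof -
  let ?Q = "a \<cdot>\<^sub>m S + b \<cdot>\<^sub>m T"
  have c: "S \<in> carrier_mat m m" "T \<in> carrier_mat m m" "?Q \<in> carrier_mat m m"
    using S T Q by (auto simp: sym_kernels_def)
  obtain \<nu> \<eta> where o: "orthonormal_on m {..<m} \<eta>"
    and e: "\<And>i j. i < m \<Longrightarrow> j < m \<Longrightarrow> ent ?Q i j = spec {..<m} \<nu> \<eta> i j"
    by (rule spectral_theorem[OF sym_kernels_ksym[OF Q]]) blast
  define K where "K = spec {..<m} (\<lambda>k. sgn (\<nu> k)) \<eta>"
  have K1: "\<bar>ip m x (kapp m K x)\<bar> \<le> nsq m x" for x
  proof -
    have "\<bar>ip m x (kapp m K x)\<bar> \<le> (\<Sum>k<m. \<bar>sgn (\<nu> k) * (ip m (\<eta> k) x)\<^sup>2\<bar>)"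
      unfolding K_def ip_kapp_spec by (rule sum_abs)
    also have "\<dots> \<le> (\<Sum>k<m. (ip m (\<eta> k) x)\<^sup>2)"
      by (intro sum_mono) (auto simp: abs_mult sgn_if)
    also have "\<dots> \<le> nsq m x" by (rule Bessel[OF finite_lessThan o])
    finally show ?thesis .
  qed
  have le: "kip m (ent S) K \<le> nuclear_norm S" if S: "S \<in> sym_kernels m" for S
  proof -
    obtain \<mu> \<psi> where o: "orthonormal_on m {..<m} \<psi>"
      and e: "\<And>i j. i < m \<Longrightarrow> j < m \<Longrightarrow> ent S i j = spec {..<m} \<mu> \<psi> i j"
      by (rule spectral_theorem[OF sym_kernels_ksym[OF S]]) blast
    have "kip m (ent S) K = kip m (spec {..<m} \<mu> \<psi>) K" by (rule kip_cong) (simp_all add: e)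
    also have "\<dots> \<le> (\<Sum>k<m. \<bar>\<mu> k\<bar>)"
      unfolding kip_spec
    proof (intro sum_mono)
      fix k assume "k \<in> {..<m}"
      then have "nsq m (\<psi> k) = 1" using o by (simp add: orthonormal_on_def)
      then have "\<bar>\<mu> k * ip m (\<psi> k) (kapp m K (\<psi> k))\<bar> \<le> \<bar>\<mu> k\<bar> * 1"
        unfolding abs_mult using K1[of "\<psi> k"] by (intro mult_left_mono) auto
      then show "\<mu> k * ip m (\<psi> k) (kapp m K (\<psi> k)) \<le> \<bar>\<mu> k\<bar>" by simp
    qed
    also have "\<dots> = nuclear_norm S"
      using nuclear_norm_spectral[OF _ o e] S by (simp add: sym_kernels_def)
    finally show ?thesis .
  qed
  have "nuclear_norm ?Q = (\<Sum>k<m. \<bar>\<nu> k\<bar>)" by (rule nuclear_norm_spectral[OF c(3) o e])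
  also have "\<dots> = kip m (spec {..<m} \<nu> \<eta>) K"
    unfolding kip_spec K_def
    using eigenvalue_quadratic_form[OF o] by (intro sum.cong refl) (simp add: abs_sgn)
  also have "\<dots> = kip m (\<lambda>i j. a * ent S i j + b * ent T i j) K"
    by (rule kip_cong) (use c e in \<open>auto simp: e[symmetric]\<close>)
  also have "\<dots> = a * kip m (ent S) K + b * kip m (ent T) K"
    by (simp only: kip_add_left kip_scale_left)
  also have "\<dots> \<le> a * nuclear_norm S + b * nuclear_norm T"
    by (intro add_mono mult_left_mono le S T a)
  finally show ?thesis .
qed

lemma kip_convex_combination:
  "kip m (\<lambda>i j. b * A i j + (1 - b) * B i j) (\<lambda>i j. b * A i j + (1 - b) * B i j) =
   b * kip m A A + (1 - b) * kip m B B - b * (1 - b) * kip m (\<lambda>i j. A i j - B i j) (\<lambda>i j. A i j - B i j)"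
  unfolding kip_add_left kip_add_right kip_diff_left kip_diff_right kip_scale_left kip_scale_right
  by (simp add: kip_commute[of m B A] algebra_simps)

text \<open>The penalised risk without the nuclear norm. It is quadratic, so its deficit along a
  segment is known exactly.\<close>

definition risk_kernel ::
    "nat \<Rightarrow> nat \<Rightarrow> (nat \<Rightarrow> nat \<times> nat \<times> real) \<Rightarrow> real \<Rightarrow> (nat \<Rightarrow> nat \<Rightarrow> real) \<Rightarrow> (nat \<Rightarrow> nat \<Rightarrow> real) \<Rightarrow> real" where
  "risk_kernel m n z e H A = kip m A A / (real m)\<^sup>2
     - (2 / real n) * (\<Sum>j=1..n. case z j of (x, x', y) \<Rightarrow> y * A x x')
     + e * (kip m (kmult m H A) (kmult m H A) / (real m)\<^sup>2)"

lemma penalized_risk_kernel: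
  assumes "S \<in> carrier_mat m m" "W \<in> carrier_mat m m"
  shows "penalized_risk n z \<epsilon> e W S = risk_kernel m n z e (ent (mat_fun sqrt W)) (ent S) + \<epsilon> * nuclear_norm S"
    and "L2_sq (mat_fun sqrt W * S) =
      kip m (kmult m (ent (mat_fun sqrt W)) (ent S)) (kmult m (ent (mat_fun sqrt W)) (ent S)) / (real m)\<^sup>2"
proof -
  have W: "mat_fun sqrt W \<in> carrier_mat m m" using assms(2) by (simp add: mat_fun_def)
  then have c: "mat_fun sqrt W * S \<in> carrier_mat m m" using assms(1) by simp
  have "ent (mat_fun sqrt W * S) i j = kmult m (ent (mat_fun sqrt W)) (ent S) i j" if "i < m" "j < m" for i j
    using that W assms(1) by (simp add: kmult_def scalar_prod_def lessThan_atLeast0)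
  then show 1: "L2_sq (mat_fun sqrt W * S) =
      kip m (kmult m (ent (mat_fun sqrt W)) (ent S)) (kmult m (ent (mat_fun sqrt W)) (ent S)) / (real m)\<^sup>2"
    unfolding L2_sq_kip[OF c] by (intro arg_cong[where f = "\<lambda>x. x / _"] kip_cong) auto
  show "penalized_risk n z \<epsilon> e W S = risk_kernel m n z e (ent (mat_fun sqrt W)) (ent S) + \<epsilon> * nuclear_norm S"
    unfolding penalized_risk_def 1 L2_sq_kip[OF assms(1)] risk_kernel_def by simp
qed

lemma risk_kernel_cong:
  assumes "\<And>i j. i < m \<Longrightarrow> j < m \<Longrightarrow> A i j = B i j"
    and "\<And>j. j \<in> {1..n} \<Longrightarrow> z j \<in> {..<m} \<times> {..<m} \<times> UNIV"
  shows "risk_kernel m n z e H A = risk_kernel m n z e H B"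
proof -
  have "(case z j of (x, x', y) \<Rightarrow> y * A x x') = (case z j of (x, x', y) \<Rightarrow> y * B x x')" if "j \<in> {1..n}" for j
    using assms(1) assms(2)[OF that] by auto
  then have "(\<Sum>j=1..n. case z j of (x, x', y) \<Rightarrow> y * A x x') = (\<Sum>j=1..n. case z j of (x, x', y) \<Rightarrow> y * B x x')"
    by (intro sum.cong refl)
  moreover have "kmult m H A i j = kmult m H B i j" if "j < m" for i j
    unfolding kmult_def using assms(1) that by (intro sum.cong refl) auto
  ultimately show ?thesis
    unfolding risk_kernel_def using kip_cong[of m A B A B] kip_cong[of m "kmult m H A" "kmult m H B" "kmult m H A" "kmult m H B"] assms(1)
    by simp
qed

lemma kmult_diff_right: "kmult m H (\<lambda>i j. A i j - B i j) = (\<lambda>i j. kmult m H A i j - kmult m H B i j)"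
  by (simp add: kmult_def fun_eq_iff right_diff_distrib sum_subtractf)

lemma kmult_combination_right:
  "kmult m H (\<lambda>i j. b * A i j + c * B i j) = (\<lambda>i j. b * kmult m H A i j + c * kmult m H B i j)"
  by (simp add: kmult_def fun_eq_iff distrib_left sum.distrib sum_distrib_left mult_ac)

lemma risk_kernel_convex_combination:
  fixes A B :: "nat \<Rightarrow> nat \<Rightarrow> real"
  defines "\<Delta> \<equiv> \<lambda>i j. A i j - B i j"
  shows "risk_kernel m n z e H (\<lambda>i j. b * A i j + (1 - b) * B i j) =
    b * risk_kernel m n z e H A + (1 - b) * risk_kernel m n z e H B
    - b * (1 - b) * (kip m \<Delta> \<Delta> / (real m)\<^sup>2 + e * (kip m (kmult m H \<Delta>) (kmult m H \<Delta>) / (real m)\<^sup>2))"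
proof -
  have s: "(\<Sum>j=1..n. case z j of (x, x', y) \<Rightarrow> y * (b * A x x' + (1 - b) * B x x')) =
      b * (\<Sum>j=1..n. case z j of (x, x', y) \<Rightarrow> y * A x x') + (1 - b) * (\<Sum>j=1..n. case z j of (x, x', y) \<Rightarrow> y * B x x')"
    unfolding sum_distrib_left sum.distrib[symmetric]
    by (intro sum.cong refl) (auto simp: algebra_simps split: prod.split)
  show ?thesis
    unfolding risk_kernel_def \<Delta>_def kmult_combination_right kmult_diff_right kip_convex_combination s
    by (simp add: field_simps add_divide_distrib diff_divide_distrib)
qed

text \<open>Compare the minimiser \<open>T\<close> with \<open>b T + (1 - b) S\<close>, use
  convexity of the nuclear norm, divide by \<open>1 - b\<close> and let \<open>b\<close> tend to
  1.\<close>

lemma penalized_risk_strongly_convex: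
  assumes W: "W \<in> carrier_mat m m" and D: "D \<subseteq> sym_kernels m" "convex_mats D"
    and z: "\<And>j. j \<in> {1..n} \<Longrightarrow> z j \<in> {..<m} \<times> {..<m} \<times> UNIV" and "0 \<le> \<epsilon>"
    and T: "T \<in> D" and min: "\<And>S. S \<in> D \<Longrightarrow> penalized_risk n z \<epsilon> e W T \<le> penalized_risk n z \<epsilon> e W S"
    and S: "S \<in> D"
  defines "\<Delta> \<equiv> \<lambda>i j. T $$ (i, j) - S $$ (i, j)" and "H \<equiv> ent (mat_fun sqrt W)"
  shows "penalized_risk n z \<epsilon> e W T
    + (kip m \<Delta> \<Delta> / (real m)\<^sup>2 + e * (kip m (kmult m H \<Delta>) (kmult m H \<Delta>) / (real m)\<^sup>2))
    \<le> penalized_risk n z \<epsilon> e W S"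
proof -
  let ?r = "risk_kernel m n z e H"
  define G where "G = kip m \<Delta> \<Delta> / (real m)\<^sup>2 + e * (kip m (kmult m H \<Delta>) (kmult m H \<Delta>) / (real m)\<^sup>2)"
  have pr: "penalized_risk n z \<epsilon> e W Q = ?r (ent Q) + \<epsilon> * nuclear_norm Q" if "Q \<in> D" for Q
    unfolding H_def using that D W by (intro penalized_risk_kernel) (auto simp: sym_kernels_def)
  have "G \<le> penalized_risk n z \<epsilon> e W S - penalized_risk n z \<epsilon> e W T"
  proof (rule field_le_mult_one_interval)
    fix b :: real assume b: "0 < b" "b < 1"
    define Q where "Q = b \<cdot>\<^sub>m T + (1 - b) \<cdot>\<^sub>m S"
    have Q: "Q \<in> D" using D(2) T S b unfolding convex_mats_def Q_def by auto
    have c: "T \<in> carrier_mat m m" "S \<in> carrier_mat m m" using T S D by (auto simp: sym_kernels_def)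
    have "?r (ent Q) = ?r (\<lambda>i j. b * T $$ (i, j) + (1 - b) * S $$ (i, j))"
      using z c by (intro risk_kernel_cong) (auto simp: Q_def)
    also have "\<dots> = b * ?r (ent T) + (1 - b) * ?r (ent S) - b * (1 - b) * G"
      unfolding G_def \<Delta>_def by (rule risk_kernel_convex_combination)
    finally have 1: "?r (ent Q) = b * ?r (ent T) + (1 - b) * ?r (ent S) - b * (1 - b) * G" .
    have "nuclear_norm Q \<le> b * nuclear_norm T + (1 - b) * nuclear_norm S"
      using T S Q D(1) b unfolding Q_def by (intro nuclear_norm_convex) auto
    then have 2: "\<epsilon> * nuclear_norm Q \<le> \<epsilon> * (b * nuclear_norm T + (1 - b) * nuclear_norm S)"
      using \<open>0 \<le> \<epsilon>\<close> by (rule mult_left_mono)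
    have "?r (ent T) + \<epsilon> * nuclear_norm T \<le> ?r (ent Q) + \<epsilon> * nuclear_norm Q"
      using min[OF Q] unfolding pr[OF Q] pr[OF T] .
    then have "(1 - b) * (b * G) \<le> (1 - b) * ((?r (ent S) + \<epsilon> * nuclear_norm S) - (?r (ent T) + \<epsilon> * nuclear_norm T))"
      using 1 2 by (simp add: algebra_simps)
    then show "b * G \<le> penalized_risk n z \<epsilon> e W S - penalized_risk n z \<epsilon> e W T"
      unfolding pr[OF S] pr[OF T] using b by (simp add: mult_le_cancel_left)
  qed
  then show ?thesis by (simp add: G_def)
qed

section \<open>The deterministic oracle inequality\<close>

context sampling_model
begin

text \<open>Symmetric kernels do not notice the symmetrisation of the observations, so the noise may
  be taken symmetric.\<close>

lemma kip_obs:
  assumes "w \<in> \<Omega>" "ksym m A"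
  shows "kip m (obs w) A = (case w of (x, x', y) \<Rightarrow> y * A x x')"
proof -
  obtain u v y where w: "w = (u, v, y)" "u < m" "v < m" using assms(1) by (auto simp: \<Omega>_def)
  let ?d = "\<lambda>u v i j. (if i = u then 1 else 0) * (if j = v then 1 else (0::real))"
  have d: "(\<Sum>i<m. \<Sum>j<m. A i j * ?d u v i j) = A u v" if "u < m" "v < m" for u v
  proof -
    have "(\<Sum>i<m. \<Sum>j<m. A i j * ?d u v i j) =
        (\<Sum>i<m. \<Sum>j<m. A i j * ((if u = i then 1 else 0) * (if v = j then 1 else 0)))"
      by (intro sum.cong refl) auto
    then show ?thesis using double_delta[OF that, of A] by simp
  qed
  have "kip m (obs w) A = y / 2 * ((\<Sum>i<m. \<Sum>j<m. A i j * ?d u v i j) + (\<Sum>i<m. \<Sum>j<m. A i j * ?d v u i j))"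
    unfolding kip_def w(1) obs_def prod.case sum_distrib_left sum.distrib[symmetric]
    by (intro sum.cong refl) (simp add: algebra_simps)
  also have "\<dots> = y / 2 * (A u v + A v u)" using w d by simp
  also have "A v u = A u v" using assms(2) w by (auto simp: ksym_def)
  finally show ?thesis by (simp add: w(1))
qed

lemma kip_sum_left: "kip m (\<lambda>i j. \<Sum>l\<in>L. B l i j) A = (\<Sum>l\<in>L. kip m (B l) A)"
proof -
  have "kip m (\<lambda>i j. \<Sum>l\<in>L. B l i j) A = (\<Sum>i<m. \<Sum>l\<in>L. \<Sum>j<m. B l i j * A i j)"
    unfolding kip_def sum_distrib_right by (intro sum.cong refl sum.swap)
  then show ?thesis unfolding kip_def by (simp only: sum.swap[of _ L])
qed

lemma kip_noise:
  assumes "ksym m A" "\<And>j. j \<in> {1..n} \<Longrightarrow> z j \<in> \<Omega>" "1 \<le> n"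
  shows "kip m (noise n z) A =
    1 / real n * (\<Sum>j=1..n. case z j of (x, x', y) \<Rightarrow> y * A x x') - kip m S0 A / (real m)\<^sup>2"
proof -
  have "kip m (noise n z) A = 1 / real n * (\<Sum>j=1..n. kip m (cen (z j)) A)"
    unfolding noise_def[abs_def] kip_scale_left kip_sum_left ..
  also have "(\<Sum>j=1..n. kip m (cen (z j)) A) = (\<Sum>j=1..n. kip m (obs (z j)) A - kip m S0 A / (real m)\<^sup>2)"
    unfolding cen_def[abs_def] kip_diff_left kip_scale_left by simp
  also have "\<dots> = (\<Sum>j=1..n. case z j of (x, x', y) \<Rightarrow> y * A x x') - real n * (kip m S0 A / (real m)\<^sup>2)"
    unfolding sum_subtractf using kip_obs[OF assms(2) assms(1)] by simp
  finally show ?thesis using assms(3) by (simp add: right_diff_distrib)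
qed

text \<open>Expanding the square around \<open>S0\<close> produces the cross term
  \<open>2 * kip m S0 A / m^2\<close>, which the mean subtracted in \<open>noise\<close>
  cancels.\<close>

lemma risk_kernel_difference:
  assumes "ksym m A" "\<And>j. j \<in> {1..n} \<Longrightarrow> z j \<in> \<Omega>" "1 \<le> n"
    and AB: "\<And>i j. A i j = T i j - S0 i j"
  shows "risk_kernel m n z e H T - risk_kernel m n z e H S0 =
    kip m A A / (real m)\<^sup>2 - 2 * kip m (noise n z) A
    + e * (kip m (kmult m H T) (kmult m H T) / (real m)\<^sup>2) - e * (kip m (kmult m H S0) (kmult m H S0) / (real m)\<^sup>2)"
proof -
  have T: "T = (\<lambda>i j. A i j + S0 i j)" using AB by simp
  have "kip m T T - kip m S0 S0 = kip m A A + 2 * kip m S0 A"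
    unfolding T kip_add_left kip_add_right by (simp add: kip_commute[of m A S0])
  then have 1: "kip m T T / (real m)\<^sup>2 - kip m S0 S0 / (real m)\<^sup>2 = kip m A A / (real m)\<^sup>2 + 2 * (kip m S0 A / (real m)\<^sup>2)"
    by (simp only: diff_divide_distrib[symmetric] add_divide_distrib[symmetric] times_divide_eq_right)
  define sT where "sT = (\<Sum>j=1..n. case z j of (x, x', y) \<Rightarrow> y * T x x')"
  define sS where "sS = (\<Sum>j=1..n. case z j of (x, x', y) \<Rightarrow> y * S0 x x')"
  define sA where "sA = (\<Sum>j=1..n. case z j of (x, x', y) \<Rightarrow> y * A x x')"
  have "sT - sS = sA"
    unfolding sT_def sS_def sA_def sum_subtractf[symmetric] AB
    by (intro sum.cong refl) (auto simp: algebra_simps split: prod.split)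
  then have 2: "sT = sS + sA" by simp
  have 3: "kip m (noise n z) A = 1 / real n * sA - kip m S0 A / (real m)\<^sup>2"
    unfolding sA_def by (rule kip_noise[OF assms(1-3)])
  show ?thesis
    unfolding risk_kernel_def sT_def[symmetric] sS_def[symmetric] 2 3 using 1
    by (simp add: algebra_simps add_divide_distrib)
qed

lemma oracle_bound:
  assumes W: "W \<in> carrier_mat m m" and es: "orthonormal_eigensystem m W lam \<phi>"
    and D: "D \<subseteq> sym_kernels m" "convex_mats D"
    and z: "\<And>j. j \<in> {1..n} \<Longrightarrow> z j \<in> \<Omega>" and "1 \<le> n" "0 < \<epsilon>" "0 \<le> e"
    and T: "T \<in> D" and min: "\<And>S. S \<in> D \<Longrightarrow> penalized_risk n z \<epsilon> e W T \<le> penalized_risk n z \<epsilon> e W S"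
    and S: "S \<in> D" and S0: "S0 = ent S"
    and o: "orthonormal_on m {..<m} \<psi>" and e\<psi>: "\<And>i j. i < m \<Longrightarrow> j < m \<Longrightarrow> S $$ (i, j) = spec {..<m} \<mu> \<psi> i j"
    and a: "\<And>k. k \<in> {1..m} \<Longrightarrow> 0 < a k" "\<And>k. k \<in> {1..m} \<Longrightarrow> a k \<le> 1 + e * \<bar>lam k\<bar>"
    and good1: "\<And>x. \<bar>ip m x (kapp m (noise n z) x)\<bar> \<le> \<epsilon> / 2 * nsq m x"
    and good2: "wnorm \<psi> \<mu> {1..m} (\<lambda>k. vent (\<phi> k)) a (noise n z) \<le> \<Theta>"
  shows "L2_sq (T - S) \<le> e * L2_sq (mat_fun sqrt W * S) + 2 * (real m)\<^sup>2 * \<Theta> + (real m)\<^sup>2 * \<epsilon>\<^sup>2 / 2 *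
    (\<Sum>k\<in>{1..m}. 1 / a k * nsq m (kapp m (P \<psi> \<mu>) (vent (\<phi> k))))"
proof -
  let ?f = "\<lambda>k. vent (\<phi> k)" and ?J = "{1..m}"
  note J = eigensystem_kernel[OF es]
  define A where "A = (\<lambda>i j. T $$ (i, j) - S $$ (i, j))"
  define H where "H = ent (mat_fun sqrt W)"
  define M where "M = (real m)\<^sup>2"
  define \<Xi> where "\<Xi> = noise n z"
  have "0 < M" using m2 by (simp add: M_def)
  have sk: "T \<in> sym_kernels m" "S \<in> sym_kernels m" and c: "T \<in> carrier_mat m m" "S \<in> carrier_mat m m"
    using T S D by (auto simp: sym_kernels_def)
  have kA: "ksym m A" using sym_kernels_ksym[OF sk(1)] sym_kernels_ksym[OF sk(2)] by (simp add: ksym_def A_def)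
  have hH: "kip m (kmult m H B) (kmult m H B) = (\<Sum>k\<in>?J. \<bar>lam k\<bar> * nsq m (kapp m B (?f k)))"
    if "ksym m B" for B
  proof -
    have "kmult m H B i j = kmult m (spec ?J (\<lambda>k. sqrt (lam k)) ?f) B i j" if "i < m" for i j
      unfolding kmult_def H_def using mat_fun_eigensystem[OF W es that] by (intro sum.cong refl) auto
    then have "kip m (kmult m H B) (kmult m H B) =
        kip m (kmult m (spec ?J (\<lambda>k. sqrt (lam k)) ?f) B) (kmult m (spec ?J (\<lambda>k. sqrt (lam k)) ?f) B)"
      by (intro kip_cong)
    then show ?thesis using kip_sqrt_spec[OF J(1,3) that] by simp
  qed
  define FA where "FA = kip m A A"
  define HA where "HA = kip m (kmult m H A) (kmult m H A)"
  define HT where "HT = kip m (kmult m H (ent T)) (kmult m H (ent T))"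
  define HS where "HS = kip m (kmult m H S0) (kmult m H S0)"
  have pr: "penalized_risk n z \<epsilon> e W Q = risk_kernel m n z e H (ent Q) + \<epsilon> * nuclear_norm Q" if "Q \<in> D" for Q
    unfolding H_def using that D W by (intro penalized_risk_kernel) (auto simp: sym_kernels_def)
  have "z j \<in> {..<m} \<times> {..<m} \<times> UNIV" if "j \<in> {1..n}" for j using z[OF that] by (auto simp: \<Omega>_def)
  from penalized_risk_strongly_convex[OF W D this less_imp_le[OF \<open>0 < \<epsilon>\<close>] T min S]
  have "penalized_risk n z \<epsilon> e W T + (FA / M + e * (HA / M)) \<le> penalized_risk n z \<epsilon> e W S"
    by (simp add: A_def H_def FA_def HA_def M_def)
  moreover have "risk_kernel m n z e H (ent T) - risk_kernel m n z e H S0 =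
      FA / M - 2 * kip m \<Xi> A + e * (HT / M) - e * (HS / M)"
    unfolding FA_def M_def HT_def HS_def \<Xi>_def
    by (rule risk_kernel_difference[OF kA z \<open>1 \<le> n\<close>]) (simp_all add: A_def S0)
  moreover have "0 \<le> e * (HT / M)"
    unfolding HT_def using \<open>0 \<le> e\<close> \<open>0 < M\<close> kip_self_nonneg by (intro mult_nonneg_nonneg divide_nonneg_pos)
  \<comment> \<open>One \<open>FA / M\<close> comes from the difference of the risks, the other from
    strong convexity. Discarding the nonnegative \<open>HT\<close> leaves the bias \<open>HS\<close>
    with factor 1.\<close>
  ultimately have basic: "2 * (FA / M) + e * (HA / M) + \<epsilon> * (nuclear_norm T - nuclear_norm S)
      \<le> e * (HS / M) + 2 * kip m \<Xi> A"
    unfolding pr[OF T] pr[OF S] S0[symmetric] by (simp add: right_diff_distrib)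
  obtain \<nu> \<eta> where o': "orthonormal_on m {..<m} \<eta>"
    and e': "\<And>i j. i < m \<Longrightarrow> j < m \<Longrightarrow> ent T i j = spec {..<m} \<nu> \<eta> i j"
    by (rule spectral_theorem[OF sym_kernels_ksym[OF sk(1)]]) blast
  have nn: "nuclear_norm T = (\<Sum>k<m. \<bar>\<nu> k\<bar>)" "nuclear_norm S = (\<Sum>k<m. \<bar>\<mu> k\<bar>)"
    by (rule nuclear_norm_spectral[OF c(1) o' e'], assumption+)
      (rule nuclear_norm_spectral[OF c(2) o e\<psi>], assumption+)
  define V where "V = comp_part m (R \<psi> \<mu>) \<Xi>"
  define Gs where "Gs = spec {..<m} (\<lambda>k. sgn (\<mu> k)) \<psi>"
  have "ksym m \<Xi>"
    unfolding \<Xi>_def noise_def ksym_def using ksym_cen by (auto simp: ksym_def intro!: sum.cong)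
  then have dual: "2 * kip m \<Xi> A - \<epsilon> * (nuclear_norm T - nuclear_norm S) \<le> 2 * kip m V A - \<epsilon> * kip m Gs A"
    unfolding nn V_def Gs_def R_def
    by (intro nuclear_penalty_bound[OF o o' _ \<open>0 < \<epsilon>\<close>]) (use good1 e' e\<psi> in \<open>auto simp: \<Xi>_def A_def\<close>)
  define NA where "NA = (\<Sum>k\<in>?J. a k * nsq m (kapp m A (?f k)))"
  define \<omega> where "\<omega> = (\<Sum>k\<in>?J. 1 / a k * nsq m (kapp m (P \<psi> \<mu>) (?f k)))"
  \<comment> \<open>With this factor the two applications of \<open>kip_weighted_AM_GM\<close>
    together use up \<open>NA / M\<close>, which one copy of \<open>FA / M + e * (HA / M)\<close>
    absorbs.\<close>
  have \<kappa>: "0 < 1 / (2 * M)" using \<open>0 < M\<close> by simp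
  have "2 * kip m V A \<le> wnorm \<psi> \<mu> ?J ?f a \<Xi> / (1 / (2 * M)) + 1 / (2 * M) * NA"
    unfolding V_def NA_def wnorm_def by (rule kip_weighted_AM_GM[OF J a(1) \<kappa>])
  also have "\<dots> \<le> \<Theta> / (1 / (2 * M)) + 1 / (2 * M) * NA"
    using good2 \<kappa> by (intro add_right_mono divide_right_mono) (auto simp: \<Xi>_def)
  finally have am1: "2 * kip m V A \<le> 2 * M * \<Theta> + NA / (2 * M)" by (simp add: mult.commute)
  \<comment> \<open>The square of \<open>sgn\<close> is the indicator of the nonzero eigenvalues, so
    \<open>Gs\<close> and \<open>P\<close> have images of equal length.\<close>
  have kG: "nsq m (kapp m (\<lambda>i j. - (\<epsilon> / 2) * Gs i j) x) =
      \<epsilon>\<^sup>2 / 4 * nsq m (kapp m (P \<psi> \<mu>) x)" for x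
  proof -
    have "kapp m (\<lambda>i j. - (\<epsilon> / 2) * Gs i j) x = (\<lambda>i. - (\<epsilon> / 2) * kapp m Gs x i)"
      by (rule ext) (rule kapp_scale_kernel)
    then have "nsq m (kapp m (\<lambda>i j. - (\<epsilon> / 2) * Gs i j) x) =
        (- (\<epsilon> / 2)) * ((- (\<epsilon> / 2)) * nsq m (kapp m Gs x))"
      by (simp only: ip_scale_left ip_scale_right)
    also have "nsq m (kapp m Gs x) = nsq m (kapp m (P \<psi> \<mu>) x)"
      unfolding Gs_def P_def norm_kapp_spec[OF finite_lessThan o]
      by (intro sum.cong refl) (auto simp: sgn_if)
    finally show ?thesis by (simp add: power2_eq_square)
  qed
  have "2 * kip m (\<lambda>i j. - (\<epsilon> / 2) * Gs i j) A \<le> (\<Sum>k\<in>?J. 1 / a k *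
      nsq m (kapp m (\<lambda>i j. - (\<epsilon> / 2) * Gs i j) (?f k))) / (1 / (2 * M))
      + 1 / (2 * M) * NA"
    unfolding NA_def by (rule kip_weighted_AM_GM[OF J a(1) \<kappa>])
  also have "(\<Sum>k\<in>?J. 1 / a k *
      nsq m (kapp m (\<lambda>i j. - (\<epsilon> / 2) * Gs i j) (?f k))) = \<epsilon>\<^sup>2 / 4 * \<omega>"
    unfolding kG \<omega>_def sum_distrib_left by (simp only: mult.left_commute)
  finally have am2: "- \<epsilon> * kip m Gs A \<le> M * \<epsilon>\<^sup>2 / 2 * \<omega> + NA / (2 * M)"
    unfolding kip_scale_left by (simp add: field_simps)
  have "NA \<le> (\<Sum>k\<in>?J. (1 + e * \<bar>lam k\<bar>) * nsq m (kapp m A (?f k)))"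
    unfolding NA_def by (intro sum_mono mult_right_mono a ip_self_nonneg)
  also have "\<dots> = FA + e * HA"
    unfolding HA_def hH[OF kA] FA_def kip_basis[OF J, where A = A and B = A]
    by (simp add: distrib_right sum.distrib sum_distrib_left mult.assoc)
  finally have "NA / M \<le> (FA + e * HA) / M" using \<open>0 < M\<close> by (intro divide_right_mono) auto
  then have na: "NA / (2 * M) + NA / (2 * M) \<le> FA / M + e * (HA / M)"
    by (simp add: add_divide_distrib)
  have "FA / M \<le> e * (HS / M) + 2 * M * \<Theta> + M * \<epsilon>\<^sup>2 / 2 * \<omega>"
    using basic dual am1 am2 na by linarith
  moreover have "L2_sq (T - S) = FA / M"
    unfolding L2_sq_kip[OF minus_carrier_mat[OF c(2)]] FA_def M_def
    by (intro arg_cong[where f = "\<lambda>x. x / _"] kip_cong) (use c in \<open>auto simp: A_def\<close>)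
  moreover have "L2_sq (mat_fun sqrt W * S) = HS / M"
    unfolding penalized_risk_kernel(2)[OF c(2) W] HS_def M_def H_def S0 ..
  ultimately show ?thesis by (simp add: M_def \<omega>_def)
qed

end

section \<open>The oracle inequality\<close>

text \<open>
  On one vertex the Laplacian vanishes, while \<open>\<lambda>\<^bsub>k0\<^esub> > 0\<close>.  Excluding this case matters: with \<open>m \<ge> 2\<close>
  the matrix tail bound leaves room for the failure probability of the vector tail bound.
\<close>

lemma vertices_ge_2:
  assumes g: "simple_graph m E" and es: "orthonormal_eigensystem m (laplacian_power m E d p) lam \<phi>"
    and k0: "k0 \<in> {1..m}" "0 < lam k0"
  shows "2 \<le> m"
proof (rule ccontr)
  assume "\<not> 2 \<le> m"
  then have m: "m = 1" "k0 = 1" using k0(1) by auto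
  have "E = {}"
  proof (rule ccontr)
    assume "E \<noteq> {}"
    then obtain e where "e \<in> E" by blast
    then have "e \<subseteq> {..<1::nat}" "card e = 2" using g m by (auto simp: simple_graph_def)
    then show False using card_mono[of "{..<1::nat}" e] by simp
  qed
  define L where "L = laplacian m E"
  have L1: "L \<in> carrier_mat 1 1"
    unfolding L_def laplacian_def adjacency_mat_def using m by (intro minus_carrier_mat) simp
  have L2: "L $$ (0, 0) = 0"
    using \<open>E = {}\<close> m by (simp add: L_def laplacian_def degree_mat_def adjacency_mat_def)
  note L = L1 L2
  have "x = 0" if x: "x \<in> spectrum L" for x
  proof -
    obtain v where v: "v \<in> carrier_vec 1" "v \<noteq> 0\<^sub>v 1" "L *\<^sub>v v = x \<cdot>\<^sub>v v"
      using x carrier_matD[OF L(1)] by (auto simp: spectrum_def eigenvalue_def eigenvector_def)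
    have "vec_index (L *\<^sub>v v) 0 = 0"
      using mult_mat_vec_kapp[OF L(1) v(1), of 0] L(2) by (simp add: kapp_def)
    then have "x * vec_index v 0 = 0" using v by simp
    moreover have "vec_index v 0 \<noteq> 0" using v(1,2) by (auto simp: Matrix.vec_eq_iff)
    ultimately show "x = 0" by simp
  qed
  then have "(\<Sum>x\<in>spectrum L. x powr p * vec_index (orth_proj (mat_kernel (char_matrix L x)) (unit_vec 1 0)) 0) = 0"
    by (intro sum.neutral) auto
  then have W: "laplacian_power m E d p \<in> carrier_mat 1 1" "laplacian_power m E d p $$ (0, 0) = 0"
    using carrier_matD[OF L(1)] unfolding laplacian_power_def L_def[symmetric] by (simp_all add: mat_fun_def)
  have \<phi>: "\<phi> 1 \<in> carrier_vec 1" "laplacian_power m E d p *\<^sub>v \<phi> 1 = lam 1 \<cdot>\<^sub>v \<phi> 1" "scalar_prod (\<phi> 1) (\<phi> 1) = 1"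
    using es m by (auto simp: orthonormal_eigensystem_def)
  have "vec_index (laplacian_power m E d p *\<^sub>v \<phi> 1) 0 = 0"
    using mult_mat_vec_kapp[OF W(1) \<phi>(1), of 0] W(2) by (simp add: kapp_def)
  then have "lam 1 * vec_index (\<phi> 1) 0 = 0" using \<phi>(1,2) by simp
  moreover have "vec_index (\<phi> 1) 0 \<noteq> 0" using \<phi>(3) scalar_prod_ip[OF \<phi>(1), of "\<phi> 1"] by (auto simp: ip_def)
  ultimately show False using k0(2) m by simp
qed

section \<open>The law of the sample\<close>

context prob_space
begin

text \<open>Turns the weighted sums of the tail bounds into probabilities. The set \<open>B\<close>
  is arbitrary, which also supplies measurability for events that depend on the sample
  alone.\<close>

lemma iid_joint_law:
  fixes Zs :: "nat \<Rightarrow> 'a \<Rightarrow> nat \<times> nat \<times> real"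
  assumes iid: "iid_copies m M Z n Zs" and "1 \<le> n"
    and Z: "Z \<in> measurable M (count_space ({..<m} \<times> {..<m} \<times> {-1, 1}))"
    and B: "B \<subseteq> PiE {1..n} (\<lambda>_. {..<m} \<times> {..<m} \<times> {-1, 1})"
  shows "{\<omega> \<in> space M. restrict (\<lambda>j. Zs j \<omega>) {1..n} \<in> B} \<in> events"
    and "prob {\<omega> \<in> space M. restrict (\<lambda>j. Zs j \<omega>) {1..n} \<in> B} =
      (\<Sum>z\<in>B. \<Prod>j=1..n. prob {\<omega> \<in> space M. Z \<omega> = z j})"
proof -
  let ?\<Omega> = "{..<m} \<times> {..<m} \<times> {-1, 1 :: real}"
  let ?N = "count_space ?\<Omega>"
  have ind: "indep_vars (\<lambda>_. ?N) Zs {1..n}" and id: "\<And>j. j \<in> {1..n} \<Longrightarrow> distr M ?N (Zs j) = distr M ?N Z"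
    using iid by (auto simp: iid_copies_def Let_def)
  have Zs: "Zs j \<in> measurable M ?N" if "j \<in> {1..n}" for j
    using ind that by (auto simp: indep_vars_def)
  have finB: "finite B" using B by (rule finite_subset) (auto intro!: finite_PiE)
  define ev where "ev z = (\<Inter>j\<in>{1..n}. Zs j -` {z j} \<inter> space M)" for z
  have evm: "ev z \<in> events" if "z \<in> PiE {1..n} (\<lambda>_. ?\<Omega>)" for z
    unfolding ev_def using \<open>1 \<le> n\<close> that
    by (intro sets.finite_INT measurable_sets[OF Zs]) (auto simp: PiE_iff)
  have pr: "prob (ev z) = (\<Prod>j=1..n. prob {\<omega> \<in> space M. Z \<omega> = z j})" if z: "z \<in> PiE {1..n} (\<lambda>_. ?\<Omega>)" for z
  proof -
    have "prob (ev z) = (\<Prod>j\<in>{1..n}. prob (Zs j -` {z j} \<inter> space M))"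
      unfolding ev_def using \<open>1 \<le> n\<close> z by (intro indep_varsD[OF ind]) (auto simp: PiE_iff)
    also have "\<dots> = (\<Prod>j=1..n. prob {\<omega> \<in> space M. Z \<omega> = z j})"
    proof (intro prod.cong refl)
      fix j assume j: "j \<in> {1..n}"
      then have s: "{z j} \<in> sets ?N" using z by (auto simp: PiE_iff)
      have "prob (Zs j -` {z j} \<inter> space M) = measure (distr M ?N (Zs j)) {z j}"
        by (rule measure_distr[OF Zs[OF j] s, symmetric])
      also have "\<dots> = prob (Z -` {z j} \<inter> space M)" unfolding id[OF j] by (rule measure_distr[OF Z s])
      also have "Z -` {z j} \<inter> space M = {\<omega> \<in> space M. Z \<omega> = z j}" by auto
      finally show "prob (Zs j -` {z j} \<inter> space M) = prob {\<omega> \<in> space M. Z \<omega> = z j}" .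
    qed
    finally show ?thesis .
  qed
  have U: "{\<omega> \<in> space M. restrict (\<lambda>j. Zs j \<omega>) {1..n} \<in> B} = (\<Union>z\<in>B. ev z)"
  proof (intro Set.set_eqI iffI)
    fix \<omega> assume "\<omega> \<in> {\<omega> \<in> space M. restrict (\<lambda>j. Zs j \<omega>) {1..n} \<in> B}"
    then show "\<omega> \<in> (\<Union>z\<in>B. ev z)"
      by (intro UN_I[of "restrict (\<lambda>j. Zs j \<omega>) {1..n}"]) (auto simp: ev_def)
  next
    fix \<omega> assume "\<omega> \<in> (\<Union>z\<in>B. ev z)"
    then obtain z where z: "z \<in> B" "\<omega> \<in> ev z" by blast
    then have "restrict (\<lambda>j. Zs j \<omega>) {1..n} = z"
      using B by (intro extensionalityI[of _ "{1..n}"]) (auto simp: ev_def PiE_iff)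
    moreover have "\<omega> \<in> space M" using z(2) \<open>1 \<le> n\<close> by (auto simp: ev_def)
    ultimately show "\<omega> \<in> {\<omega> \<in> space M. restrict (\<lambda>j. Zs j \<omega>) {1..n} \<in> B}" using z(1) by simp
  qed
  show "{\<omega> \<in> space M. restrict (\<lambda>j. Zs j \<omega>) {1..n} \<in> B} \<in> events"
    unfolding U using finB evm B by (intro sets.finite_UN) auto
  have "disjoint_family_on ev B"
    unfolding disjoint_family_on_def
  proof (intro ballI impI)
    fix z z' assume zz: "z \<in> B" "z' \<in> B" "z \<noteq> z'"
    show "ev z \<inter> ev z' = {}"
    proof (rule ccontr)
      assume "ev z \<inter> ev z' \<noteq> {}"
      then obtain \<omega> where w: "\<omega> \<in> ev z" "\<omega> \<in> ev z'" by blast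
      then have "z = z'"
        using B zz(1,2) by (intro extensionalityI[of _ "{1..n}"]) (auto simp: ev_def PiE_iff)
      then show False using zz(3) by simp
    qed
  qed
  then have "prob (\<Union>z\<in>B. ev z) = (\<Sum>z\<in>B. prob (ev z))"
    using finB evm B by (intro finite_measure_finite_Union) auto
  also have "\<dots> = (\<Sum>z\<in>B. \<Prod>j=1..n. prob {\<omega> \<in> space M. Z \<omega> = z j})"
    using B by (intro sum.cong refl pr) auto
  finally show "prob {\<omega> \<in> space M. restrict (\<lambda>j. Zs j \<omega>) {1..n} \<in> B} =
      (\<Sum>z\<in>B. \<Prod>j=1..n. prob {\<omega> \<in> space M. Z \<omega> = z j})"
    unfolding U .
qed

lemma regression_sampling_model:
  assumes u: "uniform_pair_with_sign_response m M X X' Y" and "2 \<le> m"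
    and sym: "regression_kernel m M X X' Y \<in> sym_kernels m"
  shows "(\<lambda>\<omega>. (X \<omega>, X' \<omega>, Y \<omega>)) \<in> measurable M (count_space ({..<m} \<times> {..<m} \<times> {-1, 1}))"
    and "sampling_model m (\<lambda>w. prob {\<omega> \<in> space M. (X \<omega>, X' \<omega>, Y \<omega>) = w}) (ent (regression_kernel m M X X' Y))"
proof -
  have ind: "indep_var (count_space {..<m}) X (count_space {..<m}) X'"
    and dX: "distr M (count_space {..<m}) X = uniform_count_measure {..<m}"
    and dX': "distr M (count_space {..<m}) X' = uniform_count_measure {..<m}"
    and mY: "Y \<in> measurable M (count_space {-1, 1})"
    using u by (auto simp: uniform_pair_with_sign_response_def)
  note mX = indep_var_rv1[OF ind] and mX' = indep_var_rv2[OF ind]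
  have ev: "{\<omega> \<in> space M. X \<omega> = u \<and> X' \<omega> = v \<and> Y \<omega> = y} \<in> events" if "u < m" "v < m" "y \<in> {-1, 1}" for u v y
  proof -
    have "{\<omega> \<in> space M. X \<omega> = u \<and> X' \<omega> = v \<and> Y \<omega> = y} =
        (X -` {u} \<inter> space M) \<inter> (X' -` {v} \<inter> space M) \<inter> (Y -` {y} \<inter> space M)" by auto
    also have "\<dots> \<in> events"
      using that by (intro sets.Int measurable_sets[OF mX] measurable_sets[OF mX'] measurable_sets[OF mY]) auto
    finally show ?thesis .
  qed
  show "(\<lambda>\<omega>. (X \<omega>, X' \<omega>, Y \<omega>)) \<in> measurable M (count_space ({..<m} \<times> {..<m} \<times> {-1, 1}))"
  proof (subst measurable_count_space_eq2)
    have "(\<lambda>\<omega>. (X \<omega>, X' \<omega>, Y \<omega>)) -` {w} \<inter> space M \<in> events" if w: "w \<in> {..<m} \<times> {..<m} \<times> {-1, 1}" for w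
    proof -
      obtain u v y where w': "w = (u, v, y)" by (cases w)
      have "(\<lambda>\<omega>. (X \<omega>, X' \<omega>, Y \<omega>)) -` {w} \<inter> space M = {\<omega> \<in> space M. X \<omega> = u \<and> X' \<omega> = v \<and> Y \<omega> = y}"
        using w' by auto
      then show ?thesis using ev[of u v y] w w' by auto
    qed
    then show "(\<lambda>\<omega>. (X \<omega>, X' \<omega>, Y \<omega>)) \<in> space M \<rightarrow> {..<m} \<times> {..<m} \<times> {-1, 1} \<and>
        (\<forall>a\<in>{..<m} \<times> {..<m} \<times> {-1, 1}. (\<lambda>\<omega>. (X \<omega>, X' \<omega>, Y \<omega>)) -` {a} \<inter> space M \<in> events)"
      using measurable_space[OF mX] measurable_space[OF mX'] measurable_space[OF mY] by auto
  qed simp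
  define q where "q w = prob {\<omega> \<in> space M. (X \<omega>, X' \<omega>, Y \<omega>) = w}" for w
  have Y1: "Y \<omega> = -1 \<or> Y \<omega> = 1" if "\<omega> \<in> space M" for \<omega> using measurable_space[OF mY that] by auto
  have qm: "q (u, v, -1) + q (u, v, 1) = 1 / (real m)\<^sup>2"
    and qr: "q (u, v, 1) - q (u, v, -1) = regression_kernel m M X X' Y $$ (u, v) / (real m)\<^sup>2"
    if uv: "u < m" "v < m" for u v
  proof -
    define A where "A = {\<omega> \<in> space M. X \<omega> = u \<and> X' \<omega> = v}"
    define A1 where "A1 y = {\<omega> \<in> space M. X \<omega> = u \<and> X' \<omega> = v \<and> Y \<omega> = y}" for y
    have e1: "A1 (-1) \<in> events" "A1 1 \<in> events" unfolding A1_def using ev uv by auto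
    have un: "A = A1 (-1) \<union> A1 1" and dj: "A1 (-1) \<inter> A1 1 = {}" using Y1 by (auto simp: A_def A1_def)
    have q1: "q (u, v, y) = prob (A1 y)" for y
      unfolding q_def A1_def by (rule arg_cong[where f = prob]) auto
    have "prob (X -` {u} \<inter> space M) = measure (distr M (count_space {..<m}) X) {u}"
      using uv by (intro measure_distr[OF mX, symmetric]) auto
    then have pu: "prob (X -` {u} \<inter> space M) = 1 / real m"
      unfolding dX using uv by (simp add: measure_uniform_count_measure)
    have "prob (X' -` {v} \<inter> space M) = measure (distr M (count_space {..<m}) X') {v}"
      using uv by (intro measure_distr[OF mX', symmetric]) auto
    then have pv: "prob (X' -` {v} \<inter> space M) = 1 / real m"
      unfolding dX' using uv by (simp add: measure_uniform_count_measure)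
    have "prob ((\<lambda>\<omega>. (X \<omega>, X' \<omega>)) -` ({u} \<times> {v}) \<inter> space M) = prob (X -` {u} \<inter> space M) * prob (X' -` {v} \<inter> space M)"
      using uv by (intro indep_varD[OF ind]) auto
    moreover have "(\<lambda>\<omega>. (X \<omega>, X' \<omega>)) -` ({u} \<times> {v}) \<inter> space M = A" by (auto simp: A_def)
    ultimately have pA: "prob A = 1 / (real m)\<^sup>2" unfolding pu pv by (simp add: power2_eq_square)
    have "prob A = prob (A1 (-1)) + prob (A1 1)"
      unfolding un by (rule finite_measure_Union[OF e1 dj])
    then show "q (u, v, -1) + q (u, v, 1) = 1 / (real m)\<^sup>2" by (simp add: q1 pA)
    have "(\<integral>\<omega>. Y \<omega> * indicator A \<omega> \<partial>M) = (\<integral>\<omega>. indicator (A1 1) \<omega> - indicator (A1 (-1)) \<omega> \<partial>M)"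
    proof (rule Bochner_Integration.integral_cong[OF refl])
      fix \<omega> assume "\<omega> \<in> space M"
      then show "Y \<omega> * indicator A \<omega> = indicator (A1 1) \<omega> - (indicator (A1 (-1)) \<omega> :: real)"
        using Y1[of \<omega>] by (auto simp: A_def A1_def indicator_def)
    qed
    also have "\<dots> = (\<integral>\<omega>. indicator (A1 1) \<omega> \<partial>M) - (\<integral>\<omega>. indicator (A1 (-1)) \<omega> \<partial>M)"
      using e1 by (intro Bochner_Integration.integral_diff) (auto simp: less_top[symmetric])
    also have "\<dots> = prob (A1 1) - prob (A1 (-1))"
      using e1 by (simp add: A1_def Int_def conj_commute)
    finally have "(\<integral>\<omega>. Y \<omega> * indicator A \<omega> \<partial>M) = q (u, v, 1) - q (u, v, -1)" by (simp add: q1)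
    moreover have "regression_kernel m M X X' Y $$ (u, v) = (\<integral>\<omega>. Y \<omega> * indicator A \<omega> \<partial>M) / prob A"
      using uv by (simp add: regression_kernel_def A_def Let_def)
    ultimately show "q (u, v, 1) - q (u, v, -1) = regression_kernel m M X X' Y $$ (u, v) / (real m)\<^sup>2"
      unfolding pA using \<open>2 \<le> m\<close> by simp
  qed
  show "sampling_model m (\<lambda>w. prob {\<omega> \<in> space M. (X \<omega>, X' \<omega>, Y \<omega>) = w}) (ent (regression_kernel m M X X' Y))"
    using \<open>2 \<le> m\<close> qm qr sym_kernels_ksym[OF sym] unfolding q_def
    by unfold_locales (auto simp: measure_nonneg)
qed

end

text \<open>Strong convexity at one minimiser, evaluated at the other, bounds their distance by 0.
  It serves to show that the estimator depends on the outcome only through the sample.\<close>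

lemma penalized_risk_argmin_unique:
  assumes W: "W \<in> carrier_mat m m" and D: "D \<subseteq> sym_kernels m" "convex_mats D"
    and z: "\<And>j. j \<in> {1..n} \<Longrightarrow> z j \<in> {..<m} \<times> {..<m} \<times> UNIV" and "0 \<le> \<epsilon>" "0 \<le> e" "0 < m"
    and T: "is_arg_min (penalized_risk n z \<epsilon> e W) (\<lambda>S. S \<in> D) T"
    and S: "is_arg_min (penalized_risk n z \<epsilon> e W) (\<lambda>S. S \<in> D) S"
  shows "T = S"
proof -
  let ?\<Delta> = "\<lambda>i j. T $$ (i, j) - S $$ (i, j)" and ?H = "ent (mat_fun sqrt W)"
  have TS: "T \<in> D" "S \<in> D" and min: "\<And>Q. Q \<in> D \<Longrightarrow> penalized_risk n z \<epsilon> e W T \<le> penalized_risk n z \<epsilon> e W Q"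
    and "penalized_risk n z \<epsilon> e W S \<le> penalized_risk n z \<epsilon> e W T"
    using T S by (auto simp: is_arg_min_def not_less)
  then have "kip m ?\<Delta> ?\<Delta> / (real m)\<^sup>2 + e * (kip m (kmult m ?H ?\<Delta>) (kmult m ?H ?\<Delta>) / (real m)\<^sup>2) \<le> 0"
    using penalized_risk_strongly_convex[OF W D z \<open>0 \<le> \<epsilon>\<close> TS(1) min TS(2)] by simp
  moreover have "0 \<le> e * (kip m (kmult m ?H ?\<Delta>) (kmult m ?H ?\<Delta>) / (real m)\<^sup>2)"
    using \<open>0 \<le> e\<close> kip_self_nonneg by (intro mult_nonneg_nonneg divide_nonneg_nonneg) auto
  ultimately have "kip m ?\<Delta> ?\<Delta> / (real m)\<^sup>2 \<le> 0" by linarith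
  then have "kip m ?\<Delta> ?\<Delta> = 0"
    using \<open>0 < m\<close> kip_self_nonneg[of m ?\<Delta>] by (simp add: divide_le_0_iff)
  then have "\<forall>i\<in>{..<m}. (\<Sum>j<m. ?\<Delta> i j * ?\<Delta> i j) = 0"
    unfolding kip_def by (subst (asm) sum_nonneg_eq_0_iff) (auto intro!: sum_nonneg)
  then have "T $$ (i, j) = S $$ (i, j)" if "i < m" "j < m" for i j
    using that by (auto simp: sum_nonneg_eq_0_iff)
  moreover have "T \<in> carrier_mat m m" "S \<in> carrier_mat m m" using TS D by (auto simp: sym_kernels_def)
  ultimately show ?thesis by (intro eq_matI) auto
qed

text \<open>The first summand is at most \<open>3/4 * exp (- t)\<close>, the second at most
  \<open>2/8 * exp (- t)\<close>.\<close>

lemma failure_probability_arith: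
  fixes t T0 T :: real
  assumes "2 \<le> m" "0 < t" and T0: "T0 = t + ln (2 * real m)" and T: "t + ln (2 * real m * 4) \<le> T"
  shows "2 * real m * exp (- (5/4 * T0)) + 2 * exp (- T) \<le> exp (- t)"
proof -
  have m: "4 \<le> 2 * real m" using assms(1) by simp
  \<comment> \<open>The gain from the exponent 5/4, equal to the fourth root of
    \<open>1 / (2 m)\<close>. It is at most 3/4 since \<open>1/4 \<le> (3/4) ^ 4\<close>.\<close>
  define h where "h = exp (- (1/4 * ln (2 * real m)))"
  have "h ^ 4 = exp (- ln (2 * real m))" unfolding h_def exp_of_nat_mult[symmetric] by simp
  also have "\<dots> = 1 / (2 * real m)" using m by (simp add: exp_minus field_simps)
  also have "\<dots> \<le> 1 / 4" using m by (intro divide_left_mono) auto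
  also have "\<dots> \<le> (3/4) ^ 4" by (simp add: power4_eq_xxxx)
  finally have h: "h \<le> 3/4" by (rule power_le_imp_le_base[of _ 3, simplified]) auto
  have "2 * real m * exp (- (5/4 * T0)) = exp (ln (2 * real m)) * exp (- (5/4 * T0))" using m by simp
  also have "\<dots> = h * exp (- (5/4 * t))"
    unfolding h_def T0 exp_add[symmetric] by (simp add: algebra_simps)
  also have "\<dots> \<le> 3/4 * exp (- t)" using h assms(2) by (intro mult_mono) auto
  finally have 1: "2 * real m * exp (- (5/4 * T0)) \<le> 3/4 * exp (- t)" .
  have "exp (- T) \<le> exp (- (t + ln (2 * real m * 4)))" using T by simp
  also have "\<dots> = exp (- t) * (1 / (2 * real m * 4))"
    using m by (simp add: exp_diff exp_minus field_simps)
  also have "\<dots> \<le> exp (- t) * (1 / 8)" using m by (intro mult_left_mono divide_left_mono) auto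
  finally show ?thesis using 1 by simp
qed

text \<open>The coefficient \<open>8 * (5 + 3 * c)\<close> is \<open>8 * (3 + 2 * c)\<close> from
  the variance of the noise plus \<open>8 * (2 + c)\<close> from the sign term of the penalty. The
  coefficient 64 is \<open>2 * 4 * 8\<close>, with 8 from \<open>wnorm_cen_le\<close> and 4 from the
  tail level.\<close>

theorem estimator_bound:
  fixes c t \<zeta> e d p :: real and m n :: nat and E :: "nat set set" and lam :: "nat \<Rightarrow> real"
    and X X' :: "'a \<Rightarrow> nat" and Y :: "'a \<Rightarrow> real" and M :: "'a measure" and Zs :: "nat \<Rightarrow> 'a \<Rightarrow> nat \<times> nat \<times> real"
  assumes "0 < c"
  defines "W \<equiv> laplacian_power m E d p"
  defines "Sstar \<equiv> regression_kernel m M X X' Y"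
  defines "L \<equiv> support m Sstar"
  defines "T \<equiv> t + ln (2 * real m * (log 2 (4 * real n powr \<zeta> * real m powr ((3/2) * \<zeta>)) + 2))"
  defines "\<epsilon> \<equiv> 4 * sqrt ((t + ln (2 * real m)) / (real n * real m))"
  assumes g: "simple_graph m E" and es: "orthonormal_eigensystem m W lam \<phi>"
    and k0: "k0 \<in> {1..m}" "0 < lam k0" and "1 \<le> \<zeta>"
    and tail: "\<forall>s\<in>{k0..m}. (\<Sum>k=s..m. 1 / lam k) \<le> c * (real s / lam s)"
    and ps: "prob_space M" and u: "uniform_pair_with_sign_response m M X X' Y"
    and sym: "Sstar \<in> sym_kernels m" and n: "1 \<le> n"
    and iid: "iid_copies m M (\<lambda>\<omega>. (X \<omega>, X' \<omega>, Y \<omega>)) n Zs"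
    and D: "D \<subseteq> sym_kernels m" "convex_mats D" "Sstar \<in> D"
    and "0 < t" and Tn: "real m * T \<le> real n"
    and s: "s \<in> {k0 + 1..m + 1}" and e: "(if s = m + 1 then 0 else 1 / lam s) \<le> e"
    and Shat: "\<forall>\<omega>\<in>space M. is_arg_min (penalized_risk n (\<lambda>j. Zs j \<omega>) \<epsilon> e W) (\<lambda>S. S \<in> D) (Shat \<omega>)"
  shows "measure M {\<omega> \<in> space M. L2_sq (Shat \<omega> - Sstar) \<le>
      8 * (5 + 3 * c) * (coherence m L \<phi> s * real m * T / real n) + e * L2_sq (mat_fun sqrt W * Sstar)
      + 64 * (MAX v\<in>{..<m}. norm_sq (orth_proj L (unit_vec m v))) * (real m * T / real n)\<^sup>2} \<ge> 1 - exp (- t)"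
proof -
  interpret prob_space M by (rule ps)
  have m2: "2 \<le> m" by (rule vertices_ge_2[OF g es[unfolded W_def] k0])
  have Wc: "W \<in> carrier_mat m m"
    by (simp add: W_def laplacian_power_def mat_fun_def laplacian_def adjacency_mat_def)
  define q where "q w = prob {\<omega> \<in> space M. (X \<omega>, X' \<omega>, Y \<omega>) = w}" for w
  note Zm = regression_sampling_model(1)[OF u m2 sym[unfolded Sstar_def]]
  interpret sampling_model m q "ent Sstar"
    using regression_sampling_model(2)[OF u m2 sym[unfolded Sstar_def]] unfolding q_def Sstar_def .
  let ?f = "\<lambda>k. vent (\<phi> k)" and ?J = "{1..m}"
  note J = eigensystem_kernel[OF es]
  have Sc: "Sstar \<in> carrier_mat m m" using sym by (simp add: sym_kernels_def)
  obtain \<mu> \<psi> where o: "orthonormal_on m {..<m} \<psi>"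
    and e\<psi>: "\<And>i j. i < m \<Longrightarrow> j < m \<Longrightarrow> ent Sstar i j = spec {..<m} \<mu> \<psi> i j"
    by (rule spectral_theorem[OF sym_kernels_ksym[OF sym]]) blast
  let ?P = "P \<psi> \<mu>"
  have proj: "orth_proj L x = Matrix.vec m (kapp m ?P (vent x))" if "x \<in> carrier_vec m" for x
    unfolding L_def P_def by (rule orth_proj_support[OF Sc o e\<psi> that])
  have nproj: "norm_sq (orth_proj L x) = nsq m (kapp m ?P (vent x))" if "x \<in> carrier_vec m" for x
    unfolding proj[OF that] norm_sq_def by (subst scalar_prod_ip[of _ m]) (auto intro: ip_cong)
  define f where "f k = nsq m (kapp m ?P (?f k))" for k
  have fk: "norm_sq (orth_proj L (\<phi> k)) = f k" if "k \<in> ?J" for k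
    unfolding f_def using es that by (intro nproj) (simp add: orthonormal_eigensystem_def)
  define \<rho> where "\<rho> = coherence m L \<phi> s"
  define U where "U = (MAX v\<in>{..<m}. norm_sq (orth_proj L (unit_vec m v)))"
  have U: "(\<Sum>i<m. (?P i v)\<^sup>2) \<le> U" if "v < m" for v
  proof -
    have "kapp m ?P (vent (unit_vec m v)) i = ?P i v" for i
    proof -
      have "kapp m ?P (vent (unit_vec m v)) i = (\<Sum>j<m. ?P i j * (if j = v then 1 else 0))"
        unfolding kapp_def using that by (intro sum.cong refl) auto
      then show ?thesis using that by (simp only: sum_mult_delta finite_lessThan lessThan_iff)
    qed
    then have "norm_sq (orth_proj L (unit_vec m v)) = (\<Sum>i<m. (?P i v)\<^sup>2)"
      by (subst nproj) (simp_all add: ip_def power2_eq_square)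
    then show ?thesis unfolding U_def using that by (metis Max_ge finite_imageI finite_lessThan imageI lessThan_iff)
  qed
  have sk: "k0 + 1 \<le> s" "s \<le> m + 1" "1 \<le> k0" using s k0 by auto
  have coh: "real l * (1 / real j * (\<Sum>i=1..j. f i)) \<le> \<rho>"
    if lj: "1 \<le> l" "l \<le> min s m" "l \<le> j" "j \<le> m" for l j
  proof -
    let ?g = "\<lambda>j. (1 / real j) * (\<Sum>i=1..j. norm_sq (orth_proj L (\<phi> i)))"
    have "(\<Sum>i=1..j. f i) = (\<Sum>i=1..j. norm_sq (orth_proj L (\<phi> i)))"
      using lj fk by (intro sum.cong refl) auto
    then have "real l * (1 / real j * (\<Sum>i=1..j. f i)) = real l * ?g j" by simp
    also have "\<dots> \<le> real l * (MAX j\<in>{l..m}. ?g j)"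
      using lj by (intro mult_left_mono Max_ge) auto
    also have "\<dots> \<le> (MAX l\<in>{1..min s m}. real l * (MAX j\<in>{l..m}. ?g j))"
      using lj by (intro Max_ge) auto
    also have "\<dots> = \<rho>" using sk by (simp add: \<rho>_def coherence_def)
    finally show ?thesis .
  qed
  have mono: "lam i \<le> lam j" if "1 \<le> i" "i \<le> j" "j \<le> m" for i j
    using es that by (auto simp: orthonormal_eigensystem_def mono_on_def)
  define a where "a = (\<lambda>k. if k < s then 1 else e * lam k)"
  have tail': "(\<Sum>k=s..m. 1 / lam k) \<le> c * (real s / lam s)" if "s \<le> m" using tail sk that by simp
  have e': "1 / lam s \<le> e" if "s \<le> m" using e that by simp
  have f0: "0 \<le> f k" for k unfolding f_def by (rule ip_self_nonneg)
  note w = coherence_weighted_sums[OF sk k0(2) mono f0 \<open>0 < c\<close> tail' e' coh]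
  have a1: "1 \<le> a k" if "k \<in> ?J" for k unfolding a_def using w(1) that by simp
  have w1: "(\<Sum>k\<in>?J. 1 / a k * f k) \<le> (2 + c) * \<rho>" unfolding a_def by (rule w(2))
  have w2: "(\<Sum>k\<in>?J. 1 / a k * ((\<Sum>i=1..m. f i) / real m)) \<le> (1 + c) * \<rho>"
    unfolding a_def by (rule w(3))
  have e0: "0 \<le> e"
  proof (cases "s = m + 1")
    case False
    then have "0 < lam s" using mono[of k0 s] k0 sk by simp
    then have "0 \<le> 1 / lam s" by simp
    also have "\<dots> \<le> e" using e False by simp
    finally show ?thesis .
  qed (use e in simp)
  have "kip m ?P ?P = (\<Sum>k\<in>?J. f k)" unfolding f_def by (rule kip_basis[OF J])
  then have "(\<Sum>k\<in>?J. 1 / a k * (f k + kip m ?P ?P / real m)) \<le> (3 + 2 * c) * \<rho>"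
    using w1 w2 by (simp add: distrib_left sum.distrib algebra_simps)
  then have var: "(\<Sum>k\<in>?J. 1 / a k * (nsq m (kapp m ?P (?f k)) + kip m ?P ?P / real m)) / real m
      \<le> (3 + 2 * c) * \<rho> / real m"
    unfolding f_def[symmetric] by (intro divide_right_mono) auto
  define T0 where "T0 = t + ln (2 * real m)"
  have mn: "0 < real m" "0 < real n" "1 \<le> real n" "1 \<le> real m" using m2 n by auto
  \<comment> \<open>Both powers are at least 1, so the logarithm is at least 2; the resulting factor
    4 is what \<open>failure_probability_arith\<close> asks of \<open>T\<close>.\<close>
  have "4 \<le> log 2 (4 * real n powr \<zeta> * real m powr ((3/2) * \<zeta>)) + 2"
  proof -
    have "1 \<le> real n powr \<zeta>" "1 \<le> real m powr ((3/2) * \<zeta>)"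
      using mn \<open>1 \<le> \<zeta>\<close> by (auto intro!: ge_one_powr_ge_zero)
    then have "1 * 1 \<le> real n powr \<zeta> * real m powr ((3/2) * \<zeta>)" by (intro mult_mono) auto
    then have "2 powr 2 \<le> 4 * real n powr \<zeta> * real m powr ((3/2) * \<zeta>)" by simp
    then have "log 2 (2 powr 2) \<le> log 2 (4 * real n powr \<zeta> * real m powr ((3/2) * \<zeta>))"
      by (subst log_le_cancel_iff) auto
    moreover have "log 2 (2 powr 2) = (2::real)" by (rule log_powr_cancel) auto
    ultimately show ?thesis by linarith
  qed
  then have "2 * real m * 4 \<le> 2 * real m * (log 2 (4 * real n powr \<zeta> * real m powr ((3/2) * \<zeta>)) + 2)"
    using mn by (intro mult_left_mono) auto
  then have T4: "t + ln (2 * real m * 4) \<le> T" unfolding T_def using mn by (subst add_le_cancel_left, subst ln_le_cancel_iff) auto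
  have T0: "0 < T0" "T0 \<le> T"
  proof -
    show "0 < T0" unfolding T0_def using \<open>0 < t\<close> mn by (intro add_pos_nonneg) auto
    have "ln (2 * real m) \<le> ln (2 * real m * 4)" using mn by (subst ln_le_cancel_iff) auto
    then show "T0 \<le> T" using T4 by (simp add: T0_def)
  qed
  then have "0 < T" by simp
  have "real m * T0 \<le> real n" using T0 mn Tn by (meson mult_left_mono less_imp_le order_trans)
  let ?Pi = "PiE {1..n} (\<lambda>_. \<Omega>)"
  define \<sigma> where "\<sigma> = (3 + 2 * c) * \<rho> / real m"
  define \<Theta> where "\<Theta> = 4 * (real n * \<sigma> * T + 8 * U * T\<^sup>2) / (real n)\<^sup>2"
  define B1 where "B1 = {z. z \<in> ?Pi \<and> (\<exists>x. 2 * sqrt (T0 / (real n * real m)) * nsq m x < \<bar>ip m x (kapp m (noise n z) x)\<bar>)}"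
  define B2 where "B2 = {z. z \<in> ?Pi \<and> \<Theta> < wnorm \<psi> \<mu> ?J ?f a (noise n z)}"
  have b1: "(\<Sum>z\<in>B1. \<Prod>j=1..n. q (z j)) \<le> 2 * real m * exp (- (5/4 * T0))"
    unfolding B1_def by (rule noise_quadratic_tail) fact+
  have b2: "(\<Sum>z\<in>B2. \<Prod>j=1..n. q (z j)) \<le> 2 * exp (- T)"
    unfolding B2_def \<Theta>_def using noise_wnorm_tail[OF o J a1 U var[folded \<sigma>_def] \<open>0 < T\<close> n] .
  have fB: "finite B1" "finite B2" unfolding B1_def B2_def using finite_\<Omega> by (auto intro!: finite_PiE)
  have qn: "0 \<le> q w" for w by (simp add: q_def)
  have "(\<Sum>z\<in>B1 \<union> B2. \<Prod>j=1..n. q (z j)) \<le> (\<Sum>z\<in>B1. \<Prod>j=1..n. q (z j)) + (\<Sum>z\<in>B2. \<Prod>j=1..n. q (z j))"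
    using sum.union_inter[OF fB, of "\<lambda>z. \<Prod>j=1..n. q (z j)"]
      sum_nonneg[of "B1 \<inter> B2" "\<lambda>z. \<Prod>j=1..n. q (z j)"] qn by (simp add: prod_nonneg)
  also have "\<dots> \<le> exp (- t)"
    using b1 b2 failure_probability_arith[OF m2 \<open>0 < t\<close> T0_def T4] by simp
  finally have bad: "(\<Sum>z\<in>B1 \<union> B2. \<Prod>j=1..n. q (z j)) \<le> exp (- t)" .
  \<comment> \<open>Restricted to the indices \<open>{1..n}\<close>, so that a sample is an element
    of the extensional product \<open>?Pi\<close>.\<close>
  define zz where "zz \<omega> = restrict (\<lambda>j. Zs j \<omega>) {1..n}" for \<omega>
  have mZ: "Zs j \<in> measurable M (count_space \<Omega>)" if "j \<in> {1..n}" for j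
    using iid that by (auto simp: iid_copies_def Let_def indep_vars_def \<Omega>_def)
  have zz\<Omega>: "zz \<omega> \<in> ?Pi" if "\<omega> \<in> space M" for \<omega>
    unfolding zz_def using measurable_space[OF mZ that] by (intro restrict_PiE_iff[THEN iffD2]) simp
  note law = iid_joint_law[OF iid n Zm, folded \<Omega>_def zz_def q_def]
  have risk: "penalized_risk n (\<lambda>j. Zs j \<omega>) \<epsilon> e W = penalized_risk n (zz \<omega>) \<epsilon> e W" for \<omega>
    unfolding penalized_risk_def zz_def by (intro ext) simp
  have amin: "is_arg_min (penalized_risk n (zz \<omega>) \<epsilon> e W) (\<lambda>S. S \<in> D) (Shat \<omega>)" if "\<omega> \<in> space M" for \<omega>
    using Shat that unfolding risk by blast
  have \<epsilon>: "0 < \<epsilon>" "\<epsilon> / 2 = 2 * sqrt (T0 / (real n * real m))" "\<epsilon>\<^sup>2 = 16 * T0 / (real n * real m)"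
    using T0 mn by (auto simp: \<epsilon>_def T0_def power_mult_distrib)
  define rhs where "rhs = 8 * (5 + 3 * c) * (\<rho> * real m * T / real n) + e * L2_sq (mat_fun sqrt W * Sstar)
      + 64 * U * (real m * T / real n)\<^sup>2"
  have "\<rho> \<ge> 0"
  proof -
    have "0 \<le> real 1 * (1 / real m * (\<Sum>i=1..m. f i))" using f0 by (intro mult_nonneg_nonneg sum_nonneg) auto
    also have "\<dots> \<le> \<rho>" using sk mn m2 by (intro coh) auto
    finally show ?thesis .
  qed
  have det: "L2_sq (Shat \<omega> - Sstar) \<le> rhs" if \<omega>: "\<omega> \<in> space M" and nb: "zz \<omega> \<notin> B1 \<union> B2" for \<omega>
  proof -
    have "L2_sq (Shat \<omega> - Sstar) \<le> e * L2_sq (mat_fun sqrt W * Sstar) + 2 * (real m)\<^sup>2 * \<Theta> + (real m)\<^sup>2 * \<epsilon>\<^sup>2 / 2 *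
      (\<Sum>k\<in>?J. 1 / a k * nsq m (kapp m ?P (?f k)))"
    proof (rule oracle_bound[where n = n and z = "zz \<omega>" and D = D])
      show "zz \<omega> j \<in> \<Omega>" if "j \<in> {1..n}" for j using zz\<Omega>[OF \<omega>] that by (auto simp: PiE_iff)
      show "Shat \<omega> \<in> D" "\<And>S. S \<in> D \<Longrightarrow> penalized_risk n (zz \<omega>) \<epsilon> e W (Shat \<omega>) \<le> penalized_risk n (zz \<omega>) \<epsilon> e W S"
        using amin[OF \<omega>] by (auto simp: is_arg_min_def not_less)
      show "0 < a k" if "k \<in> ?J" for k using a1[OF that] by simp
      show "a k \<le> 1 + e * \<bar>lam k\<bar>" if "k \<in> ?J" for k
        using mult_left_mono[OF abs_ge_self[of "lam k"] e0] mult_nonneg_nonneg[OF e0 abs_ge_zero[of "lam k"]]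
        by (simp add: a_def)
      show "\<bar>ip m x (kapp m (noise n (zz \<omega>)) x)\<bar> \<le> \<epsilon> / 2 * nsq m x" for x
        using nb zz\<Omega>[OF \<omega>] unfolding \<epsilon>(2) B1_def by (auto simp: not_less)
      show "wnorm \<psi> \<mu> ?J ?f a (noise n (zz \<omega>)) \<le> \<Theta>"
        using nb zz\<Omega>[OF \<omega>] unfolding B2_def by (auto simp: not_less)
    qed (use Wc es D n \<epsilon>(1) e0 o e\<psi> in auto)
    also have "2 * (real m)\<^sup>2 * \<Theta> = 8 * (3 + 2 * c) * (\<rho> * real m * T / real n) + 64 * U * (real m * T / real n)\<^sup>2"
      using mn by (simp add: \<Theta>_def \<sigma>_def field_simps power2_eq_square)
    also have "(\<Sum>k\<in>?J. 1 / a k * nsq m (kapp m ?P (?f k))) = (\<Sum>k\<in>?J. 1 / a k * f k)"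
      by (simp only: f_def)
    also have "(real m)\<^sup>2 * \<epsilon>\<^sup>2 / 2 * (\<Sum>k\<in>?J. 1 / a k * f k) \<le> 8 * (2 + c) * (\<rho> * real m * T / real n)"
    proof -
      have "(real m)\<^sup>2 * \<epsilon>\<^sup>2 / 2 = 8 * (real m * T0 / real n)"
        unfolding \<epsilon>(3) using mn by (simp add: power2_eq_square)
      also have "\<dots> \<le> 8 * (real m * T / real n)"
        using T0 mn by (intro mult_left_mono divide_right_mono) auto
      finally have "(real m)\<^sup>2 * \<epsilon>\<^sup>2 / 2 * (\<Sum>k\<in>?J. 1 / a k * f k) \<le> 8 * (real m * T / real n) * ((2 + c) * \<rho>)"
        using w1 \<open>0 < T\<close> mn f0 a1 by (intro mult_mono sum_nonneg mult_nonneg_nonneg) (auto simp: order_trans[OF zero_le_one])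
      then show ?thesis by (simp add: mult_ac)
    qed
    finally show ?thesis by (simp add: rhs_def algebra_simps)
  qed
  define G where "G = {\<omega> \<in> space M. L2_sq (Shat \<omega> - Sstar) \<le> rhs}"
  have B: "B1 \<union> B2 \<subseteq> ?Pi" by (auto simp: B1_def B2_def)
  define bad where "bad = {\<omega> \<in> space M. zz \<omega> \<in> B1 \<union> B2}"
  have badm: "bad \<in> events" and "prob bad \<le> exp (- t)"
    using law[OF B] bad by (auto simp: bad_def)
  \<comment> \<open>The good event is a preimage under the sample map, because equal samples give
    equal minimisers. It must be shown to be an event, as \<open>measure\<close> is 0 on sets that
    are not measurable.\<close>
  have "G = {\<omega> \<in> space M. zz \<omega> \<in> zz ` G}"
  proof (intro Set.set_eqI iffI)
    fix \<omega> assume "\<omega> \<in> {\<omega> \<in> space M. zz \<omega> \<in> zz ` G}"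
    then obtain \<omega>' where w: "\<omega> \<in> space M" "\<omega>' \<in> G" "zz \<omega> = zz \<omega>'" by auto
    then have "\<omega>' \<in> space M" by (simp add: G_def)
    have "Shat \<omega> = Shat \<omega>'"
    proof (rule penalized_risk_argmin_unique[OF Wc D(1,2)])
      show "is_arg_min (penalized_risk n (zz \<omega>) \<epsilon> e W) (\<lambda>S. S \<in> D) (Shat \<omega>)" by (rule amin[OF w(1)])
      show "is_arg_min (penalized_risk n (zz \<omega>) \<epsilon> e W) (\<lambda>S. S \<in> D) (Shat \<omega>')"
        unfolding w(3) by (rule amin[OF \<open>\<omega>' \<in> space M\<close>])
      show "zz \<omega> j \<in> {..<m} \<times> {..<m} \<times> UNIV" if "j \<in> {1..n}" for j
        using PiE_mem[OF zz\<Omega>[OF w(1)] that] by (auto simp: \<Omega>_def)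
    qed (use \<epsilon>(1) e0 m2 in auto)
    then show "\<omega> \<in> G" using w by (simp add: G_def)
  qed (auto simp: G_def)
  moreover have "zz ` G \<subseteq> ?Pi" using zz\<Omega> by (auto simp: G_def)
  ultimately have "G \<in> events" using law(1)[of "zz ` G"] by simp
  have "1 - exp (- t) \<le> 1 - prob bad" using \<open>prob bad \<le> exp (- t)\<close> by simp
  also have "\<dots> = prob (space M - bad)" by (rule prob_compl[OF badm, symmetric])
  also have "\<dots> \<le> prob G"
    using det \<open>G \<in> events\<close> by (intro finite_measure_mono) (auto simp: bad_def G_def)
  finally show ?thesis unfolding G_def rhs_def \<rho>_def U_def .
qed

theorem theorem3:
  fixes c :: real
  assumes "c > 0"
  shows "\<exists>C>0. \<exists>C1>0.
    \<forall>(m::nat) (E::nat set set) (d::real) (p::real) (\<zeta>::real)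
      (lam::nat \<Rightarrow> real) (\<phi>::nat \<Rightarrow> real vec) (k0::nat)
      (M::'a measure) (X::'a \<Rightarrow> nat) (X'::'a \<Rightarrow> nat) (Y::'a \<Rightarrow> real)
      (n::nat) (Z::nat \<Rightarrow> 'a \<Rightarrow> nat \<times> nat \<times> real) (D::real mat set) (t::real).
    let W = laplacian_power m E d p;
        Sstar = regression_kernel m M X X' Y;
        L = support m Sstar;
        tnm = t + ln (2 * real m *
          (log 2 (4 * real n powr \<zeta> * real m powr ((3/2) * \<zeta>)) + 2));
        \<epsilon> = 4 * sqrt ((t + ln (2 * real m)) / (real n * real m))
    in
      simple_graph m E \<and> d > 0 \<and> p > 0 \<and>
      orthonormal_eigensystem m W lam \<phi> \<and>
      k0 \<in> {1..m} \<and> lam k0 > 0 \<and> (\<forall>k\<in>{1..m}. lam k > 0 \<longrightarrow> k0 \<le> k) \<and>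
      \<zeta> \<ge> 1 \<and> lam m \<le> real m powr \<zeta> \<and> lam k0 \<ge> real m powr (- \<zeta>) \<and>
      antimono_on {k0..m} (\<lambda>s. real s / lam s) \<and>
      (\<forall>k\<in>{k0..<m}. lam (k + 1) \<le> c * lam k) \<and>
      (\<forall>s\<in>{k0..m}. (\<Sum>k=s..m. 1 / lam k) \<le> c * (real s / lam s)) \<and>
      prob_space M \<and>
      uniform_pair_with_sign_response m M X X' Y \<and>
      Sstar \<in> sym_kernels m \<and> vec_space.rank m Sstar \<ge> 1 \<and>
      n \<ge> 1 \<and> iid_copies m M (\<lambda>\<omega>. (X \<omega>, X' \<omega>, Y \<omega>)) n Z \<and>
      D \<subseteq> sym_kernels m \<and> closed_mats m D \<and> convex_mats D \<and> Sstar \<in> D \<and>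
      t > 0 \<and> real m * tnm \<le> real n
      \<longrightarrow>
      (\<forall>s\<in>{k0 + 1..m + 1}. \<forall>\<epsilon>'.
         (if s = m + 1 then 0 else 1 / lam s) \<le> \<epsilon>' \<and> \<epsilon>' \<le> 1 / lam (s - 1) \<longrightarrow>
         (\<forall>Shat :: 'a \<Rightarrow> real mat.
           (\<forall>\<omega>\<in>space M. is_arg_min (penalized_risk n (\<lambda>j. Z j \<omega>) \<epsilon> \<epsilon>' W) (\<lambda>S. S \<in> D) (Shat \<omega>))
           \<longrightarrow>
           measure M {\<omega> \<in> space M.
             L2_sq (Shat \<omega> - Sstar) \<le>
               C * (coherence m L \<phi> s * real m * tnm / real n)
               + \<epsilon>' * L2_sq (mat_fun sqrt W * Sstar)
               + C1 * (MAX v\<in>{..<m}. norm_sq (orth_proj L (unit_vec m v)))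
                    * (real m * tnm / real n)\<^sup>2}
           \<ge> 1 - exp (- t)))"
  unfolding Let_def
proof (rule exI[of _ "8 * (5 + 3 * c)"], rule conjI[OF _ exI[of _ 64]], goal_cases)
  case 1
  then show ?case using assms by simp
next
  case 2
  show ?case
    by (rule conjI, simp, intro allI impI ballI, elim conjE, rule estimator_bound[OF assms]) assumption+
qed

end
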